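(* Let $T>0$. For any $c\in W^{2,1}([0,T])$ satisfying $c(T)=0$ and $-c'\in(0,1)$ on $[0,T]$, there exists $\theta_c\in L^1([0,T])$ such that, if $u^\varepsilon_T:\mathbb{R}\to\mathbb{R}$ is smooth for every $\varepsilon>0$, $u^\varepsilon_T\to\mathbf{1}_{(-\infty,0)}$ in $L^1_{\mathrm{loc}}(\mathbb{R})$ as $\varepsilon\to0$, and $u^\varepsilon$ is the unique classical solution of $$-\partial_tu^\varepsilon+u^\varepsilon\partial_xu^\varepsilon=\varepsilon\left(\partial_x^2u^\varepsilon+\theta_c(t)|\partial_xu^\varepsilon|^2\right)\ \text{ in }(0,T)\times\mathbb{R},\qquad u^\varepsilon(T,\cdot)=u^\varepsilon_T,$$ then, for all $1\le p<\infty$, as $\varepsilon\to0$, $u^\varepsilon\to u_c$ strongly in $C([0,T],L^p_{\mathrm{loc}}(\mathbb{R}))$, where $u_c(t,x)=\mathbf{1}\{x\le c(t)\}$.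
   Context: $\mathbf{1}\{x\le c(t)\}$ equals $1$ if $x\le c(t)$ and $0$ otherwise. $L^p_{\mathrm{loc}}$ carries the topology of local $L^p$ convergence.
   Formalization: The terminal data u_T^ε are additionally assumed bounded uniformly in x and in small ε (otherwise the claim fails at t=T for p>1, e.g. bumps of height h, width h^{-p}); "the unique classical solution" is read among bounded solutions, with the equation holding for a.e. t. *)

theory Defs
  imports "HOL-Analysis.Analysis"
begin

definition smooth :: "(real \<Rightarrow> real) \<Rightarrow> bool" where
  "smooth f \<longleftrightarrow> (\<forall>k x. ((deriv ^^ k) f) differentiable (at x))"


subsection \<open>The Sobolev space of order (2,1) on an interval\<close>

text \<open>Test functions are continuously differentiable with compact support in the open interval;
  smooth test functions give the same weak derivatives.\<close>

definition test_function :: "real \<Rightarrow> (real \<Rightarrow> real) \<Rightarrow> (real \<Rightarrow> real) \<Rightarrow> bool" where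
  "test_function T \<phi> \<phi>' \<longleftrightarrow>
     (\<forall>t. (\<phi> has_real_derivative \<phi>' t) (at t)) \<and> continuous_on UNIV \<phi>' \<and>
     (\<exists>a b. 0 < a \<and> a \<le> b \<and> b < T \<and> (\<forall>t. t \<notin> {a..b} \<longrightarrow> \<phi> t = 0))"

definition weak_derivative :: "real \<Rightarrow> (real \<Rightarrow> real) \<Rightarrow> (real \<Rightarrow> real) \<Rightarrow> bool" where
  "weak_derivative T f g \<longleftrightarrow>
     set_integrable lborel {0..T} f \<and> set_integrable lborel {0..T} g \<and>
     (\<forall>\<phi> \<phi>'. test_function T \<phi> \<phi>' \<longrightarrow>
        (LINT t:{0..T}|lborel. f t * \<phi>' t) = - (LINT t:{0..T}|lborel. g t * \<phi> t))"

definition W21 :: "real \<Rightarrow> (real \<Rightarrow> real) set" where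
  "W21 T = {c. \<exists>c1 c2. weak_derivative T c c1 \<and> weak_derivative T c1 c2}"


subsection \<open>Convergence in local Lebesgue spaces\<close>

definition Lp_dist :: "real \<Rightarrow> real set \<Rightarrow> (real \<Rightarrow> real) \<Rightarrow> (real \<Rightarrow> real) \<Rightarrow> real" where
  "Lp_dist p K f g = (LINT x:K|lborel. \<bar>f x - g x\<bar> powr p) powr (1 / p)"

definition Lp_loc :: "real \<Rightarrow> (real \<Rightarrow> real) set" where
  "Lp_loc p = {f. f \<in> borel_measurable borel \<and>
     (\<forall>K. compact K \<longrightarrow> set_integrable lborel K (\<lambda>x. \<bar>f x\<bar> powr p))}"

definition tendsto_Lp_loc ::
  "real \<Rightarrow> ('i \<Rightarrow> real \<Rightarrow> real) \<Rightarrow> (real \<Rightarrow> real) \<Rightarrow> 'i filter \<Rightarrow> bool" where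
  "tendsto_Lp_loc p f g F \<longleftrightarrow>
     g \<in> Lp_loc p \<and> (\<forall>\<^sub>F i in F. f i \<in> Lp_loc p) \<and>
     (\<forall>K. compact K \<longrightarrow> ((\<lambda>i. Lp_dist p K (f i) g) \<longlongrightarrow> 0) F)"

text \<open>Functions of (t, x) are curried, time first.\<close>

definition C_Lp_loc :: "real \<Rightarrow> real \<Rightarrow> (real \<Rightarrow> real \<Rightarrow> real) set" where
  "C_Lp_loc T p = {v. (\<forall>t\<in>{0..T}. v t \<in> Lp_loc p) \<and>
     (\<forall>t\<in>{0..T}. tendsto_Lp_loc p v (v t) (at t within {0..T}))}"

definition tendsto_C_Lp_loc ::
  "real \<Rightarrow> real \<Rightarrow> ('i \<Rightarrow> real \<Rightarrow> real \<Rightarrow> real) \<Rightarrow> (real \<Rightarrow> real \<Rightarrow> real) \<Rightarrow> 'i filter \<Rightarrow> bool"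
  where
  "tendsto_C_Lp_loc T p v w F \<longleftrightarrow>
     w \<in> C_Lp_loc T p \<and> (\<forall>\<^sub>F i in F. v i \<in> C_Lp_loc T p) \<and>
     (\<forall>K. compact K \<longrightarrow>
        uniform_limit {0..T} (\<lambda>i t. Lp_dist p K (v i t) (w t)) (\<lambda>t. 0) F)"


subsection \<open>The viscous terminal value problem\<close>

text \<open>
  The coefficient \<open>\<theta>\<close> is only an integrable function of time, defined up to null sets, so a
  solution cannot be asked to be continuously differentiable in time: if it were, an everywhere
  essentially discontinuous \<open>\<theta>\<close> would admit no solution with nonconstant terminal value.
  Accordingly \<open>u\<close> is twice continuously differentiable in \<open>x\<close>, locally absolutely continuous in
  \<open>t\<close> (it is the integral of its time derivative \<open>ut\<close>), and the equation holds at almost every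
  time and every point. For continuous \<open>\<theta>\<close> the time derivative is then continuous and the
  equation holds everywhere, so these are the usual classical solutions.

  Solutions are bounded; this is the class in which uniqueness is understood.
\<close>

definition classical_solution ::
  "real \<Rightarrow> real \<Rightarrow> (real \<Rightarrow> real) \<Rightarrow> (real \<Rightarrow> real) \<Rightarrow> (real \<Rightarrow> real \<Rightarrow> real) \<Rightarrow> bool" where
  "classical_solution T \<epsilon> \<theta> uT u \<longleftrightarrow>
     continuous_on ({0..T} \<times> UNIV) (\<lambda>(t, x). u t x) \<and>
     (\<exists>B. \<forall>t\<in>{0..T}. \<forall>x. \<bar>u t x\<bar> \<le> B) \<and>
     (\<forall>x. u T x = uT x) \<and>
     (\<exists>ut ux uxx.
        (\<forall>t\<in>{0<..<T}. \<forall>x. (u t has_real_derivative ux t x) (at x)) \<and>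
        (\<forall>t\<in>{0<..<T}. \<forall>x. (ux t has_real_derivative uxx t x) (at x)) \<and>
        continuous_on ({0<..<T} \<times> UNIV) (\<lambda>(t, x). ux t x) \<and>
        continuous_on ({0<..<T} \<times> UNIV) (\<lambda>(t, x). uxx t x) \<and>
        (\<forall>x a b. 0 < a \<and> a \<le> b \<and> b < T \<longrightarrow>
           set_integrable lborel {a..b} (\<lambda>t. ut t x) \<and>
           u b x - u a x = (LINT t:{a..b}|lborel. ut t x)) \<and>
        (AE t in lborel. t \<in> {0<..<T} \<longrightarrow>
           (\<forall>x. ((\<lambda>s. u s x) has_real_derivative ut t x) (at t) \<and>
              - ut t x + u t x * ux t x = \<epsilon> * (uxx t x + \<theta> t * \<bar>ux t x\<bar>\<^sup>2))))"

definition unique_classical_solution ::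
  "real \<Rightarrow> real \<Rightarrow> (real \<Rightarrow> real) \<Rightarrow> (real \<Rightarrow> real) \<Rightarrow> (real \<Rightarrow> real \<Rightarrow> real) \<Rightarrow> bool" where
  "unique_classical_solution T \<epsilon> \<theta> uT u \<longleftrightarrow>
     classical_solution T \<epsilon> \<theta> uT u \<and>
     (\<forall>v. classical_solution T \<epsilon> \<theta> uT v \<longrightarrow> (\<forall>t\<in>{0..T}. \<forall>x. v t x = u t x))"

text \<open>
  Convergence of the terminal data in the local space of exponent 1 has to be read for a family
  bounded uniformly in space and in small \<open>\<epsilon>\<close>. Without this bound it does not imply local
  convergence for an exponent p > 1 even at the terminal time (add bumps of height h and
  width h powr (-p), with h tending to infinity), and large data escaping to infinity in space
  may return to a fixed compact set in arbitrarily short time.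
\<close>

definition eventually_uniformly_bounded ::
  "('i \<Rightarrow> real \<Rightarrow> real) \<Rightarrow> 'i filter \<Rightarrow> bool" where
  "eventually_uniformly_bounded f F \<longleftrightarrow> (\<exists>M. \<forall>\<^sub>F i in F. \<forall>x. \<bar>f i x\<bar> \<le> M)"

end

theory Submission
  imports Defs "HOL-Real_Asymp.Real_Asymp"
begin

text \<open>
  The coefficient is chosen by looking at the equation for a constant \<open>\<theta>\<close>. Multiplying it by
  \<open>exp (\<theta> * u)\<close> absorbs the quadratic gradient term: with \<open>ent \<theta> v = \<integral>\<^sub>0\<^sup>v exp (\<theta> r) dr\<close> and
  \<open>flux \<theta> v = \<integral>\<^sub>0\<^sup>v r exp (\<theta> r) dr\<close> one gets the viscous conservation law
  \<open>- \<partial>\<^sub>t ent(u) + \<partial>\<^sub>x flux(u) = \<epsilon> \<partial>\<^sub>x\<^sup>2 ent(u)\<close>. In backward time its shock from 1 to 0 moves with the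
  Rankine-Hugoniot speed \<open>flux \<theta> 1 / ent \<theta> 1\<close>, the mean of \<open>r\<close> on \<open>[0,1]\<close> under the density
  \<open>exp (\<theta> r)\<close>. This speed increases strictly and continuously from 0 to 1 as \<open>\<theta>\<close> runs through the
  reals, so every prescribed speed \<open>- c' t\<close> in \<open>(0,1)\<close> is attained at exactly one \<open>\<theta> t\<close>. Membership
  of \<open>c\<close> in the Sobolev space makes \<open>c'\<close> continuous; hence \<open>\<theta>\<close> is continuous, and the solutions are
  continuously differentiable in time.

  Convergence comes from integral functionals. If \<open>h'' \<ge> \<theta> h'\<close> and \<open>H' = v h'\<close>, then
  \<open>- \<partial>\<^sub>t h(u) + \<partial>\<^sub>x H(u) \<le> \<epsilon> \<partial>\<^sub>x\<^sup>2 h(u)\<close>; testing with a nonnegative compactly supported weight moves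
  all space derivatives to the weight (\<open>entropy_inequality\<close>), so that only bounds on \<open>u\<close> itself enter.
  Two kinds of entropy are used.

  Powers of \<open>(u - k)\<^sub>+\<close> and \<open>(- u - k)\<^sub>+\<close>, with a weight whose support expands at least as
  fast as the values of \<open>u\<close> are transported, give the maximum principle when \<open>k\<close> bounds the terminal values, and show that the parts of
  \<open>u\<close> above 1 and below 0 tend to zero locally in mean (\<open>defect_vanishes\<close>).

  Exponential entropies handle the shock. The weight is cut off along a curve that, in backward time,
  runs ahead of \<open>c\<close> with a speed larger by \<open>\<delta>\<close>. In the cut-off layer the functional changes by the quantity
  \<open>flux v - \<lambda> ent v\<close>, where \<open>\<lambda>\<close> is the speed of the curve, and this is nonpositive for \<open>v\<close> in \<open>[0,1]\<close>
  as soon as \<open>\<lambda>\<close> is at least the shock speed (\<open>front_monotonicity\<close>). So no mass of \<open>u\<close> can overtake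
  the curve. The same argument for \<open>1 - u\<close>, with a curve slower than \<open>c\<close>, controls the other side,
  and between the two curves there is only a strip of width proportional to \<open>\<delta>\<close>.

  Since only an inequality between \<open>h''\<close> and \<open>\<theta> h'\<close> is required, the entropy on a short time
  interval may be taken with a constant exponent slightly above (or below) the values of \<open>\<theta>\<close>; the
  shock speed changes little under this replacement, which the \<open>\<delta>\<close> absorbs. Finitely many such
  intervals cover \<open>[0,T]\<close> (\<open>front_vanishes\<close>), and the constants lost at their endpoints do no harm
  because they do not depend on \<open>\<epsilon>\<close>.
\<close>

section \<open>A smooth cutoff function\<close>

definition ppow :: "nat \<Rightarrow> real \<Rightarrow> real" where
  "ppow n z = (max 0 z) ^ n"

lemma ppow_nonneg [simp]: "0 \<le> ppow n z"
  by (simp add: ppow_def)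

lemma ppow_pos: "0 \<le> z \<Longrightarrow> ppow n z = z ^ n"
  by (simp add: ppow_def)

lemma ppow_neg: "z \<le> 0 \<Longrightarrow> 0 < n \<Longrightarrow> ppow n z = 0"
  by (simp add: ppow_def)

lemma ppow_le_one: "z \<le> 1 \<Longrightarrow> ppow n z \<le> 1"
  by (auto simp: ppow_def intro!: power_le_one)

lemma continuous_on_ppow [continuous_intros]:
  "continuous_on S f \<Longrightarrow> continuous_on S (\<lambda>x. ppow n (f x))"
  unfolding ppow_def by (intro continuous_intros)

lemma DERIV_ppow:
  "(ppow (Suc (Suc n)) has_real_derivative real (Suc (Suc n)) * ppow (Suc n) z) (at z)"
proof -
  consider "z < 0" | "z = 0" | "0 < z" by linarith
  then show ?thesis
  proof cases
    case 1
    have "((\<lambda>_. 0::real) has_real_derivative 0) (at z)" by simp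
    then have "(ppow (Suc (Suc n)) has_real_derivative 0) (at z)"
      by (rule has_field_derivative_transform_within_open[where S = "{..<0}"])
        (use 1 in \<open>auto simp: ppow_def\<close>)
    with 1 show ?thesis by (simp add: ppow_def)
  next
    case 2
    have "((\<lambda>h::real. (ppow (Suc (Suc n)) (0 + h) - ppow (Suc (Suc n)) 0) / h) \<longlongrightarrow> 0) (at 0)"
    proof (rule Lim_null_comparison)
      show "\<forall>\<^sub>F h::real in at 0. norm ((ppow (Suc (Suc n)) (0 + h) - ppow (Suc (Suc n)) 0) / h) \<le> \<bar>h\<bar> ^ Suc n"
      proof (rule always_eventually, rule allI)
        show "norm ((ppow (Suc (Suc n)) (0 + h) - ppow (Suc (Suc n)) 0) / h) \<le> \<bar>h\<bar> ^ Suc n" for h :: real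
          using zero_le_power[of "\<bar>h\<bar>" "Suc n"]
          by (cases "0 \<le> h") (simp_all add: ppow_pos ppow_neg del: zero_le_power)
      qed
      show "((\<lambda>h::real. \<bar>h\<bar> ^ Suc n) \<longlongrightarrow> 0) (at 0)"
        by (rule tendsto_eq_intros refl | simp)+
    qed
    with 2 show ?thesis by (simp add: DERIV_def ppow_def)
  next
    case 3
    have "((\<lambda>x::real. x ^ Suc (Suc n)) has_real_derivative real (Suc (Suc n)) * z ^ Suc n) (at z)"
      using DERIV_pow[of "Suc (Suc n)" z] by simp
    then have "(ppow (Suc (Suc n)) has_real_derivative real (Suc (Suc n)) * z ^ Suc n) (at z)"
      by (rule has_field_derivative_transform_within_open[where S = "{0<..}"])
        (use 3 in \<open>auto simp: ppow_def\<close>)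
    with 3 show ?thesis by (simp add: ppow_def)
  qed
qed

lemma DERIV_ppow_chain [derivative_intros]:
  assumes "(f has_real_derivative D) (at x within S)" "2 \<le> n"
  shows "((\<lambda>x. ppow n (f x)) has_real_derivative real n * ppow (n - 1) (f x) * D) (at x within S)"
proof -
  obtain m where n: "n = Suc (Suc m)" using assms(2)
    by (metis Suc_le_D numeral_2_eq_2 Suc_le_mono)
  show ?thesis using DERIV_chain2[OF DERIV_ppow[of m "f x"] assms(1)] by (simp add: n)
qed

text \<open>
  A twice continuously differentiable step from 1 down to 0 on the unit interval, with derivatives
  that are explicit in truncated powers.
\<close>

definition cutoff :: "real \<Rightarrow> real" where
  "cutoff z = ppow 3 (1 - ppow 3 z)"

definition cutoff' :: "real \<Rightarrow> real" where
  "cutoff' z = - 9 * ppow 2 (1 - ppow 3 z) * ppow 2 z"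

definition cutoff'' :: "real \<Rightarrow> real" where
  "cutoff'' z = 54 * ppow 1 (1 - ppow 3 z) * ppow 2 z * ppow 2 z - 18 * ppow 2 (1 - ppow 3 z) * ppow 1 z"

lemma DERIV_cutoff [derivative_intros]:
  assumes "(f has_real_derivative D) (at x within S)"
  shows "((\<lambda>x. cutoff (f x)) has_real_derivative cutoff' (f x) * D) (at x within S)"
  unfolding cutoff_def cutoff'_def
  by (rule derivative_eq_intros assms refl | simp)+

lemma DERIV_cutoff' [derivative_intros]:
  assumes "(f has_real_derivative D) (at x within S)"
  shows "((\<lambda>x. cutoff' (f x)) has_real_derivative cutoff'' (f x) * D) (at x within S)"
  unfolding cutoff'_def cutoff''_def
  by (rule derivative_eq_intros assms refl | simp add: algebra_simps)+

lemma continuous_on_cutoff [continuous_intros]: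
  assumes "continuous_on S f"
  shows "continuous_on S (\<lambda>x. cutoff (f x))" "continuous_on S (\<lambda>x. cutoff' (f x))"
    "continuous_on S (\<lambda>x. cutoff'' (f x))"
  unfolding cutoff_def cutoff'_def cutoff''_def by (intro continuous_intros assms)+

lemma cutoff_left [simp]: "z \<le> 0 \<Longrightarrow> cutoff z = 1" "z \<le> 0 \<Longrightarrow> cutoff' z = 0" "z \<le> 0 \<Longrightarrow> cutoff'' z = 0"
  by (simp_all add: cutoff_def cutoff'_def cutoff''_def ppow_def)

lemma cutoff_right [simp]:
  assumes "1 \<le> z"
  shows "cutoff z = 0" "cutoff' z = 0" "cutoff'' z = 0"
proof -
  have "1 - ppow 3 z \<le> 0" using assms by (simp add: ppow_def)
  then show "cutoff z = 0" "cutoff' z = 0" "cutoff'' z = 0"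
    by (simp_all add: cutoff_def cutoff'_def cutoff''_def ppow_neg)
qed

lemma cutoff_nonneg [simp]: "0 \<le> cutoff z" and cutoff_le_one [simp]: "cutoff z \<le> 1"
  by (auto simp: cutoff_def intro!: ppow_le_one)

lemma cutoff'_nonpos [simp]: "cutoff' z \<le> 0"
  by (simp add: cutoff'_def)

text \<open>
  The constant is \<open>54 + 18\<close>, the sum of the coefficients of the second derivative.
\<close>

lemma abs_cutoff_le: "\<bar>cutoff z\<bar> \<le> 72" "\<bar>cutoff' z\<bar> \<le> 72" "\<bar>cutoff'' z\<bar> \<le> 72"
proof -
  show "\<bar>cutoff z\<bar> \<le> 72" using cutoff_nonneg[of z] cutoff_le_one[of z] by linarith
  have *: "\<bar>cutoff' z\<bar> \<le> 72 \<and> \<bar>cutoff'' z\<bar> \<le> 72"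
  proof (cases "z \<le> 1")
    case True
    define a b where "a = ppow 1 (1 - ppow 3 z)" and "b = ppow 1 z"
    have ab: "0 \<le> a" "a \<le> 1" "0 \<le> b" "b \<le> 1"
      using True by (auto simp: a_def b_def intro!: ppow_le_one)
    have sq: "ppow 2 (1 - ppow 3 z) = a\<^sup>2" "ppow 2 z = b\<^sup>2" by (auto simp: a_def b_def ppow_def)
    have bd: "0 \<le> a\<^sup>2 * b\<^sup>2" "a\<^sup>2 * b\<^sup>2 \<le> 1" "0 \<le> a * (b\<^sup>2 * b\<^sup>2)" "a * (b\<^sup>2 * b\<^sup>2) \<le> 1" "0 \<le> a\<^sup>2 * b" "a\<^sup>2 * b \<le> 1"
      using ab by (auto intro!: mult_nonneg_nonneg mult_le_one power_le_one)
    have "cutoff' z = - 9 * (a\<^sup>2 * b\<^sup>2)" by (simp add: cutoff'_def sq)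
    moreover have "cutoff'' z = 54 * (a * (b\<^sup>2 * b\<^sup>2)) - 18 * (a\<^sup>2 * b)"
      unfolding cutoff''_def sq a_def[symmetric] b_def[symmetric] by (simp add: algebra_simps)
    ultimately show ?thesis using bd by linarith
  next
    case False
    then show ?thesis by simp
  qed
  then show "\<bar>cutoff' z\<bar> \<le> 72" "\<bar>cutoff'' z\<bar> \<le> 72" by auto
qed

section \<open>Sobolev functions of order two have a continuous derivative\<close>

text \<open>
  Integrating \<open>f\<close> against the second derivative of a steep cutoff recovers the slope \<open>d\<close> of \<open>f\<close> at \<open>a\<close>, even if the layer of
  the cutoff lies beside \<open>a\<close> instead of around it: the affine part of \<open>f\<close> at \<open>a\<close> contributes exactly
  \<open>d\<close>, and the kernel is of size \<open>1 / h\<^sup>2\<close> on a set of length \<open>h\<close>. One-sided layers are what allows the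
  endpoints of the interval below, where test functions vanish.
\<close>

lemma mollified_derivative:
  fixes f :: "real \<Rightarrow> real"
  assumes h: "0 < h" and p: "0 \<le> p" "p + h \<le> T"
    and cont: "continuous_on {0..T} f"
    and r: "\<And>t. p \<le> t \<Longrightarrow> t \<le> p + h \<Longrightarrow> \<bar>f t - f a - d * (t - a)\<bar> \<le> \<omega>"
  shows "\<bar>integral {0..T} (\<lambda>t. f t * (cutoff'' ((t - p) / h) / h\<^sup>2)) - d\<bar> \<le> 72 * \<omega> / h"
proof -
  define k where "k = (\<lambda>t. cutoff'' ((t - p) / h) / h\<^sup>2)"
  define F where "F = (\<lambda>t. (f a + d * (t - a)) * (cutoff' ((t - p) / h) / h) - d * cutoff ((t - p) / h))"
  have k_cont: "continuous_on S k" for S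
    unfolding k_def using h by (intro continuous_intros) auto
  have k_le: "\<bar>k t\<bar> \<le> 72 / h\<^sup>2" for t
    unfolding k_def abs_divide using abs_cutoff_le(3) h by (simp add: divide_right_mono)
  have f_cont: "continuous_on {p..p + h} f"
    by (rule continuous_on_subset[OF cont]) (use p in auto)
  have DF: "(F has_real_derivative (f a + d * (t - a)) * k t) (at t within S)" for t S
    unfolding F_def k_def
    by (rule derivative_eq_intros refl | simp add: h less_imp_neq[OF h, symmetric])+
      (use h in \<open>simp add: field_simps power2_eq_square\<close>)
  have "((\<lambda>t. (f a + d * (t - a)) * k t) has_integral F (p + h) - F p) {p..p + h}"
    using h DF by (intro fundamental_theorem_of_calculus)
      (auto simp: has_real_derivative_iff_has_vector_derivative[symmetric])
  moreover have "F (p + h) - F p = d" using h by (simp add: F_def)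
  ultimately have lin: "((\<lambda>t. (f a + d * (t - a)) * k t) has_integral d) {p..p + h}" by simp
  define r where "r = (\<lambda>t. (f t - f a - d * (t - a)) * k t)"
  have r_cont: "continuous_on {p..p + h} r"
    unfolding r_def by (intro continuous_intros f_cont k_cont)
  have r_int: "(r has_integral integral {p..p + h} r) {p..p + h}"
    using r_cont by (intro integrable_integral integrable_continuous_real)
  have "\<bar>r t\<bar> \<le> \<omega> * (72 / h\<^sup>2)" if "t \<in> {p..p + h}" for t
    unfolding r_def abs_mult using assms(5)[of t] that k_le[of t] h
    by (intro mult_mono) (auto intro: order_trans[OF abs_ge_zero])
  then have r_le: "\<bar>integral {p..p + h} r\<bar> \<le> \<omega> * (72 / h\<^sup>2) * (p + h - p)"
    using integral_bound[of p "p + h" r "\<omega> * (72 / h\<^sup>2)"] h r_cont by simp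
  have "((\<lambda>t. f t * k t) has_integral d + integral {p..p + h} r) {p..p + h}"
    using has_integral_add[OF lin r_int] by (simp add: r_def algebra_simps)
  then have "((\<lambda>t. f t * k t) has_integral d + integral {p..p + h} r) {0..T}"
  proof (rule has_integral_on_superset)
    fix t assume "t \<notin> {p..p + h}"
    then have "(t - p) / h \<le> 0 \<or> 1 \<le> (t - p) / h" using h by (auto simp: field_simps)
    then show "f t * k t = 0" by (auto simp: k_def)
  qed (use p in auto)
  then have "integral {0..T} (\<lambda>t. f t * k t) - d = integral {p..p + h} r"
    by (simp add: integral_unique)
  moreover have "\<omega> * (72 / h\<^sup>2) * (p + h - p) = 72 * \<omega> / h"
    using h by (simp add: power2_eq_square field_simps)
  ultimately show ?thesis using r_le by (simp add: k_def)
qed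

text \<open>
  Take a smoothed indicator of \<open>[a,b]\<close> as test function, twice. Its second derivative consists of two
  kernels near the endpoints, which by \<open>mollified_derivative\<close> see \<open>c' a\<close> and \<open>c' b\<close>; its own size is at
  most 1, which leaves the integral of \<open>c2\<close>.
\<close>

lemma W21_derivative_increment:
  assumes c1: "weak_derivative T c c1" and c2: "weak_derivative T c1 c2"
    and D: "\<And>t. t \<in> {0..T} \<Longrightarrow> (c has_real_derivative c' t) (at t within {0..T})"
    and ab: "0 \<le> a" "a < b" "b \<le> T"
  shows "\<bar>c' b - c' a\<bar> \<le> (LINT t:{a..b}|lborel. \<bar>c2 t\<bar>)"
proof (rule field_le_epsilon)
  fix e :: real assume "0 < e"
  \<comment> \<open>Each of the two kernels contributes an error \<open>72 * (w * 2 h) / h = 144 w = e / 2\<close>.\<close>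
  define w where "w = e / 288"
  have w: "0 < w" using \<open>0 < e\<close> by (simp add: w_def)
  have cont: "continuous_on {0..T} c"
    using D by (meson DERIV_continuous continuous_on_eq_continuous_within)
  have *: "\<exists>d>0. \<forall>t\<in>{0..T}. \<bar>t - s\<bar> < d \<longrightarrow> \<bar>c t - c s - c' s * (t - s)\<bar> \<le> w * \<bar>t - s\<bar>" if "s \<in> {0..T}" for s
    using D[OF that] w unfolding has_field_derivative_def has_derivative_within_alt by auto
  obtain d1 where d1: "0 < d1" "\<And>t. t \<in> {0..T} \<Longrightarrow> \<bar>t - a\<bar> < d1 \<Longrightarrow> \<bar>c t - c a - c' a * (t - a)\<bar> \<le> w * \<bar>t - a\<bar>"
    using *[of a] ab by auto
  obtain d2 where d2: "0 < d2" "\<And>t. t \<in> {0..T} \<Longrightarrow> \<bar>t - b\<bar> < d2 \<Longrightarrow> \<bar>c t - c b - c' b * (t - b)\<bar> \<le> w * \<bar>t - b\<bar>"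
    using *[of b] ab by auto
  define h where "h = min (min d1 d2 / 3) ((b - a) / 4)"
  have h: "0 < h" "2 * h < d1" "2 * h < d2" "4 * h \<le> b - a"
    unfolding h_def using d1(1) d2(1) ab by (auto simp: min_def)
  define k where "k = (\<lambda>p t. cutoff'' ((t - p) / h) / h\<^sup>2)"
  define \<phi> where "\<phi> = (\<lambda>t. cutoff ((t - (b - 2 * h)) / h) - cutoff ((t - (a + h)) / h))"
  define \<phi>' where "\<phi>' = (\<lambda>t. cutoff' ((t - (b - 2 * h)) / h) / h - cutoff' ((t - (a + h)) / h) / h)"
  define \<phi>'' where "\<phi>'' = (\<lambda>t. k (b - 2 * h) t - k (a + h) t)"
  have k_cont: "continuous_on S (k p)" for S p
    unfolding k_def using h by (intro continuous_intros) auto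
  have supp: "\<phi> t = 0 \<and> \<phi>' t = 0" if "t \<notin> {a + h..b - h}" for t
  proof (cases "t < a + h")
    case True
    then have "(t - (a + h)) / h \<le> 0" "(t - (b - 2 * h)) / h \<le> 0" using h by (auto simp: field_simps)
    then show ?thesis by (simp add: \<phi>_def \<phi>'_def)
  next
    case False
    with that have "b - h < t" by auto
    then have "1 \<le> (t - (a + h)) / h" "1 \<le> (t - (b - 2 * h)) / h" using h by (auto simp: field_simps)
    then show ?thesis by (simp add: \<phi>_def \<phi>'_def)
  qed
  have cpt: "\<exists>a' b'. 0 < a' \<and> a' \<le> b' \<and> b' < T \<and> (\<forall>t. t \<notin> {a'..b'} \<longrightarrow> \<phi> t = 0 \<and> \<phi>' t = 0)"
    by (rule exI[of _ "a + h"], rule exI[of _ "b - h"]) (use supp h ab in auto)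
  have t1: "test_function T \<phi> \<phi>'"
    unfolding test_function_def
  proof (intro conjI allI)
    show "(\<phi> has_real_derivative \<phi>' t) (at t)" for t
      unfolding \<phi>_def \<phi>'_def using h by (auto intro!: derivative_eq_intros)
    show "continuous_on UNIV \<phi>'" unfolding \<phi>'_def using h by (intro continuous_intros) auto
  qed (use cpt in blast)
  have t2: "test_function T \<phi>' \<phi>''"
    unfolding test_function_def
  proof (intro conjI allI)
    show "(\<phi>' has_real_derivative \<phi>'' t) (at t)" for t
      unfolding \<phi>'_def \<phi>''_def k_def using h by (auto intro!: derivative_eq_intros simp: power2_eq_square)
    show "continuous_on UNIV \<phi>''" unfolding \<phi>''_def by (intro continuous_intros k_cont)
  qed (use cpt in blast)
  have "(LINT t:{0..T}|lborel. c t * \<phi>'' t) = - (LINT t:{0..T}|lborel. c1 t * \<phi>' t)"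
    using c1 t2 by (auto simp: weak_derivative_def)
  also have "\<dots> = (LINT t:{0..T}|lborel. c2 t * \<phi> t)"
    using c2 t1 by (auto simp: weak_derivative_def)
  finally have eq: "(LINT t:{0..T}|lborel. c t * \<phi>'' t) = (LINT t:{0..T}|lborel. c2 t * \<phi> t)" .
  have int_ck: "(\<lambda>t. c t * k p t) integrable_on {0..T}" for p
    by (intro integrable_continuous_real continuous_intros cont k_cont)
  have "(LINT t:{0..T}|lborel. c t * \<phi>'' t) = integral {0..T} (\<lambda>t. c t * \<phi>'' t)"
    unfolding \<phi>''_def
    by (intro set_borel_integral_eq_integral borel_integrable_atLeastAtMost' continuous_intros cont k_cont)
  also have "\<dots> = integral {0..T} (\<lambda>t. c t * k (b - 2 * h) t) - integral {0..T} (\<lambda>t. c t * k (a + h) t)"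
    unfolding \<phi>''_def by (simp add: right_diff_distrib integral_diff int_ck)
  finally have lhs: "(LINT t:{0..T}|lborel. c t * \<phi>'' t) =
    integral {0..T} (\<lambda>t. c t * k (b - 2 * h) t) - integral {0..T} (\<lambda>t. c t * k (a + h) t)" .
  have "\<bar>c t - c a - c' a * (t - a)\<bar> \<le> w * (2 * h)" if "a + h \<le> t" "t \<le> a + h + h" for t
  proof -
    have "\<bar>c t - c a - c' a * (t - a)\<bar> \<le> w * \<bar>t - a\<bar>" using that h ab by (intro d1) auto
    also have "\<dots> \<le> w * (2 * h)" using that h w by (intro mult_left_mono) auto
    finally show ?thesis .
  qed
  then have A: "\<bar>integral {0..T} (\<lambda>t. c t * k (a + h) t) - c' a\<bar> \<le> 72 * (w * (2 * h)) / h"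
    unfolding k_def using h ab cont by (intro mollified_derivative) auto
  have "\<bar>c t - c b - c' b * (t - b)\<bar> \<le> w * (2 * h)" if "b - 2 * h \<le> t" "t \<le> b - 2 * h + h" for t
  proof -
    have "\<bar>c t - c b - c' b * (t - b)\<bar> \<le> w * \<bar>t - b\<bar>" using that h ab by (intro d2) auto
    also have "\<dots> \<le> w * (2 * h)" using that h w by (intro mult_left_mono) auto
    finally show ?thesis .
  qed
  then have B: "\<bar>integral {0..T} (\<lambda>t. c t * k (b - 2 * h) t) - c' b\<bar> \<le> 72 * (w * (2 * h)) / h"
    unfolding k_def using h ab cont by (intro mollified_derivative) auto
  have hw: "72 * (w * (2 * h)) / h = e / 2" using h by (simp add: w_def)
  have phi_le: "\<bar>\<phi> t\<bar> \<le> indicator {a..b} t" for t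
  proof (cases "t \<in> {a + h..b - h}")
    case True
    then have "t \<in> {a..b}" using h by auto
    moreover have "\<bar>\<phi> t\<bar> \<le> 1"
      unfolding \<phi>_def using cutoff_nonneg cutoff_le_one by (smt (verit))
    ultimately show ?thesis by simp
  qed (use supp in auto)
  have c2_int: "set_integrable lborel {0..T} c2" using c2 by (auto simp: weak_derivative_def)
  have c2_ab: "set_integrable lborel {a..b} c2"
    by (rule set_integrable_subset[OF c2_int]) (use ab in auto)
  have "\<bar>LINT t:{0..T}|lborel. c2 t * \<phi> t\<bar> \<le> (LINT t:{a..b}|lborel. \<bar>c2 t\<bar>)"
    unfolding set_lebesgue_integral_def
  proof (rule order_trans[OF integral_abs_bound integral_mono'])
    show "integrable lborel (\<lambda>t. indicator {a..b} t *\<^sub>R \<bar>c2 t\<bar>)"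
      using set_integrable_abs[OF c2_ab] by (simp add: set_integrable_def)
    fix t
    have "\<bar>indicator {0..T} t *\<^sub>R (c2 t * \<phi> t)\<bar> \<le> \<bar>c2 t\<bar> * \<bar>\<phi> t\<bar>"
      by (auto simp: abs_mult indicator_def)
    also have "\<dots> \<le> \<bar>c2 t\<bar> * indicator {a..b} t" using phi_le by (intro mult_left_mono) auto
    finally show "\<bar>indicator {0..T} t *\<^sub>R (c2 t * \<phi> t)\<bar> \<le> indicator {a..b} t *\<^sub>R \<bar>c2 t\<bar>"
      by (simp add: mult.commute)
  qed simp
  then show "\<bar>c' b - c' a\<bar> \<le> (LINT t:{a..b}|lborel. \<bar>c2 t\<bar>) + e"
    using A B lhs eq hw by linarith
qed

lemma W21_continuous_derivative:
  assumes "c \<in> W21 T"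
    and D: "\<And>t. t \<in> {0..T} \<Longrightarrow> (c has_real_derivative c' t) (at t within {0..T})"
  shows "continuous_on {0..T} c'"
proof -
  obtain c1 c2 where c1: "weak_derivative T c c1" and c2: "weak_derivative T c1 c2"
    using assms(1) by (auto simp: W21_def)
  have int: "set_integrable lborel {0..T} (\<lambda>t. \<bar>c2 t\<bar>)"
    using c2 by (intro set_integrable_abs) (auto simp: weak_derivative_def)
  define F where "F = (\<lambda>t. integral {0..t} (\<lambda>t. \<bar>c2 t\<bar>))"
  have HK: "(\<lambda>t. \<bar>c2 t\<bar>) integrable_on {0..T}"
    by (rule set_borel_integral_eq_integral(1)[OF int])
  have F: "continuous_on {0..T} F"
    unfolding F_def by (rule indefinite_integral_continuous_1[OF HK])
  have less: "\<bar>c' t - c' s\<bar> \<le> F t - F s" if "0 \<le> s" "s < t" "t \<le> T" for s t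
  proof -
    have "set_integrable lborel {s..t} (\<lambda>t. \<bar>c2 t\<bar>)"
      by (rule set_integrable_subset[OF int]) (use that in auto)
    then have "(LINT r:{s..t}|lborel. \<bar>c2 r\<bar>) = integral {s..t} (\<lambda>t. \<bar>c2 t\<bar>)"
      by (rule set_borel_integral_eq_integral)
    moreover have "(\<lambda>t. \<bar>c2 t\<bar>) integrable_on {0..t}"
      by (rule integrable_subinterval_real[OF HK]) (use that in auto)
    then have "F s + integral {s..t} (\<lambda>t. \<bar>c2 t\<bar>) = F t"
      unfolding F_def using that by (intro Henstock_Kurzweil_Integration.integral_combine) auto
    ultimately show ?thesis using W21_derivative_increment[OF c1 c2 D that] by simp
  qed
  have le: "\<bar>c' t - c' s\<bar> \<le> \<bar>F t - F s\<bar>" if "s \<in> {0..T}" "t \<in> {0..T}" for s t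
    using less[of s t] less[of t s] that by (cases s t rule: linorder_cases) auto
  show ?thesis
    unfolding continuous_on_def
  proof
    fix s assume s: "s \<in> {0..T}"
    have "((\<lambda>t. c' t - c' s) \<longlongrightarrow> 0) (at s within {0..T})"
    proof (rule Lim_null_comparison)
      show "\<forall>\<^sub>F t in at s within {0..T}. norm (c' t - c' s) \<le> \<bar>F t - F s\<bar>"
        using le[OF s] by (simp add: eventually_at_filter)
      have "(F \<longlongrightarrow> F s) (at s within {0..T})" using F s by (auto simp: continuous_on_def)
      then show "((\<lambda>t. \<bar>F t - F s\<bar>) \<longlongrightarrow> 0) (at s within {0..T})"
        by (auto intro!: tendsto_eq_intros)
    qed
    then show "(c' \<longlongrightarrow> c' s) (at s within {0..T})" by (simp add: LIM_zero_iff)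
  qed
qed

section \<open>The speed of a shock as a function of the coefficient\<close>

text \<open>
  The function \<open>\<integral>\<^sub>0\<^sup>v exp (\<theta> r) dr\<close>.
\<close>

definition ent :: "real \<Rightarrow> real \<Rightarrow> real" where
  "ent \<theta> v = (if \<theta> = 0 then v else (exp (\<theta> * v) - 1) / \<theta>)"

text \<open>
  The function \<open>\<integral>\<^sub>0\<^sup>v r exp (\<theta> r) dr\<close>.
\<close>

definition flux :: "real \<Rightarrow> real \<Rightarrow> real" where
  "flux \<theta> v = (if \<theta> = 0 then v\<^sup>2 / 2 else v * exp (\<theta> * v) / \<theta> - (exp (\<theta> * v) - 1) / \<theta>\<^sup>2)"

lemma ent_0 [simp]: "ent \<theta> 0 = 0" and flux_0 [simp]: "flux \<theta> 0 = 0"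
  by (auto simp: ent_def flux_def)

lemma DERIV_ent [derivative_intros]:
  assumes "(f has_real_derivative D) (at x within S)"
  shows "((\<lambda>x. ent \<theta> (f x)) has_real_derivative exp (\<theta> * f x) * D) (at x within S)"
proof (cases "\<theta> = 0")
  case True with assms show ?thesis by (simp add: ent_def)
next
  case False
  then show ?thesis unfolding ent_def
    by (auto intro!: derivative_eq_intros assms)
qed

lemma DERIV_flux [derivative_intros]:
  assumes "(f has_real_derivative D) (at x within S)"
  shows "((\<lambda>x. flux \<theta> (f x)) has_real_derivative f x * exp (\<theta> * f x) * D) (at x within S)"
proof (cases "\<theta> = 0")
  case True with assms show ?thesis by (auto simp: flux_def intro!: derivative_eq_intros)
next
  case False
  then show ?thesis unfolding flux_def
    by (auto intro!: derivative_eq_intros assms simp: field_simps power2_eq_square)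
qed

lemma DERIV_ent_at: "(ent \<theta> has_real_derivative exp (\<theta> * v)) (at v)"
  and DERIV_flux_at: "(flux \<theta> has_real_derivative v * exp (\<theta> * v)) (at v)"
  using DERIV_ent[OF DERIV_ident, of \<theta> v UNIV] DERIV_flux[OF DERIV_ident, of \<theta> v UNIV] by simp_all

definition speed :: "real \<Rightarrow> real" where
  "speed \<theta> = flux \<theta> 1 / ent \<theta> 1"

text \<open>
  Inequalities between \<open>ent\<close> and \<open>flux\<close> for different exponents are read off their integrands; this
  comparison of increments replaces the integrals.
\<close>

lemma has_DERIV_mono:
  fixes f g :: "real \<Rightarrow> real"
  assumes "a \<le> b"
    and "\<And>x. a \<le> x \<Longrightarrow> x \<le> b \<Longrightarrow> (f has_real_derivative f' x) (at x)"
    and "\<And>x. a \<le> x \<Longrightarrow> x \<le> b \<Longrightarrow> (g has_real_derivative g' x) (at x)"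
    and "\<And>x. a \<le> x \<Longrightarrow> x \<le> b \<Longrightarrow> f' x \<le> g' x"
  shows "f b - f a \<le> g b - g a"
proof -
  have "(\<lambda>x. g x - f x) a \<le> (\<lambda>x. g x - f x) b"
    by (rule DERIV_nonneg_imp_nondecreasing[OF assms(1)])
      (use assms(2-4) in \<open>force intro!: exI derivative_eq_intros\<close>)
  then show ?thesis by simp
qed

lemma ent_1_pos: "0 < ent \<theta> 1"
  by (auto simp: ent_def divide_simps)

lemma flux_1_nonneg: "0 \<le> flux \<theta> 1"
proof -
  have "(\<lambda>_. 0) 1 - (\<lambda>_. 0) 0 \<le> flux \<theta> 1 - flux \<theta> 0"
    by (rule has_DERIV_mono[OF zero_le_one DERIV_const DERIV_flux_at]) simp
  then show ?thesis by simp
qed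

lemma flux_1_le_ent_1: "flux \<theta> 1 \<le> ent \<theta> 1"
proof -
  have "flux \<theta> 1 - flux \<theta> 0 \<le> ent \<theta> 1 - ent \<theta> 0"
    by (rule has_DERIV_mono[OF zero_le_one DERIV_flux_at DERIV_ent_at]) simp
  then show ?thesis by simp
qed

lemma speed_nonneg: "0 \<le> speed \<theta>" and speed_le_1: "speed \<theta> \<le> 1"
  using ent_1_pos[of \<theta>] flux_1_nonneg[of \<theta>] flux_1_le_ent_1[of \<theta>]
  by (auto simp: speed_def)

text \<open>
  Tilting: with \<open>\<sigma>\<close> the speed for \<open>\<theta>\<^sub>1\<close>, the integral of \<open>(r - \<sigma>) exp (\<theta>\<^sub>1 r)\<close> over \<open>[0,1]\<close> is zero, and
  multiplication of the integrand by \<open>exp ((\<theta>\<^sub>2 - \<theta>\<^sub>1) r)\<close> favours the part where \<open>r > \<sigma>\<close>.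
\<close>

lemma speed_less:
  assumes "\<theta>\<^sub>1 < \<theta>\<^sub>2"
  shows "speed \<theta>\<^sub>1 < speed \<theta>\<^sub>2"
proof -
  define \<sigma> where "\<sigma> = speed \<theta>\<^sub>1"
  \<comment> \<open>The correction vanishes at \<open>v = 1\<close> and makes the integrand nonnegative.\<close>
  define L where "L = (\<lambda>v. flux \<theta>\<^sub>2 v - \<sigma> * ent \<theta>\<^sub>2 v - exp ((\<theta>\<^sub>2 - \<theta>\<^sub>1) * \<sigma>) * (flux \<theta>\<^sub>1 v - \<sigma> * ent \<theta>\<^sub>1 v))"
  define L' where "L' = (\<lambda>v. (v - \<sigma>) * exp (\<theta>\<^sub>1 * v) * (exp ((\<theta>\<^sub>2 - \<theta>\<^sub>1) * v) - exp ((\<theta>\<^sub>2 - \<theta>\<^sub>1) * \<sigma>)))"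
  have \<sigma>: "0 \<le> \<sigma>" "\<sigma> \<le> 1" using speed_nonneg speed_le_1 by (auto simp: \<sigma>_def)
  have D: "(L has_real_derivative L' v) (at v)" for v
    unfolding L_def L'_def
    by (auto intro!: derivative_eq_intros simp: algebra_simps exp_add[symmetric])
  have pos: "0 < L' v" if "v \<noteq> \<sigma>" for v
  proof (cases "v < \<sigma>")
    case True
    then have "(\<theta>\<^sub>2 - \<theta>\<^sub>1) * v < (\<theta>\<^sub>2 - \<theta>\<^sub>1) * \<sigma>" using assms by simp
    with True show ?thesis unfolding L'_def
      by (auto intro!: mult_neg_neg mult_neg_pos)
  next
    case False
    with that have "(\<theta>\<^sub>2 - \<theta>\<^sub>1) * \<sigma> < (\<theta>\<^sub>2 - \<theta>\<^sub>1) * v" using assms by simp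
    with False that show ?thesis unfolding L'_def
      by (auto intro!: mult_pos_pos)
  qed
  have cont: "continuous_on S L" for S
    using D by (meson DERIV_isCont continuous_at_imp_continuous_on)
  have less: "L a < L b" if "a < b" "\<sigma> \<le> a \<or> b \<le> \<sigma>" for a b
    by (rule DERIV_pos_imp_increasing_open[OF \<open>a < b\<close> _ cont])
      (use D pos that in force)
  have "L 0 < L 1"
  proof (cases "\<sigma> = 0 \<or> \<sigma> = 1")
    case True then show ?thesis using less[of 0 1] by auto
  next
    case False then show ?thesis using less[of 0 \<sigma>] less[of \<sigma> 1] \<sigma> by auto
  qed
  moreover have "flux \<theta>\<^sub>1 1 - \<sigma> * ent \<theta>\<^sub>1 1 = 0"
    using ent_1_pos[of \<theta>\<^sub>1] by (simp add: \<sigma>_def speed_def)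
  ultimately have "\<sigma> * ent \<theta>\<^sub>2 1 < flux \<theta>\<^sub>2 1" by (simp add: L_def)
  then show ?thesis using ent_1_pos[of \<theta>\<^sub>2] by (simp add: \<sigma>_def[symmetric] speed_def[of \<theta>\<^sub>2] field_simps)
qed

text \<open>
  A modulus of continuity that is uniform in \<open>\<theta>\<close>: on \<open>[0,1]\<close> the density grows by a factor between
  1 and \<open>exp \<eta>\<close>. It also measures the price of replacing \<open>\<theta>\<close> by a nearby constant.
\<close>

lemma speed_add_le:
  assumes "0 \<le> \<eta>"
  shows "speed (\<theta> + \<eta>) \<le> speed \<theta> + (exp \<eta> - 1)"
proof -
  have exp_le: "exp ((\<theta> + \<eta>) * v) \<le> exp \<eta> * exp (\<theta> * v)" if "v \<le> 1" for v
  proof -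
    have "\<eta> * v \<le> \<eta>" using assms that by (simp add: mult_left_le)
    then show ?thesis by (simp add: exp_add[symmetric] algebra_simps)
  qed
  have "flux (\<theta> + \<eta>) 1 - flux (\<theta> + \<eta>) 0 \<le> exp \<eta> * flux \<theta> 1 - exp \<eta> * flux \<theta> 0"
    by (rule has_DERIV_mono[OF zero_le_one DERIV_flux_at DERIV_cmult[OF DERIV_flux_at]])
      (use mult_left_mono[OF exp_le] in \<open>simp add: mult.left_commute\<close>)
  then have "flux (\<theta> + \<eta>) 1 \<le> exp \<eta> * flux \<theta> 1" by simp
  moreover have "ent \<theta> 1 - ent \<theta> 0 \<le> ent (\<theta> + \<eta>) 1 - ent (\<theta> + \<eta>) 0"
    by (rule has_DERIV_mono[OF zero_le_one DERIV_ent_at DERIV_ent_at]) (use assms in \<open>simp add: mult_right_mono\<close>)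
  ultimately have "speed (\<theta> + \<eta>) \<le> exp \<eta> * flux \<theta> 1 / ent \<theta> 1"
    unfolding speed_def using ent_1_pos[of \<theta>] flux_1_nonneg[of \<theta>]
    by (intro frac_le) simp_all
  also have "\<dots> = speed \<theta> + (exp \<eta> - 1) * speed \<theta>" by (simp add: speed_def algebra_simps diff_divide_distrib)
  also have "\<dots> \<le> speed \<theta> + (exp \<eta> - 1) * 1"
    using assms speed_le_1[of \<theta>] by (intro add_left_mono mult_left_mono) auto
  finally show ?thesis by simp
qed

lemma speed_explicit: "\<theta> \<noteq> 0 \<Longrightarrow> speed \<theta> = exp \<theta> / (exp \<theta> - 1) - 1 / \<theta>"
  by (simp add: speed_def ent_def flux_def field_simps power2_eq_square)

lemma isCont_speed: "isCont speed \<theta>"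
proof -
  have "((\<lambda>\<theta>'. speed \<theta>' - speed \<theta>) \<longlongrightarrow> 0) (at \<theta>)"
  proof (rule Lim_null_comparison)
    have "norm (speed \<theta>' - speed \<theta>) \<le> exp \<bar>\<theta>' - \<theta>\<bar> - 1" for \<theta>'
    proof (cases "\<theta> \<le> \<theta>'")
      case True
      have "speed \<theta> \<le> speed \<theta>'" using True speed_less[of \<theta> \<theta>'] by (cases "\<theta> = \<theta>'") auto
      then show ?thesis using speed_add_le[of "\<theta>' - \<theta>" \<theta>] True by simp
    next
      case False
      have "speed \<theta>' \<le> speed \<theta>" using False speed_less[of \<theta>' \<theta>] by auto
      then show ?thesis using speed_add_le[of "\<theta> - \<theta>'" \<theta>'] False by simp
    qed
    then show "\<forall>\<^sub>F \<theta>' in at \<theta>. norm (speed \<theta>' - speed \<theta>) \<le> exp \<bar>\<theta>' - \<theta>\<bar> - 1" by simp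
    show "((\<lambda>\<theta>'. exp \<bar>\<theta>' - \<theta>\<bar> - 1) \<longlongrightarrow> 0) (at \<theta>)"
      by (auto intro!: tendsto_eq_intros)
  qed
  then show ?thesis unfolding isCont_def using LIM_zero_iff by blast
qed

lemma ex_speed_eq:
  assumes "0 < \<sigma>" "\<sigma> < 1"
  obtains \<theta> where "speed \<theta> = \<sigma>"
proof -
  \<comment> \<open>The speed is at least \<open>1 - 1 / b\<close> at \<open>b\<close> and at most \<open>1 / a\<close> at \<open>- a\<close>.\<close>
  define a where "a = 1 / \<sigma>"
  define b where "b = 1 / (1 - \<sigma>)"
  have ab: "0 < a" "0 < b" using assms by (auto simp: a_def b_def)
  have "exp (- a) / (exp (- a) - 1) \<le> 0"
    using ab by (simp add: divide_simps)
  then have lo: "speed (- a) \<le> \<sigma>" using ab assms by (simp add: speed_explicit) (simp add: a_def)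
  have "1 \<le> exp b / (exp b - 1)" using ab by (simp add: divide_simps)
  then have hi: "\<sigma> \<le> speed b" using ab assms by (simp add: speed_explicit) (simp add: b_def)
  have "\<exists>x. - a \<le> x \<and> x \<le> b \<and> speed x = \<sigma>"
    using lo hi ab isCont_speed by (intro IVT) auto
  then show ?thesis using that by blast
qed

text \<open>
  The inverse of a strictly increasing continuous function is continuous, so the coefficient inherits
  continuity from the prescribed speed.
\<close>

lemma continuous_coefficient:
  assumes "continuous_on S \<sigma>" "\<And>t. t \<in> S \<Longrightarrow> 0 < \<sigma> t \<and> \<sigma> t < 1"
  shows "\<exists>\<theta>. continuous_on S \<theta> \<and> (\<forall>t\<in>S. speed (\<theta> t) = \<sigma> t)"
proof -
  have "\<forall>t. \<exists>\<theta>. t \<in> S \<longrightarrow> speed \<theta> = \<sigma> t"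
    using assms(2) ex_speed_eq by metis
  then obtain \<theta> where \<theta>: "\<And>t. t \<in> S \<Longrightarrow> speed (\<theta> t) = \<sigma> t" by metis
  have mono: "a < b" if "speed a < speed b" for a b
    using that speed_less[of b a] by (cases a b rule: linorder_cases) auto
  have "continuous_on S \<theta>"
    unfolding continuous_on_def
  proof (intro ballI order_tendstoI)
    fix t a assume t: "t \<in> S"
    have lim: "(\<sigma> \<longlongrightarrow> \<sigma> t) (at t within S)" using assms(1) t by (auto simp: continuous_on_def)
    have inS: "\<forall>\<^sub>F s in at t within S. s \<in> S" by (simp add: eventually_at_filter)
    { assume "a < \<theta> t"
      then have "speed a < \<sigma> t" using speed_less \<theta>[OF t] by metis
      from eventually_conj[OF order_tendstoD(1)[OF lim this] inS]
      show "\<forall>\<^sub>F s in at t within S. a < \<theta> s"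
        by (elim eventually_mono) (metis \<theta> mono) }
    { assume "\<theta> t < a"
      then have "\<sigma> t < speed a" using speed_less \<theta>[OF t] by metis
      from eventually_conj[OF order_tendstoD(2)[OF lim this] inS]
      show "\<forall>\<^sub>F s in at t within S. \<theta> s < a"
        by (elim eventually_mono) (metis \<theta> mono) }
  qed
  then show ?thesis using \<theta> by blast
qed

section \<open>Regularity in time\<close>

text \<open>
  The equation at every time instead of almost every time, with the time derivative expressed by the
  space derivatives.
\<close>

definition regular_solution ::
  "real \<Rightarrow> real \<Rightarrow> (real \<Rightarrow> real) \<Rightarrow> (real \<Rightarrow> real \<Rightarrow> real) \<Rightarrow> (real \<Rightarrow> real \<Rightarrow> real) \<Rightarrow> (real \<Rightarrow> real \<Rightarrow> real) \<Rightarrow> bool"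
  where
  "regular_solution T \<epsilon> \<theta> u ux uxx \<longleftrightarrow>
     continuous_on ({0..T} \<times> UNIV) (\<lambda>(t, x). u t x) \<and>
     continuous_on ({0<..<T} \<times> UNIV) (\<lambda>(t, x). ux t x) \<and>
     continuous_on ({0<..<T} \<times> UNIV) (\<lambda>(t, x). uxx t x) \<and>
     (\<forall>t\<in>{0<..<T}. \<forall>x. (u t has_real_derivative ux t x) (at x)) \<and>
     (\<forall>t\<in>{0<..<T}. \<forall>x. (ux t has_real_derivative uxx t x) (at x)) \<and>
     (\<forall>t\<in>{0<..<T}. \<forall>x. ((\<lambda>s. u s x) has_real_derivative
        u t x * ux t x - \<epsilon> * (uxx t x + \<theta> t * (ux t x)\<^sup>2)) (at t))"

lemma continuous_on_slice:
  assumes "continuous_on (S \<times> UNIV) (\<lambda>(t, x). f t x)"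
  shows "continuous_on S (\<lambda>t. f t x)"
proof -
  have "continuous_on S (\<lambda>t. (\<lambda>(t, x). f t x) (t, x))"
    by (rule continuous_on_compose2[OF assms]) (auto intro!: continuous_intros)
  then show ?thesis by simp
qed

text \<open>
  For continuous \<open>\<theta>\<close> the right-hand side of the equation is continuous in time. As \<open>u\<close> is the integral
  of a function that agrees with it almost everywhere, the fundamental theorem of calculus gives the
  derivative everywhere.
\<close>

lemma classical_solution_regular:
  assumes sol: "classical_solution T \<epsilon> \<theta> uT u" and \<theta>: "continuous_on {0..T} \<theta>"
  obtains ux uxx where "regular_solution T \<epsilon> \<theta> u ux uxx"
proof -
  obtain ut ux uxx where
    ux: "\<forall>t\<in>{0<..<T}. \<forall>x. (u t has_real_derivative ux t x) (at x)" and
    uxx: "\<forall>t\<in>{0<..<T}. \<forall>x. (ux t has_real_derivative uxx t x) (at x)" and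
    c_ux: "continuous_on ({0<..<T} \<times> UNIV) (\<lambda>(t, x). ux t x)" and
    c_uxx: "continuous_on ({0<..<T} \<times> UNIV) (\<lambda>(t, x). uxx t x)" and
    ut: "\<forall>x a b. 0 < a \<and> a \<le> b \<and> b < T \<longrightarrow>
           set_integrable lborel {a..b} (\<lambda>t. ut t x) \<and>
           u b x - u a x = (LINT t:{a..b}|lborel. ut t x)" and
    eq: "AE t in lborel. t \<in> {0<..<T} \<longrightarrow>
           (\<forall>x. ((\<lambda>s. u s x) has_real_derivative ut t x) (at t) \<and>
              - ut t x + u t x * ux t x = \<epsilon> * (uxx t x + \<theta> t * \<bar>ux t x\<bar>\<^sup>2))"
    using sol unfolding classical_solution_def by blast
  have c_u: "continuous_on ({0..T} \<times> UNIV) (\<lambda>(t, x). u t x)"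
    using sol by (simp add: classical_solution_def)
  define f where "f = (\<lambda>t x. u t x * ux t x - \<epsilon> * (uxx t x + \<theta> t * (ux t x)\<^sup>2))"
  have cf: "continuous_on {0<..<T} (\<lambda>t. f t x)" for x
  proof -
    have "continuous_on {0<..<T} (\<lambda>t. u t x)" "continuous_on {0<..<T} \<theta>"
      by (auto intro: continuous_on_subset[OF continuous_on_slice[OF c_u]] continuous_on_subset[OF \<theta>])
    then show ?thesis unfolding f_def
      using continuous_on_slice[OF c_ux, of x] continuous_on_slice[OF c_uxx, of x]
      by (intro continuous_intros)
  qed
  have "((\<lambda>s. u s x) has_real_derivative f t x) (at t)" if t: "t \<in> {0<..<T}" for t x
  proof -
    define a b where "a = t / 2" and "b = (t + T) / 2"
    have ab: "0 < a" "a < t" "t < b" "b < T" using t by (auto simp: a_def b_def)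
    have sub: "{a..s} \<subseteq> {0<..<T}" if "s \<le> b" for s using ab that by auto
    have cfab: "continuous_on {a..b} (\<lambda>t. f t x)"
      by (rule continuous_on_subset[OF cf sub]) simp
    have inc: "u s x - u a x = integral {a..s} (\<lambda>t. f t x)" if s: "s \<in> {a..b}" for s
    proof -
      have int: "set_integrable lborel {a..s} (\<lambda>t. ut t x)"
        and inc_ut: "u s x - u a x = (LINT t:{a..s}|lborel. ut t x)"
        using ut ab s by auto
      have cfas: "continuous_on {a..s} (\<lambda>t. f t x)"
        by (rule continuous_on_subset[OF cf sub]) (use s in auto)
      have intf: "set_integrable lborel {a..s} (\<lambda>t. f t x)"
        by (rule borel_integrable_atLeastAtMost'[OF cfas])
      note inc_ut
      also have "(LINT t:{a..s}|lborel. ut t x) = (LINT t:{a..s}|lborel. f t x)"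
        unfolding set_lebesgue_integral_def
      proof (rule integral_cong_AE)
        show "AE t in lborel. indicat_real {a..s} t *\<^sub>R ut t x = indicat_real {a..s} t *\<^sub>R f t x"
          using eq
        proof eventually_elim
          case (elim t)
          show ?case
          proof (cases "t \<in> {a..s}")
            case True
            then have "t \<in> {0<..<T}" using sub[of s] s by auto
            with elim have "- ut t x + u t x * ux t x = \<epsilon> * (uxx t x + \<theta> t * \<bar>ux t x\<bar>\<^sup>2)" by blast
            then show ?thesis by (simp add: f_def)
          qed simp
        qed
      qed (use int intf in \<open>auto simp: set_integrable_def\<close>)
      also have "\<dots> = integral {a..s} (\<lambda>t. f t x)"
        by (rule set_borel_integral_eq_integral[OF intf])
      finally show ?thesis .
    qed
    have "((\<lambda>s. u a x + integral {a..s} (\<lambda>t. f t x)) has_real_derivative f t x) (at t within {a..b})"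
      using integral_has_real_derivative[OF cfab, of t] ab
      by (auto intro!: derivative_eq_intros)
    then have "((\<lambda>s. u s x) has_real_derivative f t x) (at t within {a..b})"
    proof (rule has_field_derivative_transform_within[OF _ zero_less_one])
      show "u a x + integral {a..s} (\<lambda>t. f t x) = u s x" if "s \<in> {a..b}" for s
        using inc[OF that] by simp
    qed (use ab in auto)
    moreover have "at t within {a..b} = at t" using ab by (simp add: at_within_Icc_at)
    ultimately show ?thesis by simp
  qed
  then have "regular_solution T \<epsilon> \<theta> u ux uxx"
    unfolding regular_solution_def using c_u c_ux c_uxx ux uxx by (simp add: f_def)
  then show ?thesis using that by blast
qed

section \<open>The entropy inequality\<close>

text \<open>
  Admissible test functions: supported in \<open>[-X,X]\<close>, with the derivatives that the integrations by parts
  below produce.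
\<close>

definition weight :: "real \<Rightarrow> real \<Rightarrow> (real \<Rightarrow> real \<Rightarrow> real) \<Rightarrow> (real \<Rightarrow> real \<Rightarrow> real) \<Rightarrow>
    (real \<Rightarrow> real \<Rightarrow> real) \<Rightarrow> (real \<Rightarrow> real \<Rightarrow> real) \<Rightarrow> bool" where
  "weight T X \<Psi> \<Psi>t \<Psi>x \<Psi>xx \<longleftrightarrow>
     continuous_on ({0..T} \<times> UNIV) (\<lambda>(t, x). \<Psi> t x) \<and>
     continuous_on ({0..T} \<times> UNIV) (\<lambda>(t, x). \<Psi>t t x) \<and>
     continuous_on ({0..T} \<times> UNIV) (\<lambda>(t, x). \<Psi>x t x) \<and>
     continuous_on ({0..T} \<times> UNIV) (\<lambda>(t, x). \<Psi>xx t x) \<and>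
     (\<forall>t\<in>{0<..<T}. \<forall>x. ((\<lambda>s. \<Psi> s x) has_real_derivative \<Psi>t t x) (at t)) \<and>
     (\<forall>t\<in>{0<..<T}. \<forall>x. (\<Psi> t has_real_derivative \<Psi>x t x) (at x)) \<and>
     (\<forall>t\<in>{0<..<T}. \<forall>x. (\<Psi>x t has_real_derivative \<Psi>xx t x) (at x)) \<and>
     (\<forall>t\<in>{0..T}. \<forall>x. 0 \<le> \<Psi> t x) \<and>
     (\<forall>t\<in>{0..T}. \<forall>x. X \<le> \<bar>x\<bar> \<longrightarrow> \<Psi> t x = 0 \<and> \<Psi>x t x = 0)"

lemma continuous_on_slice_x:
  assumes "continuous_on (S \<times> UNIV) (\<lambda>(t, x). f t x)" "t \<in> S"
  shows "continuous_on A (\<lambda>x. f t x)"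
  using continuous_on_compose2[OF assms(1), of A "\<lambda>x. (t, x)"] assms(2)
  by (simp add: continuous_on_Pair image_subset_iff)

lemma regular_solution_continuous:
  "regular_solution T \<epsilon> \<theta> u ux uxx \<Longrightarrow> t \<in> {0..T} \<Longrightarrow> continuous_on A (u t)"
  unfolding regular_solution_def by (rule continuous_on_slice_x) blast+

lemma weight_continuous:
  assumes "weight T X \<Psi> \<Psi>t \<Psi>x \<Psi>xx" "t \<in> {0..T}"
  shows "continuous_on A (\<Psi> t)" "continuous_on A (\<Psi>t t)" "continuous_on A (\<Psi>x t)" "continuous_on A (\<Psi>xx t)"
  using assms(1) unfolding weight_def
  by (rule_tac continuous_on_slice_x[OF _ assms(2)]; blast)+

lemma DERIV_integral_param:
  fixes g gt :: "real \<Rightarrow> real \<Rightarrow> real"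
  assumes D: "\<And>s x. s \<in> {0<..<T} \<Longrightarrow> ((\<lambda>s. g s x) has_real_derivative gt s x) (at s)"
    and g: "continuous_on ({0<..<T} \<times> UNIV) (\<lambda>(t, x). g t x)"
    and gt: "continuous_on ({0<..<T} \<times> UNIV) (\<lambda>(t, x). gt t x)"
    and t: "t \<in> {0<..<T}"
  shows "((\<lambda>s. integral {a..b} (g s)) has_real_derivative integral {a..b} (gt t)) (at t)"
proof -
  have "((\<lambda>s. integral (cbox a b) (g s)) has_real_derivative integral (cbox a b) (gt t)) (at t within {0<..<T})"
  proof (rule leibniz_rule_field_derivative)
    show "((\<lambda>s. g s x) has_real_derivative gt s x) (at s within {0<..<T})" if "s \<in> {0<..<T}" for s x
      using D[OF that] by (rule has_field_derivative_at_within)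
    show "g s integrable_on cbox a b" if "s \<in> {0<..<T}" for s
      by (intro integrable_continuous continuous_on_slice_x[OF g that])
    show "continuous_on ({0<..<T} \<times> cbox a b) (\<lambda>(t, x). gt t x)"
      by (rule continuous_on_subset[OF gt]) auto
  qed (use t in auto)
  then show ?thesis using t by (simp add: at_within_open[of t "{0<..<T}"])
qed

text \<open>
  After differentiation under the integral, the space terms are an exact derivative up to those in
  which the derivatives fall on the weight, and the two terms with the square of the gradient combine
  to \<open>- \<epsilon> (h'' - \<theta> h') (\<partial>\<^sub>x u)\<^sup>2\<close>, which has a sign. The inequality holds up to the endpoints 0 and \<open>T\<close>,
  where the derivatives of \<open>u\<close> need not exist, because the functional is continuous there.
\<close>

lemma entropy_inequality:
  fixes h h' h'' H :: "real \<Rightarrow> real"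
  assumes reg: "regular_solution T \<epsilon> \<theta> u ux uxx" and \<epsilon>: "0 \<le> \<epsilon>" and \<theta>: "continuous_on {0..T} \<theta>"
    and W: "weight T X \<Psi> \<Psi>t \<Psi>x \<Psi>xx" and X: "0 \<le> X"
    and Dh: "\<And>v. (h has_real_derivative h' v) (at v)"
    and Dh': "\<And>v. (h' has_real_derivative h'' v) (at v)"
    and DH: "\<And>v. (H has_real_derivative v * h' v) (at v)"
    and ab: "0 \<le> a" "a \<le> b" "b \<le> T"
    and convex: "\<And>t x. a < t \<Longrightarrow> t < b \<Longrightarrow> \<theta> t * h' (u t x) \<le> h'' (u t x)"
    and K: "\<And>t. a < t \<Longrightarrow> t < b \<Longrightarrow>
      integral {-X..X} (\<lambda>x. H (u t x) * \<Psi>x t x + \<epsilon> * h (u t x) * \<Psi>xx t x - h (u t x) * \<Psi>t t x) \<le> K"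
  shows "integral {-X..X} (\<lambda>x. h (u a x) * \<Psi> a x) \<le> integral {-X..X} (\<lambda>x. h (u b x) * \<Psi> b x) + K * (b - a)"
proof -
  let ?Q = "{0..T} \<times> (UNIV :: real set)" and ?Q' = "{0<..<T} \<times> (UNIV :: real set)"
  have c_h: "continuous_on S h" and c_h': "continuous_on S h'" and c_H: "continuous_on S H" for S
    by (rule DERIV_continuous_on[OF has_field_derivative_at_within[OF Dh]]
        DERIV_continuous_on[OF has_field_derivative_at_within[OF Dh']]
        DERIV_continuous_on[OF has_field_derivative_at_within[OF DH]])+
  have cu: "continuous_on ?Q (\<lambda>p. u (fst p) (snd p))"
    and cux: "continuous_on ?Q' (\<lambda>p. ux (fst p) (snd p))"
    and cuxx: "continuous_on ?Q' (\<lambda>p. uxx (fst p) (snd p))"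
    using reg by (simp_all add: regular_solution_def split_beta)
  have c\<Psi>: "continuous_on ?Q (\<lambda>p. \<Psi> (fst p) (snd p))"
    and c\<Psi>t: "continuous_on ?Q (\<lambda>p. \<Psi>t (fst p) (snd p))"
    and c\<Psi>x: "continuous_on ?Q (\<lambda>p. \<Psi>x (fst p) (snd p))"
    and c\<Psi>xx: "continuous_on ?Q (\<lambda>p. \<Psi>xx (fst p) (snd p))"
    using W by (simp_all add: weight_def split_beta)
  note to_h = continuous_on_compose2[OF c_h[of UNIV]]
    and to_h' = continuous_on_compose2[OF c_h'[of UNIV]]
    and to_H = continuous_on_compose2[OF c_H[of UNIV]]
  define E where "E = (\<lambda>t. integral (cbox (-X) X) (\<lambda>x. h (u t x) * \<Psi> t x))"
  define ut where "ut = (\<lambda>t x. u t x * ux t x - \<epsilon> * (uxx t x + \<theta> t * (ux t x)\<^sup>2))"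
  define J where "J = (\<lambda>t x. H (u t x) * \<Psi>x t x + \<epsilon> * h (u t x) * \<Psi>xx t x - h (u t x) * \<Psi>t t x)"
  have E_cont: "continuous_on {0..T} E"
    unfolding E_def
  proof (rule integral_continuous_on_param)
    have "continuous_on ?Q (\<lambda>p. h (u (fst p) (snd p)) * \<Psi> (fst p) (snd p))"
      by (intro continuous_intros c\<Psi> to_h cu) auto
    then show "continuous_on ({0..T} \<times> cbox (- X) X) (\<lambda>(t, x). h (u t x) * \<Psi> t x)"
      unfolding split_beta by (rule continuous_on_subset) auto
  qed
  have mono: "E a + K * a \<le> E b + K * b"
  proof (rule DERIV_nonneg_imp_increasing_open[OF ab(2), of "\<lambda>t. E t + K * t"])
    show "continuous_on {a..b} (\<lambda>t. E t + K * t)"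
      by (intro continuous_intros continuous_on_subset[OF E_cont]) (use ab in auto)
    fix t assume t: "a < t" "t < b"
    then have tT: "t \<in> {0<..<T}" using ab by auto
    then have tT': "t \<in> {0..T}" by auto
    have Du: "(u t has_real_derivative ux t x) (at x)" "(ux t has_real_derivative uxx t x) (at x)"
      "(\<Psi> t has_real_derivative \<Psi>x t x) (at x)" "(\<Psi>x t has_real_derivative \<Psi>xx t x) (at x)" for x
      using reg W tT by (auto simp: regular_solution_def weight_def)
    have s: "continuous_on A (u t)" "continuous_on A (ux t)" "continuous_on A (uxx t)"
      "continuous_on A (\<Psi> t)" "continuous_on A (\<Psi>x t)" "continuous_on A (\<Psi>xx t)" "continuous_on A (\<Psi>t t)" for A
      using reg W tT tT' by (auto intro: continuous_on_slice_x simp: regular_solution_def weight_def)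
    note comp = to_h[OF s(1) subset_UNIV] to_h'[OF s(1) subset_UNIV] to_H[OF s(1) subset_UNIV]
    define Et where "Et = (\<lambda>x. h' (u t x) * ut t x * \<Psi> t x + h (u t x) * \<Psi>t t x)"
    \<comment> \<open>The boundary terms of the integrations by parts, collected in one function that vanishes at \<open>\<plusminus>X\<close>.\<close>
    define Q where "Q = (\<lambda>x. - H (u t x) * \<Psi> t x + \<epsilon> * h' (u t x) * ux t x * \<Psi> t x - \<epsilon> * h (u t x) * \<Psi>x t x)"
    define Qx where "Qx = (\<lambda>x. - u t x * h' (u t x) * ux t x * \<Psi> t x
       + \<epsilon> * (h'' (u t x) * (ux t x)\<^sup>2 + h' (u t x) * uxx t x) * \<Psi> t x
       - H (u t x) * \<Psi>x t x - \<epsilon> * h (u t x) * \<Psi>xx t x)"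
    have DE: "(E has_real_derivative integral {-X..X} Et) (at t)"
    proof -
      define G where "G = (\<lambda>t x. h (u t x) * \<Psi> t x)"
      define Gt where "Gt = (\<lambda>t x. h' (u t x) * ut t x * \<Psi> t x + h (u t x) * \<Psi>t t x)"
      have sub: "?Q' \<subseteq> ?Q" by auto
      have c\<theta>: "continuous_on ?Q' (\<lambda>p. \<theta> (fst p))"
        by (rule continuous_on_compose2[OF \<theta>]) (auto intro: continuous_on_fst)
      note cu' = continuous_on_subset[OF cu sub]
      note cs = to_h'[OF cu' subset_UNIV] to_h[OF cu' subset_UNIV] c\<theta> cux cuxx cu'
        continuous_on_subset[OF c\<Psi> sub] continuous_on_subset[OF c\<Psi>t sub]
      have "((\<lambda>s. integral {-X..X} (G s)) has_real_derivative integral {-X..X} (Gt t)) (at t)"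
      proof (rule DERIV_integral_param[OF _ _ _ tT])
        fix s x assume s: "s \<in> {0<..<T}"
        have D: "((\<lambda>s. u s x) has_real_derivative ut s x) (at s)"
          "((\<lambda>s. \<Psi> s x) has_real_derivative \<Psi>t s x) (at s)"
          using reg W s by (auto simp: regular_solution_def weight_def ut_def)
        show "((\<lambda>s. G s x) has_real_derivative Gt s x) (at s)"
          unfolding G_def Gt_def
          using DERIV_mult[OF DERIV_chain2[OF Dh D(1)] D(2)] by (simp add: algebra_simps)
      next
        show "continuous_on ?Q' (\<lambda>(t, x). G t x)"
          unfolding split_beta G_def by (intro continuous_on_mult cs)
        show "continuous_on ?Q' (\<lambda>(t, x). Gt t x)"
          unfolding split_beta Gt_def ut_def
          by (intro continuous_on_add continuous_on_mult continuous_on_diff continuous_on_power cs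
              continuous_on_const)
      qed
      then show ?thesis by (simp add: E_def G_def Gt_def Et_def)
    qed
    have "(Q has_real_derivative Qx x) (at x)" for x
      unfolding Q_def Qx_def
      by (rule derivative_eq_intros DERIV_chain2[OF Dh] DERIV_chain2[OF Dh'] DERIV_chain2[OF DH] Du refl)+
        (simp add: algebra_simps power2_eq_square)
    then have "(Qx has_integral Q X - Q (-X)) {-X..X}"
      using X by (intro fundamental_theorem_of_calculus)
        (auto simp: has_real_derivative_iff_has_vector_derivative[symmetric] intro: has_field_derivative_at_within)
    moreover have "Q X = 0" "Q (-X) = 0"
      using W tT' X by (auto simp: Q_def weight_def)
    ultimately have Q0: "(Qx has_integral 0) {-X..X}" by simp
    have Jint: "J t integrable_on {-X..X}"
      unfolding J_def by (intro integrable_continuous_real continuous_intros comp s)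
    have Etint: "Et integrable_on {-X..X}"
      unfolding Et_def ut_def by (intro integrable_continuous_real continuous_intros comp s)
    have "- integral {-X..X} Et = integral {-X..X} (\<lambda>x. - Et x)" by simp
    also have "\<dots> \<le> integral {-X..X} (\<lambda>x. Qx x + J t x)"
    proof (rule integral_le)
      show "(\<lambda>x. - Et x) integrable_on {-X..X}" using Etint by (rule integrable_neg)
      show "(\<lambda>x. Qx x + J t x) integrable_on {-X..X}"
        by (intro integrable_add Jint has_integral_integrable[OF Q0])
      fix x
      have "0 \<le> \<epsilon> * (h'' (u t x) - \<theta> t * h' (u t x)) * (ux t x)\<^sup>2 * \<Psi> t x"
        using \<epsilon> convex[OF t, of x] W tT' by (intro mult_nonneg_nonneg) (auto simp: weight_def)
      then show "- Et x \<le> Qx x + J t x"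
        unfolding Et_def Qx_def J_def ut_def by (simp add: algebra_simps)
    qed
    also have "\<dots> = integral {-X..X} (J t)"
      using Q0 Jint by (subst integral_add) (auto simp: integral_unique)
    also have "\<dots> \<le> K" using K[OF t] by (simp add: J_def)
    finally have "0 \<le> integral {-X..X} Et + K" by simp
    moreover have "((\<lambda>t. E t + K * t) has_real_derivative integral {-X..X} Et + K) (at t)"
      by (auto intro!: derivative_eq_intros DE)
    ultimately show "\<exists>y. ((\<lambda>t. E t + K * t) has_real_derivative y) (at t) \<and> 0 \<le> y" by blast
  qed
  then show ?thesis by (simp add: E_def algebra_simps)
qed

section \<open>Finite speed of propagation\<close>

lemma ppow_Suc: "ppow (Suc n) z = max 0 z * ppow n z"
  by (simp add: ppow_def)

lemma ppow_Suc': "0 < n \<Longrightarrow> ppow (Suc n) z = z * ppow n z"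
  by (cases "0 \<le> z") (simp_all add: ppow_pos ppow_neg)

text \<open>
  Equal to 1 for \<open>\<bar>x\<bar> \<le> R + B t\<close>, with a transition layer of width \<open>\<rho>\<close> that moves outwards with speed \<open>B\<close>.
\<close>

definition cone_weight :: "real \<Rightarrow> real \<Rightarrow> real \<Rightarrow> real \<Rightarrow> real \<Rightarrow> real" where
  "cone_weight R \<rho> B t x = cutoff ((x - R - B * t) / \<rho>) * cutoff ((- x - R - B * t) / \<rho>)"

definition cone_t :: "real \<Rightarrow> real \<Rightarrow> real \<Rightarrow> real \<Rightarrow> real \<Rightarrow> real" where
  "cone_t R \<rho> B t x = - (B / \<rho>) *
     (cutoff' ((x - R - B * t) / \<rho>) * cutoff ((- x - R - B * t) / \<rho>)
      + cutoff ((x - R - B * t) / \<rho>) * cutoff' ((- x - R - B * t) / \<rho>))"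

definition cone_x :: "real \<Rightarrow> real \<Rightarrow> real \<Rightarrow> real \<Rightarrow> real \<Rightarrow> real" where
  "cone_x R \<rho> B t x = 1 / \<rho> *
     (cutoff' ((x - R - B * t) / \<rho>) * cutoff ((- x - R - B * t) / \<rho>)
      - cutoff ((x - R - B * t) / \<rho>) * cutoff' ((- x - R - B * t) / \<rho>))"

definition cone_xx :: "real \<Rightarrow> real \<Rightarrow> real \<Rightarrow> real \<Rightarrow> real \<Rightarrow> real" where
  "cone_xx R \<rho> B t x = 1 / \<rho>\<^sup>2 *
     (cutoff'' ((x - R - B * t) / \<rho>) * cutoff ((- x - R - B * t) / \<rho>)
      - 2 * (cutoff' ((x - R - B * t) / \<rho>) * cutoff' ((- x - R - B * t) / \<rho>))
      + cutoff ((x - R - B * t) / \<rho>) * cutoff'' ((- x - R - B * t) / \<rho>))"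

lemma cone_nonneg [simp]: "0 \<le> cone_weight R \<rho> B t x"
  and cone_le_one [simp]: "cone_weight R \<rho> B t x \<le> 1"
  by (auto simp: cone_weight_def intro!: mult_le_one)

lemma cone_eq_one: "0 \<le> t \<Longrightarrow> 0 \<le> B \<Longrightarrow> 0 < \<rho> \<Longrightarrow> \<bar>x\<bar> \<le> R \<Longrightarrow> cone_weight R \<rho> B t x = 1"
proof -
  assume a: "0 \<le> t" "0 \<le> B" "0 < \<rho>" "\<bar>x\<bar> \<le> R"
  then have "0 \<le> B * t" by simp
  with a have "x - R - B * t \<le> 0" "- x - R - B * t \<le> 0" by linarith+
  with a have "(x - R - B * t) / \<rho> \<le> 0" "(- x - R - B * t) / \<rho> \<le> 0"
    by (simp_all only: divide_nonpos_pos)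
  then show ?thesis by (simp add: cone_weight_def)
qed

text \<open>
  The layer moves outwards at least as fast as the fluxes below, which are bounded by \<open>B\<close> times the
  entropy; hence their contribution is dominated by the time derivative of the weight.
\<close>

lemma cone_transport:
  assumes "0 \<le> B" "0 < \<rho>"
  shows "B * \<bar>cone_x R \<rho> B t x\<bar> \<le> cone_t R \<rho> B t x"
proof -
  define p q where "p = - (cutoff' ((x - R - B * t) / \<rho>) * cutoff ((- x - R - B * t) / \<rho>))"
    and "q = - (cutoff ((x - R - B * t) / \<rho>) * cutoff' ((- x - R - B * t) / \<rho>))"
  have pq: "0 \<le> p" "0 \<le> q"
    by (auto simp: p_def q_def mult_nonneg_nonpos mult_nonpos_nonneg)
  have "\<bar>cone_x R \<rho> B t x\<bar> = 1 / \<rho> * \<bar>q - p\<bar>"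
    using assms by (simp add: cone_x_def p_def q_def abs_mult)
  also have "\<dots> \<le> 1 / \<rho> * (p + q)" using pq assms by (intro mult_left_mono) auto
  finally have "B * \<bar>cone_x R \<rho> B t x\<bar> \<le> B * (1 / \<rho> * (p + q))"
    using assms by (intro mult_left_mono) auto
  also have "\<dots> = cone_t R \<rho> B t x" by (simp add: cone_t_def p_def q_def algebra_simps)
  finally show ?thesis .
qed

lemma abs_cone_xx_le: "\<bar>cone_xx R \<rho> B t x\<bar> \<le> 20736 / \<rho>\<^sup>2"
proof -
  let ?y = "(x - R - B * t) / \<rho>" and ?z = "(- x - R - B * t) / \<rho>"
  have "\<bar>cutoff'' ?y * cutoff ?z\<bar> \<le> 72 * 72" "\<bar>cutoff' ?y * cutoff' ?z\<bar> \<le> 72 * 72"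
    "\<bar>cutoff ?y * cutoff'' ?z\<bar> \<le> 72 * 72"
    unfolding abs_mult by (intro mult_mono abs_cutoff_le; simp)+
  then have "\<bar>cutoff'' ?y * cutoff ?z - 2 * (cutoff' ?y * cutoff' ?z) + cutoff ?y * cutoff'' ?z\<bar> \<le> 20736"
    by linarith
  then show ?thesis by (simp add: cone_xx_def abs_mult divide_right_mono)
qed

lemma weight_cone:
  assumes "0 \<le> B" "0 < \<rho>"
  shows "weight T (R + B * T + \<rho>) (cone_weight R \<rho> B) (cone_t R \<rho> B) (cone_x R \<rho> B) (cone_xx R \<rho> B)"
  unfolding weight_def
proof (intro conjI ballI allI impI)
  show "continuous_on ({0..T} \<times> UNIV) (\<lambda>(t, x). cone_weight R \<rho> B t x)"
    "continuous_on ({0..T} \<times> UNIV) (\<lambda>(t, x). cone_t R \<rho> B t x)"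
    "continuous_on ({0..T} \<times> UNIV) (\<lambda>(t, x). cone_x R \<rho> B t x)"
    "continuous_on ({0..T} \<times> UNIV) (\<lambda>(t, x). cone_xx R \<rho> B t x)"
    unfolding split_beta cone_weight_def cone_t_def cone_x_def cone_xx_def using assms
    by (intro continuous_intros; simp)+
  fix t x
  show "((\<lambda>s. cone_weight R \<rho> B s x) has_real_derivative cone_t R \<rho> B t x) (at t)"
    unfolding cone_weight_def cone_t_def using assms
    by (auto intro!: derivative_eq_intros simp: field_simps)
  show "(cone_weight R \<rho> B t has_real_derivative cone_x R \<rho> B t x) (at x)"
    unfolding cone_weight_def[abs_def] cone_x_def using assms
    by (auto intro!: derivative_eq_intros simp: field_simps)
  show "(cone_x R \<rho> B t has_real_derivative cone_xx R \<rho> B t x) (at x)"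
    unfolding cone_x_def[abs_def] cone_xx_def using assms
    by (auto intro!: derivative_eq_intros simp: field_simps power2_eq_square)
next
  fix t x :: real assume t: "t \<in> {0..T}" and x: "R + B * T + \<rho> \<le> \<bar>x\<bar>"
  have "B * t \<le> B * T" using assms t by (intro mult_left_mono) auto
  with x have "\<rho> \<le> x - R - B * t \<or> \<rho> \<le> - x - R - B * t" by linarith
  then have "1 \<le> (x - R - B * t) / \<rho> \<or> 1 \<le> (- x - R - B * t) / \<rho>"
    using assms by (simp add: le_divide_eq)
  then show "cone_weight R \<rho> B t x = 0" "cone_x R \<rho> B t x = 0"
    by (auto simp: cone_weight_def cone_x_def)
qed simp

text \<open>
  For \<open>h\<close> the \<open>n\<close>-th truncated power, \<open>h'' \<ge> \<theta> h'\<close> reduces to \<open>n - 1 \<ge> s \<theta> w\<close> for the excess \<open>w\<close>, which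
  holds for large \<open>n\<close> because \<open>u\<close> is bounded. Powers have an explicit flux, and it satisfies
  \<open>\<bar>H\<bar> \<le> B h\<close>, so that only the viscous term of the weight survives. The sign \<open>s\<close> treats values above
  \<open>k\<close> and below \<open>- k\<close> together. The number 20736 is \<open>4 * 72\<^sup>2\<close>.
\<close>

lemma excess_inequality:
  assumes reg: "regular_solution T \<epsilon> \<theta> u ux uxx" and \<epsilon>: "0 \<le> \<epsilon>" and \<theta>: "continuous_on {0..T} \<theta>"
    and \<Theta>: "\<And>t. t \<in> {0..T} \<Longrightarrow> \<bar>\<theta> t\<bar> \<le> \<Theta>"
    and B: "\<And>t x. t \<in> {0..T} \<Longrightarrow> \<bar>u t x\<bar> \<le> B"
    and k: "0 \<le> k" "k \<le> B" and n: "3 \<le> n" "\<Theta> * B \<le> real n - 1" and s: "s = 1 \<or> s = -1"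
    and R: "0 \<le> R" and \<rho>: "0 < \<rho>" and t: "t \<in> {0..T}" and X: "X = R + B * T + \<rho>"
  shows "integral {-X..X} (\<lambda>x. ppow n (s * u t x - k) * cone_weight R \<rho> B t x)
    \<le> integral {-X..X} (\<lambda>x. ppow n (s * u T x - k) * cone_weight R \<rho> B T x)
      + (\<epsilon> * B ^ n * (20736 / \<rho>\<^sup>2) * (2 * X)) * (T - t)"
proof -
  have B0: "0 \<le> B" using k by simp
  have ss: "s * s = 1" using s by auto
  have X0: "0 \<le> X" using X R \<rho> B0 t by (simp add: add_nonneg_nonneg)
  obtain m where m: "n = Suc (Suc m)" "0 < m"
    using n(1) by (metis Suc_le_D Suc_le_lessD numeral_3_eq_3 Suc_le_mono)
  define h where "h = (\<lambda>v. ppow n (s * v - k))"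
  define h' where "h' = (\<lambda>v. real n * ppow (n - 1) (s * v - k) * s)"
  define h'' where "h'' = (\<lambda>v. real n * (real (n - 1) * ppow (n - 2) (s * v - k)))"
  define H where "H = (\<lambda>v. s * (k * ppow n (s * v - k) + n / (n + 1) * ppow (Suc n) (s * v - k)))"
  have W: "weight T X (cone_weight R \<rho> B) (cone_t R \<rho> B) (cone_x R \<rho> B) (cone_xx R \<rho> B)"
    unfolding X by (rule weight_cone[OF B0 \<rho>])
  have h_nonneg: "0 \<le> h v" for v by (simp add: h_def)
  have h_le: "h (u t x) \<le> B ^ n" if "t \<in> {0..T}" for t x
  proof -
    have "s * u t x - k \<le> B" using B[OF that, of x] k s by auto
    then show ?thesis unfolding h_def ppow_def using B0 by (intro power_mono) auto
  qed
  have H_le: "\<bar>H (u t x)\<bar> \<le> B * h (u t x)" if "t \<in> {0..T}" for t x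
  proof -
    define w where "w = max 0 (s * u t x - k)"
    have "k + w \<le> B" using B[OF that, of x] k s by (auto simp: w_def)
    moreover have "n / (n + 1) * w \<le> 1 * w" by (intro mult_right_mono) (auto simp: w_def)
    ultimately have le: "k + n / (n + 1) * w \<le> B" by simp
    have "H (u t x) = s * ((k + n / (n + 1) * w) * h (u t x))"
      by (simp add: H_def h_def w_def ppow_Suc algebra_simps)
    then have "\<bar>H (u t x)\<bar> = \<bar>(k + n / (n + 1) * w) * h (u t x)\<bar>" using s by auto
    also have "\<dots> = (k + n / (n + 1) * w) * h (u t x)"
      using k h_nonneg by (intro abs_of_nonneg mult_nonneg_nonneg add_nonneg_nonneg) (auto simp: w_def)
    also have "\<dots> \<le> B * h (u t x)" using le h_nonneg by (intro mult_right_mono)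
    finally show ?thesis .
  qed
  have "integral {-X..X} (\<lambda>x. h (u t x) * cone_weight R \<rho> B t x)
    \<le> integral {-X..X} (\<lambda>x. h (u T x) * cone_weight R \<rho> B T x)
      + (\<epsilon> * B ^ n * (20736 / \<rho>\<^sup>2) * (2 * X)) * (T - t)"
  proof (rule entropy_inequality[OF reg \<epsilon> \<theta> W X0])
    show "(h has_real_derivative h' v) (at v)" for v
      unfolding h_def h'_def using n(1) by (auto intro!: derivative_eq_intros)
    show "(h' has_real_derivative h'' v) (at v)" for v
      unfolding h'_def h''_def m(1) using m(2) s
      by (auto intro!: derivative_eq_intros simp: algebra_simps)
    show "(H has_real_derivative v * h' v) (at v)" for v
    proof -
      define w where "w = s * v - k"
      have v: "v = s * (w + k)" using ss by (simp add: w_def algebra_simps)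
      have "(H has_real_derivative s * (k * (n * ppow (n - 1) w * s) + n / (n + 1) * (real (Suc n) * ppow n w * s))) (at v)"
        unfolding H_def w_def using n(1) by (auto intro!: derivative_eq_intros)
      moreover have "s * (k * (n * ppow (n - 1) w * s) + n / (n + 1) * (real (Suc n) * ppow n w * s)) = v * h' v"
      proof -
        have n: "n / (n + 1) * (real (Suc n) * ppow n w * s) = n * ppow n w * s" by simp
        have w: "ppow n w = w * ppow (n - 1) w" using m ppow_Suc'[of "n - 1" w] by simp
        have "s * (k * (n * ppow (n - 1) w * s) + n / (n + 1) * (real (Suc n) * ppow n w * s))
            = s * (k * (n * ppow (n - 1) w * s) + n * (w * ppow (n - 1) w) * s)"
          by (simp only: n, simp only: w)
        also have "\<dots> = s * (w + k) * (n * ppow (n - 1) w * s)" by (simp add: algebra_simps)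
        also have "\<dots> = v * h' v" unfolding h'_def w_def[symmetric] using v by simp
        finally show ?thesis .
      qed
      ultimately show ?thesis by simp
    qed
    show "\<theta> r * h' (u r x) \<le> h'' (u r x)" if r: "t < r" "r < T" for r x
    proof -
      have rT: "r \<in> {0..T}" using r t by auto
      define w where "w = max 0 (s * u r x - k)"
      have w: "0 \<le> w" "w \<le> B" using B[OF rT, of x] k s by (auto simp: w_def)
      have "\<theta> r * (w * s) \<le> \<bar>\<theta> r * (w * s)\<bar>" by (rule abs_ge_self)
      also have "\<dots> = \<bar>\<theta> r\<bar> * w" using s w by (auto simp: abs_mult)
      also have "\<dots> \<le> \<Theta> * B" using \<Theta>[OF rT] w by (intro mult_mono) auto
      also note n(2)
      finally have "\<theta> r * (w * s) \<le> real (n - 1)" using n(1) by (simp add: of_nat_diff)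
      then have "n * ppow (n - 2) (s * u r x - k) * (\<theta> r * (w * s)) \<le> n * ppow (n - 2) (s * u r x - k) * real (n - 1)"
        by (intro mult_left_mono) auto
      then show ?thesis
        by (simp add: h'_def h''_def m(1) ppow_Suc w_def algebra_simps)
    qed
    fix r assume r: "t < r" "r < T"
    then have rT: "r \<in> {0..T}" using t by auto
    let ?J = "\<lambda>x. H (u r x) * cone_x R \<rho> B r x + \<epsilon> * h (u r x) * cone_xx R \<rho> B r x - h (u r x) * cone_t R \<rho> B r x"
    have J_le: "?J x \<le> \<epsilon> * B ^ n * (20736 / \<rho>\<^sup>2)" for x
    proof -
      have "H (u r x) * cone_x R \<rho> B r x \<le> \<bar>H (u r x)\<bar> * \<bar>cone_x R \<rho> B r x\<bar>"
        by (metis abs_ge_self abs_mult)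
      also have "\<dots> \<le> B * h (u r x) * \<bar>cone_x R \<rho> B r x\<bar>" using H_le[OF rT] by (intro mult_right_mono) auto
      also have "\<dots> = h (u r x) * (B * \<bar>cone_x R \<rho> B r x\<bar>)" by simp
      also have "\<dots> \<le> h (u r x) * cone_t R \<rho> B r x"
        using h_nonneg cone_transport[OF B0 \<rho>] by (intro mult_left_mono)
      finally have 1: "H (u r x) * cone_x R \<rho> B r x \<le> h (u r x) * cone_t R \<rho> B r x" .
      have "\<epsilon> * h (u r x) * cone_xx R \<rho> B r x \<le> \<epsilon> * h (u r x) * \<bar>cone_xx R \<rho> B r x\<bar>"
        using \<epsilon> h_nonneg by (intro mult_left_mono mult_nonneg_nonneg) auto
      also have "\<dots> \<le> \<epsilon> * B ^ n * (20736 / \<rho>\<^sup>2)"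
        using \<epsilon> h_nonneg h_le[OF rT] abs_cone_xx_le B0 by (intro mult_mono mult_nonneg_nonneg) auto
      finally show ?thesis using 1 by linarith
    qed
    have cont_u: "continuous_on A (u r)" for A
      by (rule regular_solution_continuous[OF reg rT])
    have "continuous_on {-X..X} ?J"
      unfolding h_def H_def
      by (intro continuous_intros cont_u weight_continuous[OF W rT])
    then have "integral {-X..X} ?J \<le> integral {-X..X} (\<lambda>_. \<epsilon> * B ^ n * (20736 / \<rho>\<^sup>2))"
      using J_le by (intro integral_le integrable_continuous_real) auto
    also have "\<dots> = \<epsilon> * B ^ n * (20736 / \<rho>\<^sup>2) * (2 * X)" using X0 by simp
    finally show "integral {-X..X} ?J \<le> \<epsilon> * B ^ n * (20736 / \<rho>\<^sup>2) * (2 * X)" .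
  qed (use t in auto)
  then show ?thesis by (simp add: h_def)
qed

section \<open>Maximum principle and values outside the unit interval\<close>

lemma continuous_on_Icc_bounded:
  fixes f :: "real \<Rightarrow> real"
  assumes "continuous_on {a..b} f"
  obtains C where "\<And>t. t \<in> {a..b} \<Longrightarrow> \<bar>f t\<bar> \<le> C"
proof -
  have "bounded (f ` {a..b})"
    by (rule compact_imp_bounded[OF compact_continuous_image[OF assms compact_Icc]])
  then obtain C where "\<forall>x\<in>f ` {a..b}. \<bar>x\<bar> \<le> C" unfolding bounded_real by blast
  then show ?thesis using that by blast
qed

text \<open>
  Let the layer width and the radius of the weight tend to infinity together: the viscous error is of
  order \<open>1 / R\<close>, and the excess over \<open>M\<close> is absent at the terminal time. The bound \<open>B\<close> of the
  individual solution enters only through constants.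
\<close>

lemma maximum_principle:
  assumes T: "0 < T" and reg: "regular_solution T \<epsilon> \<theta> u ux uxx" and \<epsilon>: "0 \<le> \<epsilon>" and \<theta>: "continuous_on {0..T} \<theta>"
    and bounded: "\<And>t x. t \<in> {0..T} \<Longrightarrow> \<bar>u t x\<bar> \<le> B"
    and terminal: "\<And>x. \<bar>u T x\<bar> \<le> M" and M: "0 \<le> M"
    and t: "t \<in> {0..T}"
  shows "\<bar>u t x\<bar> \<le> M"
proof -
  obtain \<Theta> where \<Theta>: "\<And>t. t \<in> {0..T} \<Longrightarrow> \<bar>\<theta> t\<bar> \<le> \<Theta>"
    using continuous_on_Icc_bounded[OF \<theta>] by blast
  define B' where "B' = max B M"
  have B': "\<bar>u t x\<bar> \<le> B'" if "t \<in> {0..T}" for t x using bounded[OF that, of x] by (simp add: B'_def)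
  have B'0: "0 \<le> B'" using M by (simp add: B'_def)
  obtain n0 :: nat where n0: "\<Theta> * B' + 1 \<le> real n0" using real_arch_simple by blast
  define n where "n = max n0 3"
  have n: "3 \<le> n" "\<Theta> * B' \<le> real n - 1" using n0 by (auto simp: n_def)
  have le: "s * u t x \<le> M" if s: "s = 1 \<or> s = -1" for s
  proof -
    define f where "f = (\<lambda>x. ppow n (s * u t x - M))"
    define r where "r = \<bar>x\<bar> + 1"
    define g where "g = (\<lambda>R. (\<epsilon> * B' ^ n * (20736 / R\<^sup>2) * (2 * (R + B' * T + R))) * (T - t))"
    have cont_u: "continuous_on A (u t)" for A
      by (rule regular_solution_continuous[OF reg t])
    have cont_f: "continuous_on A f" for A unfolding f_def by (intro continuous_intros cont_u)
    have f0: "0 \<le> f x" for x by (simp add: f_def)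
    have le_g: "integral {-r..r} f \<le> g R" if R: "r \<le> R" for R
    proof -
      have R0: "0 < R" using R by (simp add: r_def)
      define X where "X = R + B' * T + R"
      have "0 \<le> B' * T" using B'0 T by simp
      with R R0 have rX: "r \<le> X" by (simp add: X_def)
      have cont_c: "continuous_on A (cone_weight R R B' t)" for A
        by (rule weight_continuous(1)[OF weight_cone[OF B'0 R0] t])
      have "integral {-r..r} f = integral {-r..r} (\<lambda>x. f x * cone_weight R R B' t x)"
      proof (rule integral_cong)
        fix x assume "x \<in> {-r..r}"
        then have "cone_weight R R B' t x = 1" using R t B'0 R0 by (intro cone_eq_one) auto
        then show "f x = f x * cone_weight R R B' t x" by simp
      qed
      also have "\<dots> \<le> integral {-X..X} (\<lambda>x. f x * cone_weight R R B' t x)"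
        using rX f0 by (intro integral_subset_le integrable_continuous_real continuous_intros cont_f cont_c) auto
      also have "\<dots> \<le> integral {-X..X} (\<lambda>x. ppow n (s * u T x - M) * cone_weight R R B' T x) + g R"
        using excess_inequality[OF reg \<epsilon> \<theta> \<Theta> B' M _ n s _ R0 t X_def] R0 unfolding f_def g_def X_def
        by (simp add: B'_def)
      also have "(\<lambda>x. ppow n (s * u T x - M) * cone_weight R R B' T x) = (\<lambda>_. 0)"
      proof
        fix x
        have "s * u T x - M \<le> 0" using terminal[of x] s by auto
        then show "ppow n (s * u T x - M) * cone_weight R R B' T x = 0" using n by (simp add: ppow_neg)
      qed
      finally show ?thesis by simp
    qed
    have "(g \<longlongrightarrow> 0) at_top" unfolding g_def by real_asymp
    then have "integral {-r..r} f \<le> 0"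
      by (rule tendsto_lowerbound)
        (use le_g in \<open>auto simp: eventually_at_top_linorder\<close>)
    moreover have "0 \<le> integral {-r..r} f"
      using f0 by (intro integral_nonneg integrable_continuous_real cont_f)
    ultimately have "(f has_integral 0) (cbox (-r) r)"
      using integrable_integral[OF integrable_continuous_real[OF cont_f], of "-r" r] by simp
    then have "f x = 0"
      by (rule has_integral_0_cbox_imp_0[OF cont_f, rotated]) (use f0 in \<open>auto simp: r_def\<close>)
    then show ?thesis using n by (auto simp: f_def ppow_def split: if_splits)
  qed
  from le[of 1] le[of "-1"] show ?thesis by simp
qed

text \<open>
  What the limit needs of a family of solutions; the conditions are asked only for small \<open>\<epsilon>\<close>.
\<close>

definition vanishing_viscosity_family ::
  "real \<Rightarrow> (real \<Rightarrow> real) \<Rightarrow> real \<Rightarrow> (real \<Rightarrow> real \<Rightarrow> real \<Rightarrow> real) \<Rightarrow> bool" where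
  "vanishing_viscosity_family T \<theta> M u \<longleftrightarrow>
     0 < T \<and> 1 \<le> M \<and> continuous_on {0..T} \<theta> \<and>
     (\<forall>\<^sub>F \<epsilon> in at_right 0. 0 < \<epsilon> \<and> (\<exists>ux uxx. regular_solution T \<epsilon> \<theta> (u \<epsilon>) ux uxx) \<and>
        (\<forall>t\<in>{0..T}. \<forall>x. \<bar>u \<epsilon> t x\<bar> \<le> M)) \<and>
     (\<forall>X. ((\<lambda>\<epsilon>. integral {-X..X} (\<lambda>x. \<bar>u \<epsilon> T x - indicator {..<0} x\<bar>)) \<longlongrightarrow> 0) (at_right 0))"

text \<open>
  The distance to the interval \<open>[0,1]\<close>.
\<close>

definition defect :: "real \<Rightarrow> real" where
  "defect v = max 0 (v - 1) + max 0 (- v)"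

text \<open>
  Converts smallness of integrals of powers back to smallness in mean.
\<close>

lemma max_0_le_ppow:
  assumes "0 < \<alpha>"
  shows "max 0 w \<le> \<alpha> + ppow (Suc n) w / \<alpha> ^ n"
proof (cases "w \<le> \<alpha>")
  case True
  then show ?thesis using assms by (intro add_increasing2) auto
next
  case False
  then have "\<alpha> ^ n \<le> w ^ n" using assms by (intro power_mono) auto
  then have "w * 1 \<le> w * (w ^ n / \<alpha> ^ n)" using assms False by (intro mult_left_mono) auto
  then show ?thesis using assms False by (simp add: ppow_def)
qed

lemma terminal_integrable:
  fixes f :: "real \<Rightarrow> real"
  assumes "continuous_on UNIV f"
  shows "(\<lambda>x. \<bar>f x - indicator {..<0} x\<bar>) integrable_on {a..b}"
proof -
  have "set_integrable lborel {a..b} f"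
    by (rule borel_integrable_atLeastAtMost'[OF continuous_on_subset[OF assms]]) simp
  moreover have "set_integrable lborel {a..b} (indicator {..<0::real} :: real \<Rightarrow> real)"
    unfolding set_integrable_def
    by (rule Bochner_Integration.integrable_bound[where f = "indicator {a..b} :: real \<Rightarrow> real"])
      (auto simp: indicator_def emeasure_lborel_Icc_eq intro!: integrable_real_indicator)
  ultimately have "set_integrable lborel {a..b} (\<lambda>x. \<bar>f x - indicator {..<0} x\<bar>)"
    by (intro set_integrable_abs set_integral_diff)
  then show ?thesis using set_borel_integral_eq_integral(1) by blast
qed

text \<open>
  At the terminal time the excess is bounded by the distance to the indicator function, whose values
  lie in \<open>[0,1]\<close>; afterwards it grows only by the viscous error, which is linear in \<open>\<epsilon>\<close>.
\<close>

lemma excess_vanishes: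
  assumes F: "vanishing_viscosity_family T \<theta> M u"
    and sk: "s = 1 \<and> k = 1 \<or> s = -1 \<and> k = 0" and R: "0 \<le> R" and \<tau>: "0 < \<tau>"
  shows "\<forall>\<^sub>F \<epsilon> in at_right 0. \<forall>t\<in>{0..T}. integral {-R..R} (\<lambda>x. max 0 (s * u \<epsilon> t x - k)) \<le> \<tau>"
proof -
  have T: "0 < T" and M: "1 \<le> M" and \<theta>: "continuous_on {0..T} \<theta>"
    and good: "\<forall>\<^sub>F \<epsilon> in at_right 0. 0 < \<epsilon> \<and> (\<exists>ux uxx. regular_solution T \<epsilon> \<theta> (u \<epsilon>) ux uxx) \<and>
        (\<forall>t\<in>{0..T}. \<forall>x. \<bar>u \<epsilon> t x\<bar> \<le> M)"
    and tmnl: "\<And>X. ((\<lambda>\<epsilon>. integral {-X..X} (\<lambda>x. \<bar>u \<epsilon> T x - indicator {..<0} x\<bar>)) \<longlongrightarrow> 0) (at_right 0)"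
    using F by (auto simp: vanishing_viscosity_family_def)
  obtain \<Theta> where \<Theta>: "\<And>t. t \<in> {0..T} \<Longrightarrow> \<bar>\<theta> t\<bar> \<le> \<Theta>"
    using continuous_on_Icc_bounded[OF \<theta>] by blast
  obtain n0 :: nat where n0: "\<Theta> * M + 1 \<le> real n0" using real_arch_simple by blast
  define m where "m = max n0 3 - 1"
  define n where "n = Suc m"
  have n: "3 \<le> n" "\<Theta> * M \<le> real n - 1" using n0 by (auto simp: n_def m_def)
  have s: "s = 1 \<or> s = -1" and k: "0 \<le> k" "k \<le> M" using sk M by auto
  define X where "X = R + M * T + 1"
  have X: "R \<le> X" "0 \<le> X" using R M T by (auto simp: X_def)
  define \<alpha> where "\<alpha> = \<tau> / (4 * R + 4)"
  have \<alpha>: "0 < \<alpha>" "\<alpha> * (2 * R) \<le> \<tau> / 2" using \<tau> R by (auto simp: \<alpha>_def field_simps)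
  define g where "g = (\<lambda>\<epsilon>. M ^ m * integral {-X..X} (\<lambda>x. \<bar>u \<epsilon> T x - indicator {..<0} x\<bar>)
    + (\<epsilon> * M ^ n * 20736 * (2 * X)) * T)"
  have "(g \<longlongrightarrow> M ^ m * 0 + (0 * M ^ n * 20736 * (2 * X)) * T) (at_right 0)"
    unfolding g_def by (intro tendsto_intros tmnl)
  then have "(g \<longlongrightarrow> 0) (at_right 0)" by simp
  moreover have "0 < \<tau> / 2 * \<alpha> ^ m" using \<tau> \<alpha> by simp
  ultimately have "\<forall>\<^sub>F \<epsilon> in at_right 0. g \<epsilon> < \<tau> / 2 * \<alpha> ^ m" by (rule order_tendstoD)
  with good show ?thesis
  proof eventually_elim
    case (elim \<epsilon>)
    then obtain ux uxx where reg: "regular_solution T \<epsilon> \<theta> (u \<epsilon>) ux uxx" and \<epsilon>: "0 < \<epsilon>"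
      and B: "\<And>t x. t \<in> {0..T} \<Longrightarrow> \<bar>u \<epsilon> t x\<bar> \<le> M" by blast
    have cont_u: "continuous_on A (u \<epsilon> t)" if "t \<in> {0..T}" for A t
      by (rule regular_solution_continuous[OF reg that])
    have cont_c: "continuous_on A (cone_weight R 1 M t)" if "t \<in> {0..T}" for A t
      using M by (intro weight_continuous(1)[OF weight_cone that]) auto
    show ?case
    proof
      fix t assume t: "t \<in> {0..T}"
      have T': "T \<in> {0..T}" using T by simp
      define f where "f = (\<lambda>t x. ppow n (s * u \<epsilon> t x - k))"
      have f0: "0 \<le> f t x" for t x by (simp add: f_def)
      have cont_f: "continuous_on A (f t)" if "t \<in> {0..T}" for A t
        unfolding f_def by (intro continuous_intros cont_u that)
      have "integral {-R..R} (f t) = integral {-R..R} (\<lambda>x. f t x * cone_weight R 1 M t x)"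
      proof (rule integral_cong)
        fix x assume "x \<in> {-R..R}"
        then have "cone_weight R 1 M t x = 1" using t M by (intro cone_eq_one) auto
        then show "f t x = f t x * cone_weight R 1 M t x" by simp
      qed
      also have "\<dots> \<le> integral {-X..X} (\<lambda>x. f t x * cone_weight R 1 M t x)"
        using X f0 by (intro integral_subset_le integrable_continuous_real continuous_intros cont_f cont_c t) auto
      also have "\<dots> \<le> integral {-X..X} (\<lambda>x. f T x * cone_weight R 1 M T x) + (\<epsilon> * M ^ n * 20736 * (2 * X)) * (T - t)"
        using excess_inequality[OF reg _ \<theta> \<Theta> B k n s R zero_less_one t X_def] \<epsilon> unfolding f_def
        by simp
      also have "\<dots> \<le> M ^ m * integral {-X..X} (\<lambda>x. \<bar>u \<epsilon> T x - indicator {..<0} x\<bar>) + (\<epsilon> * M ^ n * 20736 * (2 * X)) * T"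
      proof (rule add_mono)
        have "integral {-X..X} (\<lambda>x. f T x * cone_weight R 1 M T x)
          \<le> integral {-X..X} (\<lambda>x. M ^ m * \<bar>u \<epsilon> T x - indicator {..<0} x\<bar>)"
        proof (rule integral_le)
          show "(\<lambda>x. f T x * cone_weight R 1 M T x) integrable_on {- X..X}"
            by (intro integrable_continuous_real continuous_intros cont_f cont_c T')
          show "(\<lambda>x. M ^ m * \<bar>u \<epsilon> T x - indicat_real {..<0} x\<bar>) integrable_on {- X..X}"
            using integrable_cmul[OF terminal_integrable[OF cont_u[OF T'], of "- X" X], of "M ^ m"] by simp
          fix x
          define w where "w = max 0 (s * u \<epsilon> T x - k)"
          have w: "0 \<le> w" "w \<le> M" "w \<le> \<bar>u \<epsilon> T x - indicator {..<0} x\<bar>"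
            using B[OF T', of x] sk by (auto simp: w_def indicator_def)
          have "f T x * cone_weight R 1 M T x \<le> f T x * 1"
            using f0 by (intro mult_left_mono) auto
          also have "\<dots> = w ^ m * w" by (simp add: f_def n_def ppow_def w_def)
          also have "\<dots> \<le> M ^ m * \<bar>u \<epsilon> T x - indicator {..<0} x\<bar>"
            using w M by (intro mult_mono power_mono) auto
          finally show "f T x * cone_weight R 1 M T x \<le> M ^ m * \<bar>u \<epsilon> T x - indicator {..<0} x\<bar>" .
        qed
        then show "integral {-X..X} (\<lambda>x. f T x * cone_weight R 1 M T x)
          \<le> M ^ m * integral {-X..X} (\<lambda>x. \<bar>u \<epsilon> T x - indicator {..<0} x\<bar>)" by simp
        show "\<epsilon> * M ^ n * 20736 * (2 * X) * (T - t) \<le> \<epsilon> * M ^ n * 20736 * (2 * X) * T"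
          using \<epsilon> M X t by (intro mult_left_mono) auto
      qed
      also have "\<dots> \<le> \<tau> / 2 * \<alpha> ^ m" using elim by (simp add: g_def)
      finally have int_f: "integral {-R..R} (f t) \<le> \<tau> / 2 * \<alpha> ^ m" .
      have "integral {-R..R} (\<lambda>x. max 0 (s * u \<epsilon> t x - k)) \<le> integral {-R..R} (\<lambda>x. \<alpha> + f t x / \<alpha> ^ m)"
        using max_0_le_ppow[OF \<alpha>(1)] \<alpha> unfolding f_def n_def
        by (intro integral_le integrable_continuous_real continuous_intros cont_u t) auto
      also have "\<dots> = \<alpha> * (2 * R) + integral {-R..R} (f t) / \<alpha> ^ m"
        using R \<alpha> by (subst integral_add) (auto intro!: integrable_continuous_real continuous_intros cont_f t)
      also have "\<dots> \<le> \<tau> / 2 + \<tau> / 2"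
        using \<alpha> int_f by (intro add_mono) (auto simp: field_simps)
      finally show "integral {-R..R} (\<lambda>x. max 0 (s * u \<epsilon> t x - k)) \<le> \<tau>" by simp
    qed
  qed
qed

lemma defect_vanishes:
  assumes F: "vanishing_viscosity_family T \<theta> M u" and R: "0 \<le> R" and \<tau>: "0 < \<tau>"
  shows "\<forall>\<^sub>F \<epsilon> in at_right 0. \<forall>t\<in>{0..T}. integral {-R..R} (\<lambda>x. defect (u \<epsilon> t x)) \<le> \<tau>"
proof -
  have good: "\<forall>\<^sub>F \<epsilon> in at_right 0. \<exists>ux uxx. regular_solution T \<epsilon> \<theta> (u \<epsilon>) ux uxx"
    using F by (auto simp: vanishing_viscosity_family_def elim: eventually_mono)
  have "\<forall>\<^sub>F \<epsilon> in at_right 0. \<forall>t\<in>{0..T}. integral {-R..R} (\<lambda>x. max 0 (1 * u \<epsilon> t x - 1)) \<le> \<tau> / 2"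
    "\<forall>\<^sub>F \<epsilon> in at_right 0. \<forall>t\<in>{0..T}. integral {-R..R} (\<lambda>x. max 0 (-1 * u \<epsilon> t x - 0)) \<le> \<tau> / 2"
    by (rule excess_vanishes[OF F _ R]; use \<tau> in simp)+
  with good show ?thesis
  proof eventually_elim
    case (elim \<epsilon>)
    then obtain ux uxx where reg: "regular_solution T \<epsilon> \<theta> (u \<epsilon>) ux uxx" by blast
    have "integral {-R..R} (\<lambda>x. defect (u \<epsilon> t x)) =
       integral {-R..R} (\<lambda>x. max 0 (u \<epsilon> t x - 1)) + integral {-R..R} (\<lambda>x. max 0 (- u \<epsilon> t x))" if "t \<in> {0..T}" for t
      unfolding defect_def
      by (intro integral_add integrable_continuous_real continuous_intros regular_solution_continuous[OF reg that])
    then show ?case using elim(2,3) by fastforce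
  qed
qed

section \<open>Entropies and weights at the shock front\<close>

lemma weight_mult:
  assumes W: "weight T X P Pt Px Pxx"
    and c: "continuous_on ({0..T} \<times> UNIV) (\<lambda>(t, x). g t x)"
      "continuous_on ({0..T} \<times> UNIV) (\<lambda>(t, x). gt t x)"
      "continuous_on ({0..T} \<times> UNIV) (\<lambda>(t, x). gx t x)"
      "continuous_on ({0..T} \<times> UNIV) (\<lambda>(t, x). gxx t x)"
    and Dt: "\<And>t x. t \<in> {0<..<T} \<Longrightarrow> ((\<lambda>s. g s x) has_real_derivative gt t x) (at t)"
    and Dx: "\<And>t x. t \<in> {0<..<T} \<Longrightarrow> (g t has_real_derivative gx t x) (at x)"
    and Dxx: "\<And>t x. t \<in> {0<..<T} \<Longrightarrow> (gx t has_real_derivative gxx t x) (at x)"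
    and nonneg: "\<And>t x. 0 \<le> g t x"
  shows "weight T X (\<lambda>t x. P t x * g t x) (\<lambda>t x. Pt t x * g t x + P t x * gt t x)
    (\<lambda>t x. Px t x * g t x + P t x * gx t x)
    (\<lambda>t x. Pxx t x * g t x + 2 * (Px t x * gx t x) + P t x * gxx t x)"
proof -
  have cP: "continuous_on ({0..T} \<times> UNIV) (\<lambda>p. P (fst p) (snd p))"
    "continuous_on ({0..T} \<times> UNIV) (\<lambda>p. Pt (fst p) (snd p))"
    "continuous_on ({0..T} \<times> UNIV) (\<lambda>p. Px (fst p) (snd p))"
    "continuous_on ({0..T} \<times> UNIV) (\<lambda>p. Pxx (fst p) (snd p))"
    using W by (simp_all add: weight_def split_beta)
  have DP: "t \<in> {0<..<T} \<Longrightarrow> ((\<lambda>s. P s x) has_real_derivative Pt t x) (at t)"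
    "t \<in> {0<..<T} \<Longrightarrow> (P t has_real_derivative Px t x) (at x)"
    "t \<in> {0<..<T} \<Longrightarrow> (Px t has_real_derivative Pxx t x) (at x)" for t x
    using W by (simp_all add: weight_def)
  note c' = c[unfolded split_beta]
  show ?thesis
    unfolding weight_def split_beta
  proof (intro conjI ballI allI impI)
    fix t x assume t: "t \<in> {0<..<T}"
    show "((\<lambda>s. P s x * g s x) has_real_derivative Pt t x * g t x + P t x * gt t x) (at t)"
      using DERIV_mult[OF DP(1)[OF t] Dt[OF t]] by (simp add: algebra_simps)
    show "((\<lambda>x. P t x * g t x) has_real_derivative Px t x * g t x + P t x * gx t x) (at x)"
      using DERIV_mult[OF DP(2)[OF t] Dx[OF t]] by (simp add: algebra_simps)
    show "((\<lambda>x. Px t x * g t x + P t x * gx t x) has_real_derivative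
        Pxx t x * g t x + 2 * (Px t x * gx t x) + P t x * gxx t x) (at x)"
      using DERIV_add[OF DERIV_mult[OF DP(3)[OF t] Dx[OF t]] DERIV_mult[OF DP(2)[OF t] Dxx[OF t]]]
      by (simp add: algebra_simps)
  qed (use W nonneg in \<open>auto simp: weight_def intro!: continuous_intros cP c'\<close>)
qed

lemma weight_bounded:
  assumes W: "weight T X \<Psi> \<Psi>t \<Psi>x \<Psi>xx"
  obtains C where "0 \<le> C"
    "\<And>t x. t \<in> {0..T} \<Longrightarrow> x \<in> {-X..X} \<Longrightarrow> \<bar>\<Psi>t t x\<bar> \<le> C \<and> \<bar>\<Psi>x t x\<bar> \<le> C \<and> \<bar>\<Psi>xx t x\<bar> \<le> C"
proof -
  have bd: "\<exists>C. \<forall>t\<in>{0..T}. \<forall>x\<in>{-X..X}. \<bar>f t x\<bar> \<le> C"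
    if "continuous_on ({0..T} \<times> UNIV) (\<lambda>(t, x). f t x)" for f :: "real \<Rightarrow> real \<Rightarrow> real"
  proof -
    have "compact ((\<lambda>(t, x). f t x) ` ({0..T} \<times> {-X..X}))"
      by (intro compact_continuous_image continuous_on_subset[OF that] compact_Times) auto
    then have "bounded ((\<lambda>(t, x). f t x) ` ({0..T} \<times> {-X..X}))" by (rule compact_imp_bounded)
    then obtain C where "\<forall>y\<in>(\<lambda>(t, x). f t x) ` ({0..T} \<times> {-X..X}). \<bar>y\<bar> \<le> C"
      unfolding bounded_real by blast
    then show ?thesis by (intro exI[of _ C]) force
  qed
  obtain C1 C2 C3 where C:
    "\<forall>t\<in>{0..T}. \<forall>x\<in>{-X..X}. \<bar>\<Psi>t t x\<bar> \<le> C1"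
    "\<forall>t\<in>{0..T}. \<forall>x\<in>{-X..X}. \<bar>\<Psi>x t x\<bar> \<le> C2"
    "\<forall>t\<in>{0..T}. \<forall>x\<in>{-X..X}. \<bar>\<Psi>xx t x\<bar> \<le> C3"
    using bd[of \<Psi>t] bd[of \<Psi>x] bd[of \<Psi>xx] W unfolding weight_def by blast
  show ?thesis
  proof (rule that[of "max 0 (max C1 (max C2 C3))"])
    fix t x assume tx: "t \<in> {0..T}" "x \<in> {-X..X}"
    have "\<bar>\<Psi>t t x\<bar> \<le> C1" "\<bar>\<Psi>x t x\<bar> \<le> C2" "\<bar>\<Psi>xx t x\<bar> \<le> C3" using C tx by blast+
    then show "\<bar>\<Psi>t t x\<bar> \<le> max 0 (max C1 (max C2 C3)) \<and> \<bar>\<Psi>x t x\<bar> \<le> max 0 (max C1 (max C2 C3))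
      \<and> \<bar>\<Psi>xx t x\<bar> \<le> max 0 (max C1 (max C2 C3))" by auto
  qed simp
qed

text \<open>
  The sign of the derivative \<open>(v - \<sigma>) exp (\<theta> v)\<close> changes once, from negative to positive.
\<close>

lemma flux_minus_ent_le:
  assumes "0 \<le> v" "v \<le> 1"
  shows "flux \<theta> v - \<sigma> * ent \<theta> v \<le> max 0 (flux \<theta> 1 - \<sigma> * ent \<theta> 1)"
proof -
  define G where "G = (\<lambda>v. flux \<theta> v - \<sigma> * ent \<theta> v)"
  have D: "(G has_real_derivative (v - \<sigma>) * exp (\<theta> * v)) (at v)" for v
    unfolding G_def by (auto intro!: derivative_eq_intros DERIV_flux_at DERIV_ent_at simp: algebra_simps)
  show ?thesis
  proof (cases "v \<le> \<sigma>")
    case True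
    have "G v \<le> G 0"
      by (rule DERIV_nonpos_imp_nonincreasing[OF assms(1)])
        (use D True in \<open>force intro!: mult_nonpos_nonneg\<close>)
    then show ?thesis by (simp add: G_def)
  next
    case False
    have "G v \<le> G 1"
      by (rule DERIV_nonneg_imp_nondecreasing[OF assms(2)])
        (use D False in \<open>force intro!: mult_nonneg_nonneg\<close>)
    then show ?thesis by (simp add: G_def)
  qed
qed

lemma exp_bounds:
  fixes v M \<theta> :: real
  assumes "\<bar>v\<bar> \<le> M"
  shows "exp (\<theta> * v) \<le> exp (\<bar>\<theta>\<bar> * M)" "exp (- (\<bar>\<theta>\<bar> * M)) \<le> exp (\<theta> * v)"
proof -
  have "\<bar>\<theta> * v\<bar> \<le> \<bar>\<theta>\<bar> * M" 
    using mult_left_mono[OF assms abs_ge_zero[of \<theta>]] by (simp add: abs_mult)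
  then show "exp (\<theta> * v) \<le> exp (\<bar>\<theta>\<bar> * M)" "exp (- (\<bar>\<theta>\<bar> * M)) \<le> exp (\<theta> * v)" by auto
qed

lemma ent_flux_Lipschitz:
  assumes "\<bar>v\<bar> \<le> M" "\<bar>w\<bar> \<le> M"
  shows "\<bar>ent \<theta> v - ent \<theta> w\<bar> \<le> exp (\<bar>\<theta>\<bar> * M) * \<bar>v - w\<bar>"
    and "\<bar>flux \<theta> v - flux \<theta> w\<bar> \<le> M * exp (\<bar>\<theta>\<bar> * M) * \<bar>v - w\<bar>"
proof -
  have "norm (ent \<theta> v - ent \<theta> w) \<le> exp (\<bar>\<theta>\<bar> * M) * norm (v - w)"
  proof (rule field_differentiable_bound[of "{-M..M}" _ "\<lambda>v. exp (\<theta> * v)"])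
    fix z assume "z \<in> {-M..M}"
    then have "\<bar>z\<bar> \<le> M" by auto
    then have "exp (\<theta> * z) \<le> exp (\<bar>\<theta>\<bar> * M)" by (rule exp_bounds)
    then show "norm (exp (\<theta> * z)) \<le> exp (\<bar>\<theta>\<bar> * M)" by simp
  qed (use assms in \<open>auto intro!: has_field_derivative_at_within[OF DERIV_ent_at]\<close>)
  then show "\<bar>ent \<theta> v - ent \<theta> w\<bar> \<le> exp (\<bar>\<theta>\<bar> * M) * \<bar>v - w\<bar>" by simp
  have "norm (flux \<theta> v - flux \<theta> w) \<le> (M * exp (\<bar>\<theta>\<bar> * M)) * norm (v - w)"
  proof (rule field_differentiable_bound[of "{-M..M}" _ "\<lambda>v. v * exp (\<theta> * v)"])
    fix z assume "z \<in> {-M..M}"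
    then have z: "\<bar>z\<bar> \<le> M" by auto
    show "norm (z * exp (\<theta> * z)) \<le> M * exp (\<bar>\<theta>\<bar> * M)"
      unfolding real_norm_def abs_mult abs_exp_cancel
      by (rule mult_mono[OF z exp_bounds(1)[OF z]]) (use z in auto)
  qed (use assms in \<open>auto intro!: has_field_derivative_at_within[OF DERIV_flux_at]\<close>)
  then show "\<bar>flux \<theta> v - flux \<theta> w\<bar> \<le> M * exp (\<bar>\<theta>\<bar> * M) * \<bar>v - w\<bar>" by simp
qed

lemma flux_le_ent_diff:
  assumes "0 \<le> v" "v \<le> w" "w \<le> 1"
  shows "0 \<le> flux \<theta> w - flux \<theta> v" "flux \<theta> w - flux \<theta> v \<le> ent \<theta> w - ent \<theta> v"
    "exp (- \<bar>\<theta>\<bar>) * (w - v) \<le> ent \<theta> w - ent \<theta> v"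
proof -
  have "(\<lambda>_. 0) w - (\<lambda>_. 0) v \<le> flux \<theta> w - flux \<theta> v"
    by (rule has_DERIV_mono[OF assms(2) DERIV_const DERIV_flux_at]) (use assms in auto)
  then show "0 \<le> flux \<theta> w - flux \<theta> v" by simp
  show "flux \<theta> w - flux \<theta> v \<le> ent \<theta> w - ent \<theta> v"
    by (rule has_DERIV_mono[OF assms(2) DERIV_flux_at DERIV_ent_at]) (use assms in auto)
  have "exp (- \<bar>\<theta>\<bar>) * w - exp (- \<bar>\<theta>\<bar>) * v \<le> ent \<theta> w - ent \<theta> v"
  proof (rule has_DERIV_mono[OF assms(2) _ DERIV_ent_at])
    show "((\<lambda>v. exp (- \<bar>\<theta>\<bar>) * v) has_real_derivative exp (- \<bar>\<theta>\<bar>)) (at x)" for x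
      by (auto intro!: derivative_eq_intros)
    show "exp (- \<bar>\<theta>\<bar>) \<le> exp (\<theta> * x)" if "v \<le> x" "x \<le> w" for x
      using exp_bounds(2)[of x 1 \<theta>] assms that by simp
  qed
  then show "exp (- \<bar>\<theta>\<bar>) * (w - v) \<le> ent \<theta> w - ent \<theta> v" by (simp add: algebra_simps)
qed

text \<open>
  One side of the shock: \<open>s = 1\<close> is the region ahead of \<open>c\<close>, where the limit is 0, and \<open>s = -1\<close> the region
  behind, where it is 1.
\<close>

locale shock_front =
  fixes T M R \<delta> s :: real and c c' \<theta> :: "real \<Rightarrow> real"
  assumes T: "0 < T" and M: "1 \<le> M" and R: "0 \<le> R" and \<delta>: "0 < \<delta>" and s: "s = 1 \<or> s = -1"
    and c_cont: "continuous_on {0..T} c" and c'_cont: "continuous_on {0..T} c'"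
    and Dc: "\<And>t. t \<in> {0<..<T} \<Longrightarrow> (c has_real_derivative c' t) (at t)"
    and cT: "c T = 0" and \<theta>_cont: "continuous_on {0..T} \<theta>"
    and speed: "\<And>t. t \<in> {0..T} \<Longrightarrow> speed (\<theta> t) = - c' t"
begin

definition X :: real where "X = R + M * T + 1"

definition far_value :: real where "far_value = (if s = 1 then 0 else 1)"

text \<open>
  The cutoff of this coordinate equals 1 beyond the curve \<open>c t + s (\<delta> (T - t) + \<delta>)\<close> and vanishes at
  distance \<open>\<delta>\<close> before it. At \<open>t = T\<close> it vanishes up to the jump of the terminal value at 0, and backwards
  in time the curve moves with speed \<open>- c' t + s \<delta>\<close>.
\<close>

definition front_coord :: "real \<Rightarrow> real \<Rightarrow> real" where
  "front_coord t x = s * (c t + s * (\<delta> * (T - t) + \<delta>) - x) / \<delta>"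

definition \<Psi> :: "real \<Rightarrow> real \<Rightarrow> real" where
  "\<Psi> t x = cone_weight R 1 M t x * cutoff (front_coord t x)"

definition \<Psi>t :: "real \<Rightarrow> real \<Rightarrow> real" where
  "\<Psi>t t x = cone_t R 1 M t x * cutoff (front_coord t x) + cone_weight R 1 M t x * (cutoff' (front_coord t x) * (s * (c' t - s * \<delta>) / \<delta>))"

definition \<Psi>x :: "real \<Rightarrow> real \<Rightarrow> real" where
  "\<Psi>x t x = cone_x R 1 M t x * cutoff (front_coord t x) + cone_weight R 1 M t x * (cutoff' (front_coord t x) * (- s / \<delta>))"

definition \<Psi>xx :: "real \<Rightarrow> real \<Rightarrow> real" where
  "\<Psi>xx t x = cone_xx R 1 M t x * cutoff (front_coord t x) + 2 * (cone_x R 1 M t x * (cutoff' (front_coord t x) * (- s / \<delta>)))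
     + cone_weight R 1 M t x * (cutoff'' (front_coord t x) * (- s / \<delta>) * (- s / \<delta>))"

lemma X_nonneg: "0 \<le> X" and R_le_X: "R \<le> X"
  using R M T by (auto simp: X_def)

lemma weight_front: "weight T X \<Psi> \<Psi>t \<Psi>x \<Psi>xx"
proof -
  have c1: "continuous_on ({0..T} \<times> UNIV) (\<lambda>p. c (fst p))" "continuous_on ({0..T} \<times> UNIV) (\<lambda>p. c' (fst p))"
    by (rule continuous_on_compose2[OF c_cont] continuous_on_compose2[OF c'_cont], auto intro: continuous_on_fst)+
  have cy: "continuous_on ({0..T} \<times> UNIV) (\<lambda>p. front_coord (fst p) (snd p))"
    unfolding front_coord_def using \<delta> by (intro continuous_intros c1) auto
  have Dyt: "((\<lambda>r. front_coord r x) has_real_derivative s * (c' t - s * \<delta>) / \<delta>) (at t)" if "t \<in> {0<..<T}" for t x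
    unfolding front_coord_def using Dc[OF that] \<delta> by (auto intro!: derivative_eq_intros simp: field_simps)
  have Dyx: "(front_coord t has_real_derivative - s / \<delta>) (at x)" for t x
    unfolding front_coord_def using \<delta> by (auto intro!: derivative_eq_intros)
  show ?thesis
    unfolding \<Psi>_def[abs_def] \<Psi>t_def[abs_def] \<Psi>x_def[abs_def] \<Psi>xx_def[abs_def] X_def
  proof (rule weight_mult[OF weight_cone])
    show "((\<lambda>r. cutoff (front_coord r x)) has_real_derivative cutoff' (front_coord t x) * (s * (c' t - s * \<delta>) / \<delta>)) (at t)"
      if "t \<in> {0<..<T}" for t x
      by (rule DERIV_cutoff[OF Dyt[OF that]])
    show "((\<lambda>x. cutoff (front_coord t x)) has_real_derivative cutoff' (front_coord t x) * (- s / \<delta>)) (at x)" for t x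
      by (rule DERIV_cutoff[OF Dyx])
    show "((\<lambda>x. cutoff' (front_coord t x) * (- s / \<delta>)) has_real_derivative cutoff'' (front_coord t x) * (- s / \<delta>) * (- s / \<delta>)) (at x)" for t x
      by (rule DERIV_cmult_right[OF DERIV_cutoff'[OF Dyx]])
    show "continuous_on ({0..T} \<times> UNIV) (\<lambda>(t, x). cutoff (front_coord t x))"
      "continuous_on ({0..T} \<times> UNIV) (\<lambda>(t, x). cutoff' (front_coord t x) * (s * (c' t - s * \<delta>) / \<delta>))"
      "continuous_on ({0..T} \<times> UNIV) (\<lambda>(t, x). cutoff' (front_coord t x) * (- s / \<delta>))"
      "continuous_on ({0..T} \<times> UNIV) (\<lambda>(t, x). cutoff'' (front_coord t x) * (- s / \<delta>) * (- s / \<delta>))"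
      unfolding split_beta using \<delta> by (intro continuous_intros cy c1; simp)+
  qed (use M in auto)
qed

lemma \<Psi>_nonneg: "0 \<le> \<Psi> t x" and \<Psi>_le_one: "\<Psi> t x \<le> 1"
  by (auto simp: \<Psi>_def intro!: mult_le_one)

end

section \<open>No mass crosses the front\<close>

lemma (in shock_front) abs_s: "\<bar>s * z\<bar> = \<bar>z\<bar>"
  using s by (auto simp: abs_mult)

lemma (in shock_front) far_cases: "s = 1 \<and> far_value = 0 \<or> s = -1 \<and> far_value = 1"
  unfolding far_value_def using s by auto

text \<open>
  In the layer of the front the weight produces \<open>flux v - \<lambda> ent v\<close> relative to its value at the far
  state, with \<open>\<lambda> = - c' t + s \<delta>\<close>. The margin \<open>\<delta>\<close> puts \<open>\<lambda>\<close> on the correct side of the shock speed for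
  \<open>\<theta>'\<close>, and \<open>flux_minus_ent_le\<close> gives the sign. In the layer of the cone the flux is dominated by the
  entropy because \<open>v\<close> lies in \<open>[0,1]\<close>.
\<close>

lemma (in shock_front) front_monotonicity:
  assumes t: "t \<in> {0..T}" and \<eta>: "exp \<eta> - 1 \<le> \<delta>"
    and \<theta>': "0 \<le> s * (\<theta>' - \<theta> t)" "s * (\<theta>' - \<theta> t) \<le> \<eta>" and v: "0 \<le> v" "v \<le> 1"
  shows "s * (flux \<theta>' v - flux \<theta>' far_value) * \<Psi>x t x - s * (ent \<theta>' v - ent \<theta>' far_value) * \<Psi>t t x \<le> 0"
proof -
  define h where "h = s * (ent \<theta>' v - ent \<theta>' far_value)"
  define H where "H = s * (flux \<theta>' v - flux \<theta>' far_value)"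
  define sp where "sp = - (c' t - s * \<delta>)"
  have H_le: "\<bar>H\<bar> \<le> h"
    using flux_le_ent_diff[of 0 v \<theta>'] flux_le_ent_diff[of v 1 \<theta>'] v far_cases
    by (auto simp: H_def h_def)
  have \<eta>': "exp (s * (\<theta>' - \<theta> t)) - 1 \<le> \<delta>" using \<theta>'(2) \<eta> exp_le_cancel_iff[of "s * (\<theta>' - \<theta> t)" \<eta>] by linarith
  have G: "(flux \<theta>' v - flux \<theta>' far_value) - sp * (ent \<theta>' v - ent \<theta>' far_value) \<le> 0"
  proof (cases "s = 1")
    case True
    have "speed \<theta>' \<le> sp"
      using speed_add_le[of "\<theta>' - \<theta> t" "\<theta> t"] \<theta>' \<eta>' True speed[OF t] by (simp add: sp_def)
    then have "flux \<theta>' 1 - sp * ent \<theta>' 1 \<le> 0"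
      using ent_1_pos[of \<theta>'] by (simp add: speed_def[of \<theta>'] field_simps)
    moreover have "far_value = 0" unfolding far_value_def using True by simp
    ultimately show ?thesis using flux_minus_ent_le[OF v, of \<theta>' sp] by simp
  next
    case False
    then have s: "s = -1" using s by simp
    have "sp \<le> speed \<theta>'"
      using speed_add_le[of "\<theta> t - \<theta>'" \<theta>'] \<theta>' \<eta>' s speed[OF t] by (simp add: sp_def)
    then have "0 \<le> flux \<theta>' 1 - sp * ent \<theta>' 1"
      using ent_1_pos[of \<theta>'] by (simp add: speed_def[of \<theta>'] field_simps)
    moreover have "far_value = 1" unfolding far_value_def using False by simp
    ultimately show ?thesis using flux_minus_ent_le[OF v, of \<theta>' sp] by (simp add: algebra_simps)
  qed
  let ?P = "cone_weight R 1 M t x" and ?Px = "cone_x R 1 M t x" and ?Pt = "cone_t R 1 M t x"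
  have "\<bar>?Px\<bar> \<le> M * \<bar>?Px\<bar>" using M by (simp add: mult_le_cancel_right1)
  also have "\<dots> \<le> ?Pt" by (rule cone_transport) (use M in auto)
  finally have P: "\<bar>?Px\<bar> \<le> ?Pt" .
  have "H * ?Px \<le> \<bar>H\<bar> * \<bar>?Px\<bar>" by (metis abs_ge_self abs_mult)
  also have "\<dots> \<le> h * ?Pt" using H_le P by (intro mult_mono) auto
  finally have 1: "(H * ?Px - h * ?Pt) * cutoff (front_coord t x) \<le> 0"
    by (intro mult_nonpos_nonneg) auto
  \<comment> \<open>The signs \<open>s\<close> of the layer and of the entropy cancel.\<close>
  have HG: "- s * H + s * sp * h = - ((flux \<theta>' v - flux \<theta>' far_value) - sp * (ent \<theta>' v - ent \<theta>' far_value))"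
    using s by (auto simp: H_def h_def algebra_simps)
  have 2: "?P * (cutoff' (front_coord t x) / \<delta>) * (- s * H + s * sp * h) \<le> 0"
    unfolding HG using G \<delta> by (intro mult_nonpos_nonneg mult_nonneg_nonpos divide_nonpos_pos) auto
  have "H * \<Psi>x t x - h * \<Psi>t t x = (H * ?Px - h * ?Pt) * cutoff (front_coord t x) + ?P * (cutoff' (front_coord t x) / \<delta>) * (- s * H + s * sp * h)"
    unfolding \<Psi>x_def \<Psi>t_def sp_def using \<delta> by (simp add: field_simps)
  with 1 2 show ?thesis by (simp add: H_def h_def)
qed

text \<open>
  One time interval with a frozen exponent \<open>\<theta>'\<close>. Values outside \<open>[0,1]\<close> are projected onto it; the
  entropy, its flux and hence the error are Lipschitz, so this costs a multiple of the defect. The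
  same projection converts between the entropy, which may be negative, and \<open>\<bar>u - far_value\<bar>\<close>. The
  constant depends neither on \<open>\<epsilon>\<close> nor on the solution.
\<close>

lemma (in shock_front) front_step:
  assumes ab: "0 \<le> a" "a \<le> b" "b \<le> T" and \<eta>: "exp \<eta> - 1 \<le> \<delta>"
    and \<theta>': "\<And>t. t \<in> {a..b} \<Longrightarrow> 0 \<le> s * (\<theta>' - \<theta> t) \<and> s * (\<theta>' - \<theta> t) \<le> \<eta>"
  obtains C where "0 < C" and
    "\<And>\<epsilon> u ux uxx D \<tau> t. regular_solution T \<epsilon> \<theta> u ux uxx \<Longrightarrow> 0 < \<epsilon> \<Longrightarrow>
      (\<And>t x. t \<in> {0..T} \<Longrightarrow> \<bar>u t x\<bar> \<le> M) \<Longrightarrow>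
      (\<And>t. t \<in> {0..T} \<Longrightarrow> integral {-X..X} (\<lambda>x. defect (u t x)) \<le> D) \<Longrightarrow>
      integral {-X..X} (\<lambda>x. \<bar>u b x - far_value\<bar> * \<Psi> b x) \<le> \<tau> \<Longrightarrow> t \<in> {a..b} \<Longrightarrow>
      integral {-X..X} (\<lambda>x. \<bar>u t x - far_value\<bar> * \<Psi> t x) \<le> C * (\<tau> + D + \<epsilon>)"
proof -
  define L where "L = exp (\<bar>\<theta>'\<bar> * M)"
  define L1 where "L1 = exp \<bar>\<theta>'\<bar>"
  obtain C1 where C1: "0 \<le> C1"
    "\<And>t x. t \<in> {0..T} \<Longrightarrow> x \<in> {-X..X} \<Longrightarrow> \<bar>\<Psi>t t x\<bar> \<le> C1 \<and> \<bar>\<Psi>x t x\<bar> \<le> C1 \<and> \<bar>\<Psi>xx t x\<bar> \<le> C1"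
    using weight_bounded[OF weight_front] by blast
  define A where "A = L * (M + 1) * C1"
  define A' where "A' = L * (2 * M) * C1 * (2 * X)"
  define C where "C = L1 * L + (L1 * T * A + 1 + L1 * L) + L1 * T * A'"
  have L: "0 < L" "0 < L1" by (auto simp: L_def L1_def)
  have A: "0 \<le> A" "0 \<le> A'" using L M C1 X_nonneg by (auto simp: A_def A'_def)
  have C_parts: "0 \<le> L1 * L" "0 \<le> L1 * T * A + 1 + L1 * L" "0 \<le> L1 * T * A'"
    using L A T by (auto intro!: add_nonneg_nonneg)
  have C: "0 < C" using L A T by (auto simp: C_def intro!: add_pos_nonneg)
  define h where "h = (\<lambda>v. s * (ent \<theta>' v - ent \<theta>' far_value))"
  define h' where "h' = (\<lambda>v. s * exp (\<theta>' * v))"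
  define h'' where "h'' = (\<lambda>v. s * (exp (\<theta>' * v) * \<theta>'))"
  define H where "H = (\<lambda>v. s * (flux \<theta>' v - flux \<theta>' far_value))"
  have Dh: "(h has_real_derivative h' v) (at v)" "(h' has_real_derivative h'' v) (at v)"
    "(H has_real_derivative v * h' v) (at v)" for v
    unfolding h_def h'_def h''_def H_def
    by (auto intro!: derivative_eq_intros DERIV_ent_at DERIV_flux_at)
  have c_h: "continuous_on S h" and c_H: "continuous_on S H" for S
    by (rule DERIV_continuous_on[OF has_field_derivative_at_within[OF Dh(1)]]
        DERIV_continuous_on[OF has_field_derivative_at_within[OF Dh(3)]])+
  have far_value: "far_value = 0 \<or> far_value = 1" by (simp add: far_value_def)
  have far_le: "\<bar>far_value\<bar> \<le> M" using far_value M by auto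
  have h_Lip: "\<bar>h v - h w\<bar> \<le> L * \<bar>v - w\<bar>" and H_Lip: "\<bar>H v - H w\<bar> \<le> M * L * \<bar>v - w\<bar>"
    if "\<bar>v\<bar> \<le> M" "\<bar>w\<bar> \<le> M" for v w
  proof -
    have "h v - h w = s * (ent \<theta>' v - ent \<theta>' w)" "H v - H w = s * (flux \<theta>' v - flux \<theta>' w)"
      by (auto simp: h_def H_def algebra_simps)
    then show "\<bar>h v - h w\<bar> \<le> L * \<bar>v - w\<bar>" "\<bar>H v - H w\<bar> \<le> M * L * \<bar>v - w\<bar>"
      using ent_flux_Lipschitz[OF that, of \<theta>'] by (simp_all add: abs_s L_def)
  qed
  have h_far: "h far_value = 0" by (simp add: h_def)
  have h_le: "\<bar>h v\<bar> \<le> L * \<bar>v - far_value\<bar>" if "\<bar>v\<bar> \<le> M" for v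
    using h_Lip[OF that far_le] by (simp add: h_far)
  \<comment> \<open>The projection onto the unit interval.\<close>
  define cl where "cl = (\<lambda>v::real. max 0 (min 1 v))"
  have cl: "0 \<le> cl v" "cl v \<le> 1" "\<bar>v - cl v\<bar> = defect v" for v
    by (auto simp: cl_def defect_def max_def min_def)
  have cl_le: "\<bar>cl v\<bar> \<le> M" for v using cl(1)[of v] cl(2)[of v] M by linarith
  have defect_nonneg: "0 \<le> defect v" for v by (simp add: defect_def)
  have far_le_h: "\<bar>v - far_value\<bar> \<le> L1 * h v + (1 + L1 * L) * defect v" if v: "\<bar>v\<bar> \<le> M" for v
  proof -
    have "exp (- \<bar>\<theta>'\<bar>) * \<bar>cl v - far_value\<bar> \<le> h (cl v)"
      using far_cases cl(1,2)[of v] flux_le_ent_diff(3)[of 0 "cl v" \<theta>'] flux_le_ent_diff(3)[of "cl v" 1 \<theta>']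
      by (auto simp: h_def)
    then have "L1 * (exp (- \<bar>\<theta>'\<bar>) * \<bar>cl v - far_value\<bar>) \<le> L1 * h (cl v)"
      using L by (intro mult_left_mono) auto
    then have "\<bar>cl v - far_value\<bar> \<le> L1 * h (cl v)"
      by (simp add: L1_def mult.assoc[symmetric] exp_add[symmetric])
    also have "\<dots> \<le> L1 * (h v + L * defect v)"
      using h_Lip[OF v cl_le, of v] cl(3)[of v] L by (intro mult_left_mono) auto
    finally show ?thesis using cl(3)[of v] by (simp add: algebra_simps)
  qed
  have J_le: "H v * \<Psi>x t x - h v * \<Psi>t t x \<le> A * defect v"
    if v: "\<bar>v\<bar> \<le> M" and t: "t \<in> {a..b}" and x: "x \<in> {-X..X}" for v t x
  proof -
    have t': "t \<in> {0..T}" using t ab by auto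
    have "H (cl v) * \<Psi>x t x - h (cl v) * \<Psi>t t x \<le> 0"
      unfolding H_def h_def using \<theta>'[OF t] by (intro front_monotonicity[OF t' \<eta>] cl) auto
    moreover have "\<bar>(H v - H (cl v)) * \<Psi>x t x\<bar> \<le> M * L * defect v * C1"
      unfolding abs_mult using H_Lip[OF v cl_le, of v] cl(3)[of v] C1(2)[OF t' x] M L defect_nonneg
      by (intro mult_mono) auto
    moreover have "\<bar>(h v - h (cl v)) * \<Psi>t t x\<bar> \<le> L * defect v * C1"
      unfolding abs_mult using h_Lip[OF v cl_le, of v] cl(3)[of v] C1(2)[OF t' x] L defect_nonneg
      by (intro mult_mono) auto
    ultimately have "H v * \<Psi>x t x - h v * \<Psi>t t x \<le> M * L * defect v * C1 + L * defect v * C1"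
      unfolding left_diff_distrib by linarith
    then show ?thesis by (simp add: A_def algebra_simps)
  qed
  show ?thesis
  proof (rule that[OF C])
    fix \<epsilon> D \<tau> t :: real and u ux uxx
    assume reg: "regular_solution T \<epsilon> \<theta> u ux uxx" and \<epsilon>: "0 < \<epsilon>"
      and u_le: "\<And>t x. t \<in> {0..T} \<Longrightarrow> \<bar>u t x\<bar> \<le> M"
      and D: "\<And>t. t \<in> {0..T} \<Longrightarrow> integral {-X..X} (\<lambda>x. defect (u t x)) \<le> D"
      and \<tau>: "integral {-X..X} (\<lambda>x. \<bar>u b x - far_value\<bar> * \<Psi> b x) \<le> \<tau>" and t: "t \<in> {a..b}"
    have in_T: "r \<in> {0..T}" if "r \<in> {a..b}" for r using that ab by auto
    have bT: "b \<in> {0..T}" using ab by auto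
    have tT: "t \<in> {0..T}" using in_T[OF t] .
    note cu = regular_solution_continuous[OF reg]
    note cw = weight_continuous[OF weight_front]
    have chu: "continuous_on S (\<lambda>x. h (u r x))" "continuous_on S (\<lambda>x. H (u r x))"
      "continuous_on S (\<lambda>x. defect (u r x))" if "r \<in> {0..T}" for S r
      unfolding defect_def
      by (rule continuous_on_compose2[OF c_h[of UNIV] cu[OF that] subset_UNIV]
          continuous_on_compose2[OF c_H[of UNIV] cu[OF that] subset_UNIV]
        | intro continuous_intros cu[OF that])+
    have "0 \<le> integral {-X..X} (\<lambda>x. defect (u t x))"
      by (intro integral_nonneg integrable_continuous_real chu(3)[OF tT] defect_nonneg)
    then have D0: "0 \<le> D" using D[OF tT] by linarith
    have \<tau>0: "0 \<le> \<tau>"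
    proof -
      have "0 \<le> integral {-X..X} (\<lambda>x. \<bar>u b x - far_value\<bar> * \<Psi> b x)"
        using \<Psi>_nonneg
        by (intro integral_nonneg integrable_continuous_real continuous_intros cu[OF bT] cw[OF bT]) auto
      then show ?thesis using \<tau> by linarith
    qed
    have E: "integral {-X..X} (\<lambda>x. h (u t x) * \<Psi> t x)
      \<le> integral {-X..X} (\<lambda>x. h (u b x) * \<Psi> b x) + (A * D + A' * \<epsilon>) * (b - t)"
    proof (rule entropy_inequality[OF reg _ \<theta>_cont weight_front X_nonneg Dh])
      fix r assume r: "t < r" "r < b"
      then have rab: "r \<in> {a..b}" using t by auto
      note rT = in_T[OF rab]
      show "\<theta> r * h' (u r x) \<le> h'' (u r x)" for x
        using mult_right_mono[OF conjunct1[OF \<theta>'[OF rab]], of "exp (\<theta>' * u r x)"]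
        by (simp add: h'_def h''_def algebra_simps)
      let ?J = "\<lambda>x. H (u r x) * \<Psi>x r x + \<epsilon> * h (u r x) * \<Psi>xx r x - h (u r x) * \<Psi>t r x"
      have "?J x \<le> A * defect (u r x) + \<epsilon> * (L * (2 * M) * C1)" if x: "x \<in> {-X..X}" for x
      proof -
        have "\<bar>h (u r x)\<bar> \<le> L * \<bar>u r x - far_value\<bar>" by (rule h_le[OF u_le[OF rT]])
        also have "\<dots> \<le> L * (2 * M)" using u_le[OF rT, of x] far_le L by (intro mult_left_mono) auto
        finally have "\<bar>h (u r x) * \<Psi>xx r x\<bar> \<le> L * (2 * M) * C1"
          unfolding abs_mult using C1(2)[OF rT x] L M by (intro mult_mono) auto
        then have "\<epsilon> * (h (u r x) * \<Psi>xx r x) \<le> \<epsilon> * (L * (2 * M) * C1)"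
          using \<epsilon> by (intro mult_left_mono) auto
        then show ?thesis using J_le[OF u_le[OF rT] rab x, of x] by (simp add: mult.assoc)
      qed
      then have "integral {-X..X} ?J \<le> integral {-X..X} (\<lambda>x. A * defect (u r x) + \<epsilon> * (L * (2 * M) * C1))"
        by (intro integral_le integrable_continuous_real continuous_intros chu[OF rT] cw[OF rT])
      also have "\<dots> = A * integral {-X..X} (\<lambda>x. defect (u r x)) + A' * \<epsilon>"
        using X_nonneg
        by (subst integral_add) (auto intro!: integrable_continuous_real continuous_intros chu[OF rT] simp: A'_def)
      also have "\<dots> \<le> A * D + A' * \<epsilon>" using D[OF rT] A by (intro add_mono mult_left_mono) auto
      finally show "integral {-X..X} ?J \<le> A * D + A' * \<epsilon>" .
    qed (use \<epsilon> t ab in auto)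
    have "integral {-X..X} (\<lambda>x. h (u b x) * \<Psi> b x) \<le> integral {-X..X} (\<lambda>x. L * (\<bar>u b x - far_value\<bar> * \<Psi> b x))"
    proof (rule integral_le)
      fix x
      have "h (u b x) * \<Psi> b x \<le> L * \<bar>u b x - far_value\<bar> * \<Psi> b x"
        using h_le[OF u_le[OF bT], of x] \<Psi>_nonneg by (intro mult_right_mono) auto
      then show "h (u b x) * \<Psi> b x \<le> L * (\<bar>u b x - far_value\<bar> * \<Psi> b x)" by simp
    qed (intro integrable_continuous_real continuous_intros chu[OF bT] cw[OF bT] cu[OF bT])+
    also have "\<dots> \<le> L * \<tau>" using \<tau> L by simp
    finally have Eb: "integral {-X..X} (\<lambda>x. h (u b x) * \<Psi> b x) \<le> L * \<tau>" .
    have "(A * D + A' * \<epsilon>) * (b - t) \<le> (A * D + A' * \<epsilon>) * T"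
      using A D0 \<epsilon> ab t by (intro mult_left_mono add_nonneg_nonneg mult_nonneg_nonneg) auto
    with E Eb have Et: "integral {-X..X} (\<lambda>x. h (u t x) * \<Psi> t x) \<le> L * \<tau> + (A * D + A' * \<epsilon>) * T" by linarith
    have "integral {-X..X} (\<lambda>x. \<bar>u t x - far_value\<bar> * \<Psi> t x)
      \<le> integral {-X..X} (\<lambda>x. L1 * (h (u t x) * \<Psi> t x) + (1 + L1 * L) * defect (u t x))"
    proof (rule integral_le)
      fix x
      have "\<bar>u t x - far_value\<bar> * \<Psi> t x \<le> (L1 * h (u t x) + (1 + L1 * L) * defect (u t x)) * \<Psi> t x"
        by (intro mult_right_mono far_le_h u_le tT \<Psi>_nonneg)
      also have "\<dots> = L1 * (h (u t x) * \<Psi> t x) + (1 + L1 * L) * defect (u t x) * \<Psi> t x"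
        by (simp add: algebra_simps)
      also have "\<dots> \<le> L1 * (h (u t x) * \<Psi> t x) + (1 + L1 * L) * defect (u t x) * 1"
        using C_parts \<Psi>_le_one defect_nonneg by (intro add_left_mono mult_left_mono mult_nonneg_nonneg) auto
      finally show "\<bar>u t x - far_value\<bar> * \<Psi> t x \<le> L1 * (h (u t x) * \<Psi> t x) + (1 + L1 * L) * defect (u t x)" by simp
    qed (intro integrable_continuous_real continuous_intros chu[OF tT] cw[OF tT] cu[OF tT])+
    also have "\<dots> = L1 * integral {-X..X} (\<lambda>x. h (u t x) * \<Psi> t x) + (1 + L1 * L) * integral {-X..X} (\<lambda>x. defect (u t x))"
      by (subst integral_add) (auto intro!: integrable_continuous_real continuous_intros chu[OF tT] cw[OF tT])
    also have "\<dots> \<le> L1 * (L * \<tau> + (A * D + A' * \<epsilon>) * T) + (1 + L1 * L) * D"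
      using L C_parts by (intro add_mono mult_left_mono Et D tT) auto
    also have "\<dots> = L1 * L * \<tau> + (L1 * T * A + 1 + L1 * L) * D + L1 * T * A' * \<epsilon>"
      by (simp add: algebra_simps)
    also have "\<dots> \<le> C * \<tau> + C * D + C * \<epsilon>"
      using C_parts \<tau>0 D0 \<epsilon> by (intro add_mono mult_right_mono) (auto simp: C_def)
    also have "\<dots> = C * (\<tau> + D + \<epsilon>)" by (simp add: algebra_simps)
    finally show "integral {-X..X} (\<lambda>x. \<bar>u t x - far_value\<bar> * \<Psi> t x) \<le> C * (\<tau> + D + \<epsilon>)" .
  qed
qed

section \<open>Convergence ahead of and behind the front\<close>

lemma (in shock_front) terminal_front:
  assumes F: "vanishing_viscosity_family T \<theta> M u" and \<tau>: "0 < \<tau>"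
  shows "\<forall>\<^sub>F \<epsilon> in at_right 0. integral {-X..X} (\<lambda>x. \<bar>u \<epsilon> T x - far_value\<bar> * \<Psi> T x) \<le> \<tau>"
proof -
  have good: "\<forall>\<^sub>F \<epsilon> in at_right 0. \<exists>ux uxx. regular_solution T \<epsilon> \<theta> (u \<epsilon>) ux uxx"
    using F by (auto simp: vanishing_viscosity_family_def elim: eventually_mono)
  have "((\<lambda>\<epsilon>. integral {-X..X} (\<lambda>x. \<bar>u \<epsilon> T x - indicator {..<0} x\<bar>)) \<longlongrightarrow> 0) (at_right 0)"
    using F by (auto simp: vanishing_viscosity_family_def)
  from order_tendstoD(2)[OF this \<tau>] good show ?thesis
  proof eventually_elim
    case (elim \<epsilon>)
    then obtain ux uxx where reg: "regular_solution T \<epsilon> \<theta> (u \<epsilon>) ux uxx" by blast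
    have T': "T \<in> {0..T}" using T by simp
    note cu = regular_solution_continuous[OF reg T']
    have "integral {-X..X} (\<lambda>x. \<bar>u \<epsilon> T x - far_value\<bar> * \<Psi> T x)
      \<le> integral {-X..X} (\<lambda>x. \<bar>u \<epsilon> T x - indicator {..<0} x\<bar>)"
    proof (rule integral_le)
      show "(\<lambda>x. \<bar>u \<epsilon> T x - far_value\<bar> * \<Psi> T x) integrable_on {-X..X}"
        by (intro integrable_continuous_real continuous_intros cu weight_continuous[OF weight_front T'])
      show "(\<lambda>x. \<bar>u \<epsilon> T x - indicat_real {..<0} x\<bar>) integrable_on {-X..X}"
        by (rule terminal_integrable[OF cu])
      fix x
      show "\<bar>u \<epsilon> T x - far_value\<bar> * \<Psi> T x \<le> \<bar>u \<epsilon> T x - indicator {..<0} x\<bar>"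
      proof (cases "0 < s * x")
        case True
        then have "indicator {..<0} x = far_value" using far_cases by (auto simp: indicator_def)
        moreover have "\<bar>u \<epsilon> T x - far_value\<bar> * \<Psi> T x \<le> \<bar>u \<epsilon> T x - far_value\<bar> * 1"
          using \<Psi>_le_one by (intro mult_left_mono) auto
        ultimately show ?thesis by simp
      next
        case False
        have "s * (c T + s * (\<delta> * (T - T) + \<delta>) - x) = \<delta> - s * x" using s cT by auto
        then have "1 \<le> front_coord T x" using False \<delta> by (simp add: front_coord_def le_divide_eq)
        then show ?thesis by (simp add: \<Psi>_def)
      qed
    qed
    with elim show ?case by linarith
  qed
qed

text \<open>
  Backward induction over intervals on which \<open>\<theta>\<close> oscillates by less than \<open>\<eta> / 2\<close>, with \<open>\<eta>\<close> such that
  freezing the exponent changes the shock speed by at most \<open>\<delta>\<close>.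
\<close>

lemma (in shock_front) front_vanishes:
  assumes F: "vanishing_viscosity_family T \<theta> M u" and \<tau>: "0 < \<tau>"
  shows "\<forall>\<^sub>F \<epsilon> in at_right 0. \<forall>t\<in>{0..T}. integral {-X..X} (\<lambda>x. \<bar>u \<epsilon> t x - far_value\<bar> * \<Psi> t x) \<le> \<tau>"
proof -
  define S where "S = (\<lambda>a. \<forall>\<tau>>0. \<forall>\<^sub>F \<epsilon> in at_right 0. \<forall>t\<in>{a..T}.
    integral {-X..X} (\<lambda>x. \<bar>u \<epsilon> t x - far_value\<bar> * \<Psi> t x) \<le> \<tau>)"
  have good: "\<forall>\<^sub>F \<epsilon> in at_right 0. 0 < \<epsilon> \<and> (\<exists>ux uxx. regular_solution T \<epsilon> \<theta> (u \<epsilon>) ux uxx) \<and>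
        (\<forall>t\<in>{0..T}. \<forall>x. \<bar>u \<epsilon> t x\<bar> \<le> M)"
    using F by (auto simp: vanishing_viscosity_family_def)
  have start: "S T" using terminal_front[OF F] by (simp add: S_def)
  \<comment> \<open>By \<open>speed_add_le\<close>, a change of the exponent by \<open>\<eta>\<close> changes the speed by at most \<open>exp \<eta> - 1 = \<delta>\<close>.\<close>
  define \<eta> where "\<eta> = ln (1 + \<delta>)"
  have \<eta>: "0 < \<eta>" "exp \<eta> - 1 \<le> \<delta>" using \<delta> by (auto simp: \<eta>_def)
  have "uniformly_continuous_on {0..T} \<theta>"
    by (rule compact_uniformly_continuous[OF \<theta>_cont compact_Icc])
  then obtain r0 where r0: "0 < r0"
    "\<And>t t'. t \<in> {0..T} \<Longrightarrow> t' \<in> {0..T} \<Longrightarrow> dist t' t < r0 \<Longrightarrow> dist (\<theta> t') (\<theta> t) < \<eta> / 2"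
    unfolding uniformly_continuous_on_def using \<eta>(1) half_gt_zero by metis
  define r where "r = r0 / 2"
  have r: "0 < r" "r < r0" using r0 by (auto simp: r_def)
  have step: "S a" if ab: "0 \<le> a" "a \<le> b" "b \<le> T" "b - a \<le> r" and Sb: "S b" for a b
  proof -
    \<comment> \<open>The frozen exponent lies above all values of \<open>\<theta>\<close> on the interval if \<open>s = 1\<close>, below them if \<open>s = -1\<close>.\<close>
    define \<theta>' where "\<theta>' = \<theta> a + s * (\<eta> / 2)"
    have \<theta>': "0 \<le> s * (\<theta>' - \<theta> t) \<and> s * (\<theta>' - \<theta> t) \<le> \<eta>" if t: "t \<in> {a..b}" for t
    proof -
      have "\<bar>s * (\<theta> a - \<theta> t)\<bar> < \<eta> / 2"
        unfolding abs_s using r0(2)[of t a] t ab r by (simp add: dist_real_def)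
      moreover have "s * (\<theta>' - \<theta> t) = s * (\<theta> a - \<theta> t) + \<eta> / 2"
        using s by (auto simp: \<theta>'_def)
      ultimately show ?thesis by linarith
    qed
    obtain C where C: "0 < C" and
      step: "\<And>\<epsilon> u ux uxx D \<tau> t. regular_solution T \<epsilon> \<theta> u ux uxx \<Longrightarrow> 0 < \<epsilon> \<Longrightarrow>
        (\<And>t x. t \<in> {0..T} \<Longrightarrow> \<bar>u t x\<bar> \<le> M) \<Longrightarrow>
        (\<And>t. t \<in> {0..T} \<Longrightarrow> integral {-X..X} (\<lambda>x. defect (u t x)) \<le> D) \<Longrightarrow>
        integral {-X..X} (\<lambda>x. \<bar>u b x - far_value\<bar> * \<Psi> b x) \<le> \<tau> \<Longrightarrow> t \<in> {a..b} \<Longrightarrow>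
        integral {-X..X} (\<lambda>x. \<bar>u t x - far_value\<bar> * \<Psi> t x) \<le> C * (\<tau> + D + \<epsilon>)"
      using front_step[OF ab(1-3) \<eta>(2) \<theta>'] by blast
    show "S a"
      unfolding S_def
    proof (intro allI impI)
      fix \<tau> :: real assume \<tau>: "0 < \<tau>"
      \<comment> \<open>The three contributions in \<open>front_step\<close>, from the data at \<open>b\<close>, the defect and the viscosity, share \<open>\<tau>\<close> equally.\<close>
      define \<tau>' where "\<tau>' = \<tau> / (3 * C)"
      have \<tau>': "0 < \<tau>'" "C * (\<tau>' + \<tau>' + \<tau>') = \<tau>" using \<tau> C by (auto simp: \<tau>'_def)
      have Sb': "\<forall>\<^sub>F \<epsilon> in at_right 0. \<forall>t\<in>{b..T}. integral {-X..X} (\<lambda>x. \<bar>u \<epsilon> t x - far_value\<bar> * \<Psi> t x) \<le> min \<tau> \<tau>'"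
        using Sb[unfolded S_def, rule_format, of "min \<tau> \<tau>'"] \<tau> \<tau>' by linarith
      have small: "\<forall>\<^sub>F \<epsilon> in at_right (0::real). \<epsilon> < \<tau>'"
        using \<tau>' by (auto simp: eventually_at_right_field)
      show "\<forall>\<^sub>F \<epsilon> in at_right 0. \<forall>t\<in>{a..T}. integral {-X..X} (\<lambda>x. \<bar>u \<epsilon> t x - far_value\<bar> * \<Psi> t x) \<le> \<tau>"
        using good Sb' small defect_vanishes[OF F X_nonneg \<tau>'(1)]
      proof eventually_elim
        case (elim \<epsilon>)
        then obtain ux uxx where reg: "regular_solution T \<epsilon> \<theta> (u \<epsilon>) ux uxx" by blast
        show ?case
        proof
          fix t assume t: "t \<in> {a..T}"
          show "integral {-X..X} (\<lambda>x. \<bar>u \<epsilon> t x - far_value\<bar> * \<Psi> t x) \<le> \<tau>"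
          proof (cases "b \<le> t")
            case True
            then have "integral {-X..X} (\<lambda>x. \<bar>u \<epsilon> t x - far_value\<bar> * \<Psi> t x) \<le> min \<tau> \<tau>'" using elim(2) t by auto
            then show ?thesis by simp
          next
            case False
            have "integral {-X..X} (\<lambda>x. \<bar>u \<epsilon> b x - far_value\<bar> * \<Psi> b x) \<le> min \<tau> \<tau>'" using elim(2) ab by auto
            then have b: "integral {-X..X} (\<lambda>x. \<bar>u \<epsilon> b x - far_value\<bar> * \<Psi> b x) \<le> \<tau>'" by simp
            have "integral {-X..X} (\<lambda>x. \<bar>u \<epsilon> t x - far_value\<bar> * \<Psi> t x) \<le> C * (\<tau>' + \<tau>' + \<epsilon>)"
              by (rule step[OF reg _ _ _ b]) (use elim t False in auto)
            also have "\<dots> \<le> C * (\<tau>' + \<tau>' + \<tau>')" using C elim(3) by (intro mult_left_mono) auto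
            finally show ?thesis using \<tau>'(2) by simp
          qed
        qed
      qed
    qed
  qed
  have "S (max 0 (T - real k * r))" for k
  proof (induction k)
    case 0
    then show ?case using start T by simp
  next
    case (Suc k)
    show ?case
      by (rule step[OF _ _ _ _ Suc]) (use T r in \<open>auto simp: algebra_simps max_def\<close>)
  qed
  moreover obtain k :: nat where "T / r \<le> real k" using real_arch_simple by blast
  then have "max 0 (T - real k * r) = 0" using r by (simp add: divide_le_eq)
  ultimately have "S 0" by metis
  then show ?thesis using \<tau> by (simp add: S_def)
qed

section \<open>Convergence to the shock in the mean\<close>

lemma integral_indicator_Icc_le:
  fixes a b p q :: real
  assumes "p \<le> q"
  shows "indicat_real {p..q} integrable_on {a..b}" "integral {a..b} (indicator {p..q} :: real \<Rightarrow> real) \<le> q - p"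
proof -
  have eq: "{p..q} \<inter> {a..b} = {max a p..min b q}" by auto
  show "indicat_real {p..q} integrable_on {a..b}"
    by (simp add: integrable_on_indicator eq)
  have "integral {a..b} (indicator {p..q} :: real \<Rightarrow> real) = measure lebesgue ({p..q} \<inter> {a..b})"
    by (rule integral_indicator) (simp add: eq)
  also have "\<dots> \<le> q - p" unfolding eq using assms by (cases "max a p \<le> min b q") auto
  finally show "integral {a..b} (indicator {p..q} :: real \<Rightarrow> real) \<le> q - p" .
qed

lemma bounded_set_integrable:
  fixes f :: "real \<Rightarrow> real"
  assumes "f \<in> borel_measurable borel" "\<And>x. \<bar>f x\<bar> \<le> B" "compact K"
  shows "set_integrable lborel K f"
  unfolding set_integrable_def
proof (rule Bochner_Integration.integrable_bound[where f = "\<lambda>x. B * indicator K x"])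
  show "integrable lborel (\<lambda>x. B * indicator K x)"
    using emeasure_compact_finite[OF assms(3)] assms(3)
    by (intro integrable_mult_right integrable_real_indicator) (auto simp: borel_compact less_top)
  show "(\<lambda>x. indicator K x *\<^sub>R f x) \<in> borel_measurable lborel"
    using assms borel_compact[OF assms(3)] by simp
  show "AE x in lborel. norm (indicator K x *\<^sub>R f x) \<le> norm (B * indicator K x)"
    using assms(2) by (intro always_eventually) (auto simp: indicator_def intro: order_trans[OF assms(2)])
qed

text \<open>
  Both fronts at once: outside the strip between them one of the two weights is 1 and \<open>u\<close> is close to
  the far value there, and the strip has width at most \<open>2 \<delta> (T + 1)\<close>.
\<close>

lemma L1_convergence_to_shock:
  assumes F: "vanishing_viscosity_family T \<theta> M u"
    and c: "continuous_on {0..T} c" "continuous_on {0..T} c'" "c T = 0"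
    and Dc: "\<And>t. t \<in> {0<..<T} \<Longrightarrow> (c has_real_derivative c' t) (at t)"
    and sp: "\<And>t. t \<in> {0..T} \<Longrightarrow> speed (\<theta> t) = - c' t"
    and R: "0 \<le> R" and \<tau>: "0 < \<tau>"
  shows "\<forall>\<^sub>F \<epsilon> in at_right 0. \<forall>t\<in>{0..T}. integral {-R..R} (\<lambda>x. \<bar>u \<epsilon> t x - (if x \<le> c t then 1 else 0)\<bar>) \<le> \<tau>"
proof -
  have T: "0 < T" and M: "1 \<le> M" and \<theta>: "continuous_on {0..T} \<theta>"
    and good: "\<forall>\<^sub>F \<epsilon> in at_right 0. 0 < \<epsilon> \<and> (\<exists>ux uxx. regular_solution T \<epsilon> \<theta> (u \<epsilon>) ux uxx) \<and>
        (\<forall>t\<in>{0..T}. \<forall>x. \<bar>u \<epsilon> t x\<bar> \<le> M)"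
    using F by (auto simp: vanishing_viscosity_family_def)
  \<comment> \<open>With this \<open>\<delta>\<close> the strip between the fronts contributes half of \<open>\<tau>\<close>.\<close>
  define k where "k = (T + 1) * (M + 1)"
  have k: "0 < k" using T M by (simp add: k_def)
  define \<delta> where "\<delta> = \<tau> / (4 * k)"
  have "(M + 1) * (2 * \<delta> * (T + 1)) = 2 * \<delta> * k" by (simp add: k_def)
  then have \<delta>: "0 < \<delta>" "(M + 1) * (2 * \<delta> * (T + 1)) = \<tau> / 2"
    using \<tau> k by (auto simp: \<delta>_def)
  interpret r: shock_front T M R \<delta> 1 c c' \<theta>
    by unfold_locales (use T M R \<delta> c Dc sp \<theta> in auto)
  interpret l: shock_front T M R \<delta> "-1" c c' \<theta>
    by unfold_locales (use T M R \<delta> c Dc sp \<theta> in auto)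
  have \<tau>4: "0 < \<tau> / 4" using \<tau> by simp
  have fars: "r.far_value = 0" "l.far_value = 1" by (auto simp: r.far_value_def l.far_value_def)
  show ?thesis
    using good r.front_vanishes[OF F \<tau>4] l.front_vanishes[OF F \<tau>4]
  proof eventually_elim
    case (elim \<epsilon>)
    then obtain ux uxx where reg: "regular_solution T \<epsilon> \<theta> (u \<epsilon>) ux uxx" by blast
    show ?case
    proof
      fix t assume t: "t \<in> {0..T}"
      define w where "w = \<delta> * (T - t) + \<delta>"
      have "\<delta> * (T - t) \<le> \<delta> * T" using \<delta>(1) t by (intro mult_left_mono) auto
      moreover have "0 \<le> \<delta> * (T - t)" using \<delta>(1) t by (intro mult_nonneg_nonneg) auto
      ultimately have w: "0 \<le> w" "w \<le> \<delta> * (T + 1)"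
        using \<delta>(1) by (simp_all add: w_def distrib_left)
      note cu = regular_solution_continuous[OF reg t]
      note cr = weight_continuous[OF r.weight_front t] and cl = weight_continuous[OF l.weight_front t]
      let ?d = "\<lambda>x. \<bar>u \<epsilon> t x - (if x \<le> c t then 1 else 0)\<bar>"
      let ?I = "indicator {c t - w..c t + w} :: real \<Rightarrow> real"
      have I: "?I integrable_on {-R..R}" "integral {-R..R} ?I \<le> 2 * w"
        using integral_indicator_Icc_le[of "c t - w" "c t + w" "-R" R] w by auto
      have i: "(\<lambda>x. \<bar>u \<epsilon> t x - r.far_value\<bar> * r.\<Psi> t x) integrable_on {a..b}"
        "(\<lambda>x. \<bar>u \<epsilon> t x - l.far_value\<bar> * l.\<Psi> t x) integrable_on {a..b}" for a b
        by (intro integrable_continuous_real continuous_intros cu cr cl)+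
      have d_int: "?d integrable_on {-R..R}"
      proof (rule set_borel_integral_eq_integral(1)[OF bounded_set_integrable])
        show "?d \<in> borel_measurable borel"
          using borel_measurable_continuous_onI[OF cu] by measurable
        show "\<bar>?d x\<bar> \<le> M + 1" for x
          using elim(1) t by (auto simp: abs_le_iff intro: order_trans[of _ M] dest!: bspec[of _ _ t] spec[of _ x])
      qed simp
      have "integral {-R..R} ?d \<le> integral {-R..R} (\<lambda>x. (\<bar>u \<epsilon> t x - r.far_value\<bar> * r.\<Psi> t x
          + \<bar>u \<epsilon> t x - l.far_value\<bar> * l.\<Psi> t x) + (M + 1) * ?I x)"
      proof (rule integral_le[OF d_int])
        show "(\<lambda>x. (\<bar>u \<epsilon> t x - r.far_value\<bar> * r.\<Psi> t x + \<bar>u \<epsilon> t x - l.far_value\<bar> * l.\<Psi> t x) + (M + 1) * ?I x) integrable_on {-R..R}"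
          by (intro integrable_add i integrable_on_mult_right I)
        fix x assume x: "x \<in> {-R..R}"
        have one: "cone_weight R 1 M t x = 1" using x t M by (intro cone_eq_one) auto
        have nn: "0 \<le> \<bar>u \<epsilon> t x - r.far_value\<bar> * r.\<Psi> t x" "0 \<le> \<bar>u \<epsilon> t x - l.far_value\<bar> * l.\<Psi> t x" "0 \<le> (M + 1) * ?I x"
          using r.\<Psi>_nonneg l.\<Psi>_nonneg M by auto
        consider "c t + w < x" | "x < c t - w" | "x \<in> {c t - w..c t + w}" by fastforce
        then show "?d x \<le> (\<bar>u \<epsilon> t x - r.far_value\<bar> * r.\<Psi> t x + \<bar>u \<epsilon> t x - l.far_value\<bar> * l.\<Psi> t x) + (M + 1) * ?I x"
        proof cases
          case 1
          then have "r.front_coord t x \<le> 0" using \<delta> by (simp add: r.front_coord_def w_def divide_le_0_iff)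
          then have "r.\<Psi> t x = 1" by (simp add: r.\<Psi>_def one)
          then show ?thesis using 1 w nn by (simp add: fars)
        next
          case 2
          then have "l.front_coord t x \<le> 0" using \<delta> by (simp add: l.front_coord_def w_def divide_le_0_iff)
          then have "l.\<Psi> t x = 1" by (simp add: l.\<Psi>_def one)
          then show ?thesis using 2 w nn by (simp add: fars)
        next
          case 3
          have "\<bar>u \<epsilon> t x\<bar> \<le> M" using elim(1) t by blast
          then have "?d x \<le> M + 1" by auto
          then show ?thesis using 3 nn by simp
        qed
      qed
      also have "\<dots> = integral {-R..R} (\<lambda>x. \<bar>u \<epsilon> t x - r.far_value\<bar> * r.\<Psi> t x)
          + integral {-R..R} (\<lambda>x. \<bar>u \<epsilon> t x - l.far_value\<bar> * l.\<Psi> t x) + (M + 1) * integral {-R..R} ?I"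
        by (simp add: integral_add i I integrable_add integrable_on_mult_right)
      also have "\<dots> \<le> \<tau> / 4 + \<tau> / 4 + (M + 1) * (2 * w)"
      proof (intro add_mono mult_left_mono I)
        have "integral {-R..R} (\<lambda>x. \<bar>u \<epsilon> t x - r.far_value\<bar> * r.\<Psi> t x)
            \<le> integral {-r.X..r.X} (\<lambda>x. \<bar>u \<epsilon> t x - r.far_value\<bar> * r.\<Psi> t x)"
          using r.R_le_X r.\<Psi>_nonneg by (intro integral_subset_le i) auto
        then show "integral {-R..R} (\<lambda>x. \<bar>u \<epsilon> t x - r.far_value\<bar> * r.\<Psi> t x) \<le> \<tau> / 4" using elim(2) t by force
        have "integral {-R..R} (\<lambda>x. \<bar>u \<epsilon> t x - l.far_value\<bar> * l.\<Psi> t x)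
            \<le> integral {-l.X..l.X} (\<lambda>x. \<bar>u \<epsilon> t x - l.far_value\<bar> * l.\<Psi> t x)"
          using l.R_le_X l.\<Psi>_nonneg by (intro integral_subset_le i) auto
        then show "integral {-R..R} (\<lambda>x. \<bar>u \<epsilon> t x - l.far_value\<bar> * l.\<Psi> t x) \<le> \<tau> / 4" using elim(3) t by force
      qed (use M in auto)
      also have "\<dots> \<le> \<tau> / 4 + \<tau> / 4 + (M + 1) * (2 * \<delta> * (T + 1))"
        using w M by (intro add_left_mono mult_left_mono) auto
      also have "\<dots> = \<tau>" using \<delta>(2) by simp
      finally show "integral {-R..R} ?d \<le> \<tau>" .
    qed
  qed
qed

section \<open>Convergence in local Lebesgue spaces\<close>

lemma bounded_in_Lp_loc:
  assumes "f \<in> borel_measurable borel" "\<And>x. \<bar>f x\<bar> \<le> B" "0 \<le> p"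
  shows "f \<in> Lp_loc p"
proof -
  have "\<bar>\<bar>f x\<bar> powr p\<bar> \<le> B powr p" for x
    using assms(2)[of x] assms(3) by (simp add: powr_mono2)
  then show ?thesis
    unfolding Lp_loc_def using assms(1) by (auto intro!: bounded_set_integrable)
qed

text \<open>
  For uniformly bounded functions convergence in mean implies convergence in every \<open>L\<^sup>p\<close>, because
  \<open>\<bar>d\<bar>\<^sup>p \<le> (2 B)\<^sup>p\<^sup>-\<^sup>1 \<bar>d\<bar>\<close>.
\<close>

lemma Lp_dist_small:
  assumes p: "1 \<le> p" and B: "0 < B" and e: "0 < e" and K: "compact K" "K \<subseteq> {-R..R}"
  obtains \<tau> where "0 < \<tau>"
    "\<And>f g. f \<in> borel_measurable borel \<Longrightarrow> g \<in> borel_measurable borel \<Longrightarrow> (\<And>x. \<bar>f x\<bar> \<le> B) \<Longrightarrow>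
       (\<And>x. \<bar>g x\<bar> \<le> B) \<Longrightarrow> integral {-R..R} (\<lambda>x. \<bar>f x - g x\<bar>) \<le> \<tau> \<Longrightarrow> Lp_dist p K f g < e"
proof -
  define b where "b = (2 * B) powr (p - 1)"
  have b: "0 < b" using B by (simp add: b_def)
  define \<tau> where "\<tau> = (e / 2) powr p / b"
  show ?thesis
  proof (rule that)
    show "0 < \<tau>" using e b by (simp add: \<tau>_def)
    fix f g :: "real \<Rightarrow> real"
    assume f: "f \<in> borel_measurable borel" and g: "g \<in> borel_measurable borel"
      and fB: "\<And>x. \<bar>f x\<bar> \<le> B" and gB: "\<And>x. \<bar>g x\<bar> \<le> B"
      and le: "integral {-R..R} (\<lambda>x. \<bar>f x - g x\<bar>) \<le> \<tau>"
    have d: "\<bar>f x - g x\<bar> \<le> 2 * B" for x using fB[of x] gB[of x] by linarith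
    have d_powr: "\<bar>f x - g x\<bar> powr p \<le> b * \<bar>f x - g x\<bar>" for x
    proof (cases "f x = g x")
      case False
      then have "\<bar>f x - g x\<bar> powr p = \<bar>f x - g x\<bar> powr (p - 1) * \<bar>f x - g x\<bar>"
        by (simp add: powr_diff)
      also have "\<dots> \<le> b * \<bar>f x - g x\<bar>"
        unfolding b_def using d p by (intro mult_right_mono powr_mono2) auto
      finally show ?thesis .
    qed simp
    have meas: "(\<lambda>x. b * \<bar>f x - g x\<bar>) \<in> borel_measurable borel" using f g by measurable
    have "\<bar>b * \<bar>f x - g x\<bar>\<bar> \<le> b * (2 * B)" for x using d b by (simp add: abs_mult)
    from bounded_set_integrable[OF meas this]
    have int: "set_integrable lborel {-R..R} (\<lambda>x. b * \<bar>f x - g x\<bar>)" by simp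
    have "(LINT x:K|lborel. \<bar>f x - g x\<bar> powr p) \<le> (LINT x:{-R..R}|lborel. b * \<bar>f x - g x\<bar>)"
      unfolding set_lebesgue_integral_def
    proof (rule integral_mono')
      show "integrable lborel (\<lambda>x. indicator {-R..R} x *\<^sub>R (b * \<bar>f x - g x\<bar>))"
        using int by (simp add: set_integrable_def)
      fix x
      show "indicator K x *\<^sub>R \<bar>f x - g x\<bar> powr p \<le> indicator {-R..R} x *\<^sub>R (b * \<bar>f x - g x\<bar>)"
        using K(2) d_powr[of x] b by (auto simp: indicator_def)
      show "0 \<le> indicator {-R..R} x *\<^sub>R (b * \<bar>f x - g x\<bar>)" using b by simp
    qed
    also have "\<dots> = b * integral {-R..R} (\<lambda>x. \<bar>f x - g x\<bar>)"
      using set_borel_integral_eq_integral(2)[OF int] by simp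
    also have "\<dots> \<le> (e / 2) powr p" using le b by (simp add: \<tau>_def field_simps)
    finally have I: "(LINT x:K|lborel. \<bar>f x - g x\<bar> powr p) \<le> (e / 2) powr p" .
    have "0 \<le> (LINT x:K|lborel. \<bar>f x - g x\<bar> powr p)"
      unfolding set_lebesgue_integral_def by simp
    then have "Lp_dist p K f g \<le> ((e / 2) powr p) powr (1 / p)"
      unfolding Lp_dist_def using I p by (intro powr_mono2) auto
    also have "\<dots> = e / 2" using e p by (simp add: powr_powr)
    finally show "Lp_dist p K f g < e" using e by simp
  qed
qed

lemma compact_subset_symmetric_Icc:
  assumes "compact (K :: real set)"
  obtains R where "0 \<le> R" "K \<subseteq> {-R..R}"
proof -
  obtain B where B: "\<And>x. x \<in> K \<Longrightarrow> \<bar>x\<bar> \<le> B"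
    using compact_imp_bounded[OF assms] unfolding bounded_real by blast
  have "K \<subseteq> {- max 0 B..max 0 B}"
  proof
    fix x assume "x \<in> K"
    then have "\<bar>x\<bar> \<le> max 0 B" using B[of x] by linarith
    then show "x \<in> {- max 0 B..max 0 B}" by auto
  qed
  then show ?thesis using that[of "max 0 B"] by simp
qed

lemma tendsto_Lp_loc_from_L1:
  assumes p: "1 \<le> p" and B: "0 < B" and g: "g \<in> borel_measurable borel" "\<And>x. \<bar>g x\<bar> \<le> B"
    and f: "\<forall>\<^sub>F i in F. f i \<in> borel_measurable borel \<and> (\<forall>x. \<bar>f i x\<bar> \<le> B)"
    and lim: "\<And>R. 0 \<le> R \<Longrightarrow> ((\<lambda>i. integral {-R..R} (\<lambda>x. \<bar>f i x - g x\<bar>)) \<longlongrightarrow> 0) F"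
  shows "tendsto_Lp_loc p f g F"
  unfolding tendsto_Lp_loc_def
proof (intro conjI allI impI)
  show "g \<in> Lp_loc p" using g p by (intro bounded_in_Lp_loc) auto
  show "\<forall>\<^sub>F i in F. f i \<in> Lp_loc p"
    using f by eventually_elim (use p in \<open>auto intro: bounded_in_Lp_loc\<close>)
  fix K :: "real set" assume K: "compact K"
  obtain R where R: "0 \<le> R" "K \<subseteq> {-R..R}" using compact_subset_symmetric_Icc[OF K] .
  show "((\<lambda>i. Lp_dist p K (f i) g) \<longlongrightarrow> 0) F"
  proof (rule tendstoI)
    fix e :: real assume e: "0 < e"
    obtain \<tau> where \<tau>: "0 < \<tau>" and
      small: "\<And>f g. f \<in> borel_measurable borel \<Longrightarrow> g \<in> borel_measurable borel \<Longrightarrow> (\<And>x. \<bar>f x\<bar> \<le> B) \<Longrightarrow>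
       (\<And>x. \<bar>g x\<bar> \<le> B) \<Longrightarrow> integral {-R..R} (\<lambda>x. \<bar>f x - g x\<bar>) \<le> \<tau> \<Longrightarrow> Lp_dist p K f g < e"
      using Lp_dist_small[OF p B e K R(2)] by blast
    show "\<forall>\<^sub>F i in F. dist (Lp_dist p K (f i) g) 0 < e"
      using f order_tendstoD(2)[OF lim[OF R(1)] \<tau>]
    proof eventually_elim
      case (elim i)
      have "Lp_dist p K (f i) g < e" by (rule small) (use elim g in auto)
      then show ?case by (simp add: Lp_dist_def)
    qed
  qed
qed

lemma shock_in_C_Lp_loc:
  assumes p: "1 \<le> p" and c: "continuous_on {0..T} c"
  shows "(\<lambda>t x. if x \<le> c t then 1 else 0) \<in> C_Lp_loc T p"
proof -
  have meas: "(\<lambda>x. if x \<le> c t then 1 else 0 :: real) \<in> borel_measurable borel" for t by measurable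
  have "tendsto_Lp_loc p (\<lambda>t x. if x \<le> c t then 1 else 0) (\<lambda>x. if x \<le> c t then 1 else 0) (at t within {0..T})"
    if t: "t \<in> {0..T}" for t
  proof (rule tendsto_Lp_loc_from_L1[OF p zero_less_one meas])
    fix R :: real
    have ct: "(c \<longlongrightarrow> c t) (at t within {0..T})" using c t by (auto simp: continuous_on_def)
    have le: "\<bar>integral {-R..R} (\<lambda>x. \<bar>(if x \<le> c r then 1 else 0) - (if x \<le> c t then 1 else 0 :: real)\<bar>)\<bar> \<le> \<bar>c r - c t\<bar>" for r
    proof -
      let ?d = "\<lambda>x. \<bar>(if x \<le> c r then 1 else 0) - (if x \<le> c t then 1 else 0 :: real)\<bar>"
      let ?I = "indicat_real {min (c r) (c t)..max (c r) (c t)}"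
      have int: "?d integrable_on {-R..R}"
        by (rule set_borel_integral_eq_integral(1)[OF bounded_set_integrable[where B = 1]]) auto
      have "0 \<le> integral {-R..R} ?d" by (rule integral_nonneg[OF int]) simp
      moreover have "integral {-R..R} ?d \<le> integral {-R..R} ?I"
        by (rule integral_le[OF int integral_indicator_Icc_le(1)]) (auto simp: indicator_def)
      moreover have "integral {-R..R} ?I \<le> max (c r) (c t) - min (c r) (c t)"
        by (rule integral_indicator_Icc_le(2)) simp
      ultimately show ?thesis by simp
    qed
    show "((\<lambda>r. integral {-R..R} (\<lambda>x. \<bar>(if x \<le> c r then 1 else 0) - (if x \<le> c t then 1 else 0 :: real)\<bar>)) \<longlongrightarrow> 0) (at t within {0..T})"
    proof (rule Lim_null_comparison)
      show "((\<lambda>r. \<bar>c r - c t\<bar>) \<longlongrightarrow> 0) (at t within {0..T})"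
        using ct by (auto intro!: tendsto_eq_intros)
      show "\<forall>\<^sub>F r in at t within {0..T}.
          norm (integral {-R..R} (\<lambda>x. \<bar>(if x \<le> c r then 1 else 0) - (if x \<le> c t then 1 else 0 :: real)\<bar>)) \<le> \<bar>c r - c t\<bar>"
        unfolding real_norm_def by (rule always_eventually, rule allI, rule le)
    qed
  qed (auto intro!: always_eventually)
  moreover have "(\<lambda>x. if x \<le> c t then 1 else 0) \<in> Lp_loc p" for t
    using p meas by (intro bounded_in_Lp_loc[where B = 1]) auto
  ultimately show ?thesis by (simp add: C_Lp_loc_def)
qed

lemma bounded_continuous_in_C_Lp_loc:
  assumes p: "1 \<le> p" and u: "continuous_on ({0..T} \<times> UNIV) (\<lambda>(t, x). u t x)"
    and B: "0 < B" "\<And>t x. t \<in> {0..T} \<Longrightarrow> \<bar>u t x\<bar> \<le> B"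
  shows "u \<in> C_Lp_loc T p"
proof -
  have meas: "u t \<in> borel_measurable borel" if "t \<in> {0..T}" for t
    by (rule borel_measurable_continuous_onI[OF continuous_on_slice_x[OF u that]])
  have "tendsto_Lp_loc p u (u t) (at t within {0..T})" if t: "t \<in> {0..T}" for t
  proof (rule tendsto_Lp_loc_from_L1[OF p B(1) meas[OF t] B(2)[OF t]])
    show "\<forall>\<^sub>F r in at t within {0..T}. u r \<in> borel_measurable borel \<and> (\<forall>x. \<bar>u r x\<bar> \<le> B)"
      using meas B by (simp add: eventually_at_filter)
    fix R :: real
    have ut: "continuous_on ({0..T} \<times> cbox (-R) R) (\<lambda>p. u t (snd p))"
      by (rule continuous_on_compose2[OF continuous_on_slice_x[OF u t, of UNIV]]) (auto intro: continuous_on_snd)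
    have up: "continuous_on ({0..T} \<times> cbox (-R) R) (\<lambda>p. u (fst p) (snd p))"
      by (rule continuous_on_subset[OF u[unfolded split_beta]]) auto
    have "continuous_on {0..T} (\<lambda>r. integral (cbox (-R) R) (\<lambda>x. \<bar>u r x - u t x\<bar>))"
      by (rule integral_continuous_on_param) (unfold split_beta, intro continuous_intros ut up)
    then have "((\<lambda>r. integral (cbox (-R) R) (\<lambda>x. \<bar>u r x - u t x\<bar>)) \<longlongrightarrow>
        integral (cbox (-R) R) (\<lambda>x. \<bar>u t x - u t x\<bar>)) (at t within {0..T})"
      using t unfolding continuous_on_def by blast
    then show "((\<lambda>r. integral {-R..R} (\<lambda>x. \<bar>u r x - u t x\<bar>)) \<longlongrightarrow> 0) (at t within {0..T})" by simp
  qed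
  moreover have "u t \<in> Lp_loc p" if "t \<in> {0..T}" for t
    using p meas[OF that] B(2)[OF that] by (intro bounded_in_Lp_loc[where B = B]) auto
  ultimately show ?thesis by (simp add: C_Lp_loc_def)
qed

text \<open>
  Boundedness reduces both the membership in the space of continuous curves and the uniform
  convergence to estimates in mean.
\<close>

lemma vanishing_viscosity_limit:
  assumes F: "vanishing_viscosity_family T \<theta> M u"
    and c: "continuous_on {0..T} c" "continuous_on {0..T} c'" "c T = 0"
    and Dc: "\<And>t. t \<in> {0<..<T} \<Longrightarrow> (c has_real_derivative c' t) (at t)"
    and sp: "\<And>t. t \<in> {0..T} \<Longrightarrow> speed (\<theta> t) = - c' t"
    and p: "1 \<le> p"
  shows "tendsto_C_Lp_loc T p u (\<lambda>t x. if x \<le> c t then 1 else 0) (at_right 0)"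
  unfolding tendsto_C_Lp_loc_def
proof (intro conjI allI impI)
  have M: "1 \<le> M"
    and good: "\<forall>\<^sub>F \<epsilon> in at_right 0. 0 < \<epsilon> \<and> (\<exists>ux uxx. regular_solution T \<epsilon> \<theta> (u \<epsilon>) ux uxx) \<and>
        (\<forall>t\<in>{0..T}. \<forall>x. \<bar>u \<epsilon> t x\<bar> \<le> M)"
    using F by (auto simp: vanishing_viscosity_family_def)
  have M0: "0 < M" using M by simp
  show "(\<lambda>t x. if x \<le> c t then 1 else 0) \<in> C_Lp_loc T p"
    by (rule shock_in_C_Lp_loc[OF p c(1)])
  show "\<forall>\<^sub>F \<epsilon> in at_right 0. u \<epsilon> \<in> C_Lp_loc T p"
    using good
  proof eventually_elim
    case (elim \<epsilon>)
    then obtain ux uxx where "regular_solution T \<epsilon> \<theta> (u \<epsilon>) ux uxx" by blast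
    then have "continuous_on ({0..T} \<times> UNIV) (\<lambda>(t, x). u \<epsilon> t x)" by (simp add: regular_solution_def)
    then show ?case by (rule bounded_continuous_in_C_Lp_loc[OF p _ M0]) (use elim in blast)
  qed
  fix K :: "real set" assume K: "compact K"
  obtain R where R: "0 \<le> R" "K \<subseteq> {-R..R}" using compact_subset_symmetric_Icc[OF K] .
  show "uniform_limit {0..T} (\<lambda>\<epsilon> t. Lp_dist p K (u \<epsilon> t) (\<lambda>x. if x \<le> c t then 1 else 0)) (\<lambda>t. 0) (at_right 0)"
    unfolding uniform_limit_iff
  proof (intro allI impI)
    fix e :: real assume e: "0 < e"
    obtain \<tau> where \<tau>: "0 < \<tau>" and
      small: "\<And>f g. f \<in> borel_measurable borel \<Longrightarrow> g \<in> borel_measurable borel \<Longrightarrow> (\<And>x. \<bar>f x\<bar> \<le> M) \<Longrightarrow>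
       (\<And>x. \<bar>g x\<bar> \<le> M) \<Longrightarrow> integral {-R..R} (\<lambda>x. \<bar>f x - g x\<bar>) \<le> \<tau> \<Longrightarrow> Lp_dist p K f g < e"
      using Lp_dist_small[OF p M0 e K R(2)] by blast
    have conv: "\<forall>\<^sub>F \<epsilon> in at_right 0. \<forall>t\<in>{0..T}. integral {-R..R} (\<lambda>x. \<bar>u \<epsilon> t x - (if x \<le> c t then 1 else 0)\<bar>) \<le> \<tau>"
      by (rule L1_convergence_to_shock[OF F c Dc sp R(1) \<tau>])
    show "\<forall>\<^sub>F \<epsilon> in at_right 0. \<forall>t\<in>{0..T}. dist (Lp_dist p K (u \<epsilon> t) (\<lambda>x. if x \<le> c t then 1 else 0)) 0 < e"
      using good conv
    proof eventually_elim
      case (elim \<epsilon>)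
      then obtain ux uxx where reg: "regular_solution T \<epsilon> \<theta> (u \<epsilon>) ux uxx" by blast
      show ?case
      proof
        fix t assume t: "t \<in> {0..T}"
        have "Lp_dist p K (u \<epsilon> t) (\<lambda>x. if x \<le> c t then 1 else 0) < e"
        proof (rule small)
          show "u \<epsilon> t \<in> borel_measurable borel"
            by (rule borel_measurable_continuous_onI[OF regular_solution_continuous[OF reg t]])
          show "\<bar>u \<epsilon> t x\<bar> \<le> M" for x using elim(1) t by blast
          show "integral {-R..R} (\<lambda>x. \<bar>u \<epsilon> t x - (if x \<le> c t then 1 else 0)\<bar>) \<le> \<tau>"
            using elim(2) t by blast
        qed (use M in auto)
        then show "dist (Lp_dist p K (u \<epsilon> t) (\<lambda>x. if x \<le> c t then 1 else 0)) 0 < e"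
          by (simp add: Lp_dist_def)
      qed
    qed
  qed
qed

lemma vanishing_viscosity_familyI:
  assumes T: "0 < T" and \<theta>: "continuous_on {0..T} \<theta>"
    and bounded: "eventually_uniformly_bounded uT (at_right 0)"
    and lim: "tendsto_Lp_loc 1 uT (indicator {..<0}) (at_right 0)"
    and sol: "\<And>\<epsilon>. 0 < \<epsilon> \<Longrightarrow> classical_solution T \<epsilon> \<theta> (uT \<epsilon>) (u \<epsilon>)"
  obtains M where "vanishing_viscosity_family T \<theta> M u"
proof -
  obtain M0 where M0: "\<forall>\<^sub>F \<epsilon> in at_right 0. \<forall>x. \<bar>uT \<epsilon> x\<bar> \<le> M0"
    using bounded by (auto simp: eventually_uniformly_bounded_def)
  define M where "M = max 1 M0"
  have pos: "\<forall>\<^sub>F \<epsilon> in at_right (0::real). 0 < \<epsilon>" by (simp add: eventually_at_filter)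
  have uT: "u \<epsilon> T x = uT \<epsilon> x" if "0 < \<epsilon>" for \<epsilon> x
    using sol[OF that] by (simp add: classical_solution_def)
  have T': "T \<in> {0..T}" using T by simp
  have good: "\<forall>\<^sub>F \<epsilon> in at_right 0. 0 < \<epsilon> \<and> (\<exists>ux uxx. regular_solution T \<epsilon> \<theta> (u \<epsilon>) ux uxx) \<and>
        (\<forall>t\<in>{0..T}. \<forall>x. \<bar>u \<epsilon> t x\<bar> \<le> M)"
    using pos M0
  proof eventually_elim
    case (elim \<epsilon>)
    obtain ux uxx where reg: "regular_solution T \<epsilon> \<theta> (u \<epsilon>) ux uxx"
      using classical_solution_regular[OF sol[OF elim(1)] \<theta>] .
    have "\<exists>B. \<forall>t\<in>{0..T}. \<forall>x. \<bar>u \<epsilon> t x\<bar> \<le> B"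
      using sol[OF elim(1)] unfolding classical_solution_def by (elim conjE)
    then obtain B where B: "\<And>t x. t \<in> {0..T} \<Longrightarrow> \<bar>u \<epsilon> t x\<bar> \<le> B" by blast
    have "\<bar>u \<epsilon> T x\<bar> \<le> M" for x
      using elim(2)[rule_format, of x] uT[OF elim(1), of x] by (simp add: M_def)
    then have "\<bar>u \<epsilon> t x\<bar> \<le> M" if "t \<in> {0..T}" for t x
      by (intro maximum_principle[OF T reg _ \<theta> B _ _ that]) (use elim M_def in auto)
    then show ?case using elim reg by blast
  qed
  have "((\<lambda>\<epsilon>. integral {-X..X} (\<lambda>x. \<bar>u \<epsilon> T x - indicator {..<0} x\<bar>)) \<longlongrightarrow> 0) (at_right 0)" for X
  proof (rule Lim_transform_eventually)
    show "((\<lambda>\<epsilon>. Lp_dist 1 {-X..X} (uT \<epsilon>) (indicator {..<0})) \<longlongrightarrow> 0) (at_right 0)"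
      using lim by (simp add: tendsto_Lp_loc_def)
    show "\<forall>\<^sub>F \<epsilon> in at_right 0. Lp_dist 1 {-X..X} (uT \<epsilon>) (indicator {..<0})
        = integral {-X..X} (\<lambda>x. \<bar>u \<epsilon> T x - indicator {..<0} x\<bar>)"
      using good
    proof eventually_elim
      case (elim \<epsilon>)
      then obtain ux uxx where reg: "regular_solution T \<epsilon> \<theta> (u \<epsilon>) ux uxx" by blast
      let ?d = "\<lambda>x. \<bar>u \<epsilon> T x - indicat_real {..<0} x\<bar>"
      have meas: "?d \<in> borel_measurable borel"
        using borel_measurable_continuous_onI[OF regular_solution_continuous[OF reg T']] by measurable
      have "\<bar>?d x\<bar> \<le> M + 1" for x
      proof -
        have "\<bar>u \<epsilon> T x\<bar> \<le> M" using elim T' by blast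
        then show ?thesis by (auto simp: indicator_def)
      qed
      from bounded_set_integrable[OF meas this compact_Icc]
      have "(LINT x:{-X..X}|lborel. ?d x) = integral {-X..X} ?d"
        by (rule set_borel_integral_eq_integral(2))
      moreover have "0 \<le> (LINT x:{-X..X}|lborel. ?d x)"
        unfolding set_lebesgue_integral_def by simp
      moreover have "\<bar>uT \<epsilon> x - indicat_real {..<0} x\<bar> powr 1 = ?d x" for x
        using uT elim by simp
      ultimately show ?case by (simp add: Lp_dist_def)
    qed
  qed
  then have "vanishing_viscosity_family T \<theta> M u"
    unfolding vanishing_viscosity_family_def using T \<theta> good by (auto simp: M_def)
  then show ?thesis using that by blast
qed

theorem theorem1p4:
  fixes T :: real and c c' :: "real \<Rightarrow> real"
  assumes "T > 0"
    and "c \<in> W21 T"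
    and "\<forall>t\<in>{0..T}. (c has_real_derivative c' t) (at t within {0..T})"
    and "c T = 0"
    and "\<forall>t\<in>{0..T}. - c' t \<in> {0<..<1}"
  shows "\<exists>\<theta> :: real \<Rightarrow> real. set_integrable lborel {0..T} \<theta> \<and>
    (\<forall>(uT :: real \<Rightarrow> real \<Rightarrow> real) (u :: real \<Rightarrow> real \<Rightarrow> real \<Rightarrow> real).
       (\<forall>\<epsilon>>0. smooth (uT \<epsilon>)) \<and>
       eventually_uniformly_bounded uT (at_right 0) \<and>
       tendsto_Lp_loc 1 uT (indicator {..<0}) (at_right 0) \<and>
       (\<forall>\<epsilon>>0. unique_classical_solution T \<epsilon> \<theta> (uT \<epsilon>) (u \<epsilon>))
       \<longrightarrow> (\<forall>p\<ge>1. tendsto_C_Lp_loc T p u (\<lambda>t x. if x \<le> c t then 1 else 0) (at_right 0)))"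
proof -
  have D: "\<And>t. t \<in> {0..T} \<Longrightarrow> (c has_real_derivative c' t) (at t within {0..T})"
    using assms(3) by blast
  have c'_cont: "continuous_on {0..T} c'"
    by (rule W21_continuous_derivative[OF assms(2) D])
  have c_cont: "continuous_on {0..T} c"
    by (rule DERIV_continuous_on[OF D])
  have D_interior: "(c has_real_derivative c' t) (at t)" if "t \<in> {0<..<T}" for t
    using D[of t] that at_within_Icc_at[of 0 t T] by simp
  have "continuous_on {0..T} (\<lambda>t. - c' t)" using c'_cont by (rule continuous_on_minus)
  moreover have "0 < - c' t \<and> - c' t < 1" if "t \<in> {0..T}" for t
    using bspec[OF assms(5) that] by simp
  ultimately have "\<exists>\<theta>. continuous_on {0..T} \<theta> \<and> (\<forall>t\<in>{0..T}. speed (\<theta> t) = - c' t)"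
    by (rule continuous_coefficient)
  then obtain \<theta> where \<theta>: "continuous_on {0..T} \<theta>" and sp: "\<And>t. t \<in> {0..T} \<Longrightarrow> speed (\<theta> t) = - c' t"
    by blast
  show ?thesis
  proof (intro exI conjI allI impI)
    show "set_integrable lborel {0..T} \<theta>" by (rule borel_integrable_atLeastAtMost'[OF \<theta>])
    fix uT u and p :: real
    assume H: "(\<forall>\<epsilon>>0. smooth (uT \<epsilon>)) \<and>
       eventually_uniformly_bounded uT (at_right 0) \<and>
       tendsto_Lp_loc 1 uT (indicator {..<0}) (at_right 0) \<and>
       (\<forall>\<epsilon>>0. unique_classical_solution T \<epsilon> \<theta> (uT \<epsilon>) (u \<epsilon>))" and p: "1 \<le> p"
    have "classical_solution T \<epsilon> \<theta> (uT \<epsilon>) (u \<epsilon>)" if "0 < \<epsilon>" for \<epsilon>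
      using H that unfolding unique_classical_solution_def by blast
    moreover have "eventually_uniformly_bounded uT (at_right 0)" "tendsto_Lp_loc 1 uT (indicator {..<0}) (at_right 0)"
      using H by blast+
    ultimately obtain M where "vanishing_viscosity_family T \<theta> M u"
      using vanishing_viscosity_familyI[OF assms(1) \<theta>] by metis
    then show "tendsto_C_Lp_loc T p u (\<lambda>t x. if x \<le> c t then 1 else 0) (at_right 0)"
      by (rule vanishing_viscosity_limit[OF _ c_cont c'_cont assms(4) D_interior sp p])
  qed
qed

end
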